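(* Let $\lambda\ge0$, let $\boldsymbol{M}^T$ be a matrix with $r$ rows and $k+1$ columns of full row rank, $\mathrm{rank}(\boldsymbol{M})=r$, and let $\boldsymbol{m}$ be a vector of order $r$ of specified constants. Let $(\boldsymbol{X}_1,Y_1),\dots,(\boldsymbol{X}_n,Y_n)$ be independent and identically distributed from the logistic regression model with random covariates and true parameter $\boldsymbol{\beta}_0$. The asymptotic distribution (as $n\to\infty$) of the Wald-type test statistic $$W_n=n(\boldsymbol{M}^T\widehat{\boldsymbol{\beta}}_\lambda-\boldsymbol{m})^T\left(\boldsymbol{M}^T\boldsymbol{\Sigma}_\lambda(\widehat{\boldsymbol{\beta}}_\lambda)\boldsymbol{M}\right)^{-1}(\boldsymbol{M}^T\widehat{\boldsymbol{\beta}}_\lambda-\boldsymbol{m}),$$ under the null hypothesis $H_0:\boldsymbol{M}^T\boldsymbol{\beta}=\boldsymbol{m}$ (that is, $\boldsymbol{M}^T\boldsymbol{\beta}_0=\boldsymbol{m}$), is a chi-square distribution with $r$ degrees of freedom.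
   Context: Model: $\boldsymbol{X}_1,\dots,\boldsymbol{X}_n$ is a random sample of a random vector $\boldsymbol{X}$ in $\mathbb{R}^{k+1}$ (first coordinate equal to 1) with marginal distribution function $H$ and support $\mathcal{X}$; given $\boldsymbol{X}_i=\boldsymbol{x}$, $Y_i\in\{0,1\}$ with $\Pr(Y_i=1\mid\boldsymbol{X}_i=\boldsymbol{x})=\pi(\boldsymbol{x}^T\boldsymbol{\beta}_0)$, $\pi(s)=e^s/(1+e^s)$, $\boldsymbol{\beta}_0\in\mathbb{R}^{k+1}$. The design matrix (with rows the observed covariate vectors $\boldsymbol{x}_i^T$) is assumed of full rank $k+1$, with $k<n$. Estimator: for $\lambda>0$, the minimum density power divergence estimator $\widehat{\boldsymbol{\beta}}_\lambda$ minimizes over $\boldsymbol{\beta}\in\mathbb{R}^{k+1}$ $$\frac{1}{n^{1+\lambda}}\Big\{\sum_{i=1}^n\Big(\pi^{1+\lambda}(\boldsymbol{x}_i^T\boldsymbol{\beta})+(1-\pi(\boldsymbol{x}_i^T\boldsymbol{\beta}))^{1+\lambda}-(1+\tfrac1\lambda)\big(y_i\pi^\lambda(\boldsymbol{x}_i^T\boldsymbol{\beta})+(1-y_i)(1-\pi(\boldsymbol{x}_i^T\boldsymbol{\beta}))^\lambda\big)\Big)+\tfrac n\lambda\Big\};$$ for $\lambda=0$ it is the maximum likelihood estimator. Matrices: $\boldsymbol{\Sigma}_\lambda(\boldsymbol{\beta})=\boldsymbol{J}_\lambda^{-1}(\boldsymbol{\beta})\boldsymbol{K}_\lambda(\boldsymbol{\beta})\boldsymbol{J}_\lambda^{-1}(\boldsymbol{\beta})$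 with $$\boldsymbol{J}_\lambda(\boldsymbol{\beta})=\int_{\mathcal{X}}\frac{e^{\lambda\boldsymbol{x}^T\boldsymbol{\beta}}+e^{\boldsymbol{x}^T\boldsymbol{\beta}}}{(1+e^{\boldsymbol{x}^T\boldsymbol{\beta}})^{\lambda+3}}e^{\boldsymbol{x}^T\boldsymbol{\beta}}\boldsymbol{x}\boldsymbol{x}^T\,dH(\boldsymbol{x}),\qquad \boldsymbol{K}_\lambda(\boldsymbol{\beta})=\int_{\mathcal{X}}\frac{(e^{\lambda\boldsymbol{x}^T\boldsymbol{\beta}}+e^{\boldsymbol{x}^T\boldsymbol{\beta}})^2}{(1+e^{\boldsymbol{x}^T\boldsymbol{\beta}})^{2(\lambda+2)}}e^{\boldsymbol{x}^T\boldsymbol{\beta}}\boldsymbol{x}\boldsymbol{x}^T\,dH(\boldsymbol{x}).$$ *)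

theory Defs
  imports "HOL-Probability.Probability"
begin

definition logistic :: "real \<Rightarrow> real" where
  "logistic s = exp s / (1 + exp s)"

(* Covariates and parameters live in real^'p with CARD('p) = k+1; the label i0 marks the
   coordinate of the intercept.  H is the marginal law of the covariates.  The laws of the pairs
   (X i, Y i) coincide for all i, being determined by H and by the conditional law of Y i. *)
locale logistic_regression_sample = prob_space P
  for P :: "'a measure" +
  fixes X :: "nat \<Rightarrow> 'a \<Rightarrow> real ^ 'p" and Y :: "nat \<Rightarrow> 'a \<Rightarrow> real"
    and H :: "(real ^ 'p) measure" and i0 :: 'p and \<beta>0 :: "real ^ 'p"
  assumes indep: "indep_vars (\<lambda>_. borel) (\<lambda>i \<omega>. (X i \<omega>, Y i \<omega>)) UNIV"
    and X_measurable: "\<And>i. X i \<in> borel_measurable P"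
    and Y_measurable: "\<And>i. Y i \<in> borel_measurable P"
    and X_distr: "\<And>i. distr P borel (X i) = H"
    and intercept: "\<And>i. AE \<omega> in P. X i \<omega> $ i0 = 1"
    and Y_binary: "\<And>i. AE \<omega> in P. Y i \<omega> \<in> {0, 1}"
    and Y_cond: "\<And>i. AE \<omega> in P.
      real_cond_exp P (vimage_algebra (space P) (X i) borel)
        (indicator {\<omega> \<in> space P. Y i \<omega> = 1}) \<omega> = logistic (X i \<omega> \<bullet> \<beta>0)"

definition dpd_objective ::
    "real \<Rightarrow> nat \<Rightarrow> (nat \<Rightarrow> real ^ 'p) \<Rightarrow> (nat \<Rightarrow> real) \<Rightarrow> real ^ 'p \<Rightarrow> real" where
  "dpd_objective l n x y \<beta> = 1 / real n powr (1 + l) *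
     ((\<Sum>i<n. logistic (x i \<bullet> \<beta>) powr (1 + l) + (1 - logistic (x i \<bullet> \<beta>)) powr (1 + l)
        - (1 + 1 / l) * (y i * logistic (x i \<bullet> \<beta>) powr l
                         + (1 - y i) * (1 - logistic (x i \<bullet> \<beta>)) powr l))
      + real n / l)"

definition likelihood ::
    "nat \<Rightarrow> (nat \<Rightarrow> real ^ 'p) \<Rightarrow> (nat \<Rightarrow> real) \<Rightarrow> real ^ 'p \<Rightarrow> real" where
  "likelihood n x y \<beta> =
     (\<Prod>i<n. logistic (x i \<bullet> \<beta>) powr y i * (1 - logistic (x i \<bullet> \<beta>)) powr (1 - y i))"

definition is_mdpde ::
    "real \<Rightarrow> nat \<Rightarrow> (nat \<Rightarrow> real ^ 'p) \<Rightarrow> (nat \<Rightarrow> real) \<Rightarrow> real ^ 'p \<Rightarrow> bool" where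
  "is_mdpde l n x y b =
     (if l = 0 then is_arg_max (likelihood n x y) (\<lambda>_. True) b
      else is_arg_min (dpd_objective l n x y) (\<lambda>_. True) b)"

(* The number of rows varies with n, so the design matrix is represented by its list of rows
   x 0, ..., x (n-1); the expression below is what the library's rank unfolds to. *)
definition design_rank :: "nat \<Rightarrow> (nat \<Rightarrow> real ^ 'p) \<Rightarrow> nat" where
  "design_rank n x = dim (x ` {..<n})"

definition measure_support :: "'b::topological_space measure \<Rightarrow> 'b set" where
  "measure_support H = {x. \<forall>U. open U \<longrightarrow> x \<in> U \<longrightarrow> emeasure H U > 0}"

definition J_integrand :: "real \<Rightarrow> real ^ 'p \<Rightarrow> real ^ 'p \<Rightarrow> real ^ 'p ^ 'p" where
  "J_integrand l \<beta> x =
     ((exp (l * (x \<bullet> \<beta>)) + exp (x \<bullet> \<beta>)) / (1 + exp (x \<bullet> \<beta>)) powr (l + 3) * exp (x \<bullet> \<beta>))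
       *\<^sub>R (\<chi> i j. x $ i * x $ j)"

definition K_integrand :: "real \<Rightarrow> real ^ 'p \<Rightarrow> real ^ 'p \<Rightarrow> real ^ 'p ^ 'p" where
  "K_integrand l \<beta> x =
     ((exp (l * (x \<bullet> \<beta>)) + exp (x \<bullet> \<beta>))\<^sup>2 / (1 + exp (x \<bullet> \<beta>)) powr (2 * (l + 2)) * exp (x \<bullet> \<beta>))
       *\<^sub>R (\<chi> i j. x $ i * x $ j)"

definition J_mat :: "(real ^ 'p) measure \<Rightarrow> real \<Rightarrow> real ^ 'p \<Rightarrow> real ^ 'p ^ 'p" where
  "J_mat H l \<beta> = (LINT x:measure_support H|H. J_integrand l \<beta> x)"

definition K_mat :: "(real ^ 'p) measure \<Rightarrow> real \<Rightarrow> real ^ 'p \<Rightarrow> real ^ 'p ^ 'p" where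
  "K_mat H l \<beta> = (LINT x:measure_support H|H. K_integrand l \<beta> x)"

definition Sigma_mat :: "(real ^ 'p) measure \<Rightarrow> real \<Rightarrow> real ^ 'p \<Rightarrow> real ^ 'p ^ 'p" where
  "Sigma_mat H l \<beta> = matrix_inv (J_mat H l \<beta>) ** K_mat H l \<beta> ** matrix_inv (J_mat H l \<beta>)"

definition wald_statistic ::
    "(real ^ 'p) measure \<Rightarrow> real \<Rightarrow> real ^ 'r ^ 'p \<Rightarrow> real ^ 'r \<Rightarrow> nat \<Rightarrow> real ^ 'p \<Rightarrow> real" where
  "wald_statistic H l M m n b = real n *
     ((transpose M *v b - m) \<bullet>
      (matrix_inv (transpose M ** Sigma_mat H l b ** M) *v (transpose M *v b - m)))"

(* The law of the sum of squares of d independent standard normal variables. *)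
definition chi_square :: "nat \<Rightarrow> real measure" where
  "chi_square d = distr (\<Pi>\<^sub>M i\<in>{..<d}. density lborel (\<lambda>z. ennreal (std_normal_density z))) borel
     (\<lambda>z. \<Sum>i<d. (z i)\<^sup>2)"

end

theory Submission
  imports Defs
begin

text \<open>
  For all \<open>l \<ge> 0\<close> the estimator minimises an empirical mean of losses whose derivative is
  \<open>h (x \<bullet> \<beta>) (logistic (x \<bullet> \<beta>) - y)\<close> with \<open>h > 0\<close>.

  Consistency: the excess loss splits into a part \<open>d (x \<bullet> \<beta>)\<close> that increases along rays from \<open>\<beta>0\<close>,
  so that a lower bound on a sphere extends to its exterior, and the noise part
  \<open>(y - logistic (x \<bullet> \<beta>0)) r (x \<bullet> \<beta>)\<close>.  For \<open>l > 0\<close> the function \<open>r\<close> is bounded and monotone, and the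
  noise part is uniformly small because the functions \<open>r (x \<bullet> \<beta>)\<close> admit finitely many brackets; for
  \<open>l = 0\<close> it is linear in \<open>\<beta>\<close> while the other part grows at least linearly.  Hence a minimiser exists
  near \<open>\<beta>0\<close> with probability tending to one.

  Limit law: linearising the score equation shows that the Wald statistic differs by a vanishing
  amount from a quadratic form in the score at \<open>\<beta>0\<close>, which is a sum of \<open>r\<close> squares of asymptotically
  orthonormal linear statistics.  The one-dimensional central limit theorem gives the limits of all
  characteristic functions, and a Gaussian mixture turns them into Laplace transforms of the sum of
  squares, which determine the chi-square limit.
\<close>

text \<open>Three obstacles shape the argument. The parameter ranges over a whole Euclidean space
  and a minimiser need not exist on every sample, so uniform control must reach infinity. For
  \<open>l > 0\<close> each summand of the loss is bounded, hence neither convex nor coercive, and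
  \<open>H\<close> may charge hyperplanes, on which ridge functions need not approach their limits
  however large \<beta> is. The bracketing is therefore an induction on the dimension of subspaces
  that peels off one hyperplane per direction at infinity. Second, the available moments are second
  moments of the covariates; they come from the integrand of \<open>J\<close> at the parameter zero,
  where its weight is constant. A cubic remainder would not be integrable in general, so the
  remainder is cut off at 1 and treated by dominated convergence. Third, the estimator also enters
  through an inverted matrix. The resulting error is an arbitrarily small multiple of
  \<open>n\<close> times the squared norm of the average score, whose mean is bounded in
  \<open>n\<close>, so Markov's inequality finishes. Orthonormal vectors for the form of the middle
  matrix do the work of its inverse square root.\<close>

section \<open>Convergence with high probability and the law of large numbers\<close>

text \<open>Convergence of inner probabilities to one, so that \<open>Q n\<close> need not be measurable.\<close>
definition (in prob_space) whp :: "(nat \<Rightarrow> 'a \<Rightarrow> bool) \<Rightarrow> bool" where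
  "whp Q \<longleftrightarrow> (\<forall>\<epsilon>>0. \<forall>\<^sub>F n in sequentially. \<exists>A\<in>events. prob A \<ge> 1 - \<epsilon> \<and> (\<forall>\<omega>\<in>A. Q n \<omega>))"

context prob_space
begin

lemma whp_mono_eventually:
  assumes "whp Q" "\<forall>\<^sub>F n in sequentially. \<forall>\<omega>\<in>space M. Q n \<omega> \<longrightarrow> R n \<omega>"
  shows "whp R"
  unfolding whp_def
proof (intro allI impI)
  fix \<epsilon> :: real assume "\<epsilon> > 0"
  then have "\<forall>\<^sub>F n in sequentially. \<exists>A\<in>events. prob A \<ge> 1 - \<epsilon> \<and> (\<forall>\<omega>\<in>A. Q n \<omega>)"
    using assms(1) by (auto simp: whp_def)
  with assms(2) show "\<forall>\<^sub>F n in sequentially. \<exists>A\<in>events. prob A \<ge> 1 - \<epsilon> \<and> (\<forall>\<omega>\<in>A. R n \<omega>)"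
    by eventually_elim (meson sets.sets_into_space subsetD)
qed

lemma whp_mono:
  assumes "whp Q" "\<And>n \<omega>. \<omega> \<in> space M \<Longrightarrow> Q n \<omega> \<Longrightarrow> R n \<omega>"
  shows "whp R"
  using assms by (auto intro: whp_mono_eventually)

lemma whp_conj:
  assumes "whp Q" "whp R"
  shows "whp (\<lambda>n \<omega>. Q n \<omega> \<and> R n \<omega>)"
  unfolding whp_def
proof (intro allI impI)
  fix \<epsilon> :: real assume "\<epsilon> > 0"
  then have "\<epsilon> / 2 > 0" by simp
  with assms have
    "\<forall>\<^sub>F n in sequentially. \<exists>A\<in>events. prob A \<ge> 1 - \<epsilon> / 2 \<and> (\<forall>\<omega>\<in>A. Q n \<omega>)"
    "\<forall>\<^sub>F n in sequentially. \<exists>A\<in>events. prob A \<ge> 1 - \<epsilon> / 2 \<and> (\<forall>\<omega>\<in>A. R n \<omega>)"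
    unfolding whp_def by blast+
  then show "\<forall>\<^sub>F n in sequentially. \<exists>A\<in>events. prob A \<ge> 1 - \<epsilon> \<and> (\<forall>\<omega>\<in>A. Q n \<omega> \<and> R n \<omega>)"
  proof eventually_elim
    case (elim n)
    then obtain A B where AB: "A \<in> events" "B \<in> events" "prob A \<ge> 1 - \<epsilon> / 2" "prob B \<ge> 1 - \<epsilon> / 2"
      "\<forall>\<omega>\<in>A. Q n \<omega>" "\<forall>\<omega>\<in>B. R n \<omega>" by auto
    have "prob (A \<union> B) = prob A + prob B - prob (A \<inter> B)"
      using AB by (simp add: finite_measure_Union' finite_measure_Diff' Int_commute)
    moreover have "prob (A \<union> B) \<le> 1" by simp
    ultimately have "prob (A \<inter> B) \<ge> 1 - \<epsilon>" using AB by linarith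
    then show ?case using AB by (intro bexI[of _ "A \<inter> B"]) auto
  qed
qed

lemma whp_True [simp]: "whp (\<lambda>n \<omega>. True)"
  unfolding whp_def by (auto intro!: always_eventually bexI[of _ "space M"] simp: prob_space)

lemma whp_AE:
  assumes "\<And>n. AE \<omega> in M. Q n \<omega>"
  shows "whp Q"
  unfolding whp_def
proof (intro allI impI always_eventually)
  fix \<epsilon> :: real and n assume "\<epsilon> > 0"
  obtain N where N: "{\<omega> \<in> space M. \<not> Q n \<omega>} \<subseteq> N" "N \<in> events" "emeasure M N = 0"
    using AE_E[OF assms[of n]] by blast
  have "prob (space M - N) = 1" using N by (simp add: prob_compl measure_eq_emeasure_eq_ennreal[of 0])
  then show "\<exists>A\<in>events. prob A \<ge> 1 - \<epsilon> \<and> (\<forall>\<omega>\<in>A. Q n \<omega>)"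
    using N \<open>\<epsilon> > 0\<close> by (intro bexI[of _ "space M - N"]) auto
qed

lemma whp_finite_Ball:
  assumes "finite I" "\<And>i. i \<in> I \<Longrightarrow> whp (\<lambda>n \<omega>. Q i n \<omega>)"
  shows "whp (\<lambda>n \<omega>. \<forall>i\<in>I. Q i n \<omega>)"
  using assms by (induction I rule: finite_induct) (auto intro: whp_conj)

lemma whp_Markov:
  fixes F :: "nat \<Rightarrow> 'a \<Rightarrow> real"
  assumes int: "\<And>n. integrable M (F n)" and nonneg: "\<And>n \<omega>. \<omega> \<in> space M \<Longrightarrow> F n \<omega> \<ge> 0"
    and bound: "\<And>\<epsilon>. \<epsilon> > 0 \<Longrightarrow> \<forall>\<^sub>F n in sequentially. expectation (F n) \<le> \<epsilon>" and "\<delta> > 0"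
  shows "whp (\<lambda>n \<omega>. F n \<omega> < \<delta>)"
  unfolding whp_def
proof (intro allI impI)
  fix \<epsilon> :: real assume "\<epsilon> > 0"
  then have "\<forall>\<^sub>F n in sequentially. expectation (F n) \<le> \<delta> * \<epsilon>"
    using \<open>\<delta> > 0\<close> by (intro bound) auto
  then show "\<forall>\<^sub>F n in sequentially. \<exists>A\<in>events. prob A \<ge> 1 - \<epsilon> \<and> (\<forall>\<omega>\<in>A. F n \<omega> < \<delta>)"
  proof eventually_elim
    case (elim n)
    have [measurable]: "F n \<in> borel_measurable M" using int by auto
    have "prob {\<omega>\<in>space M. F n \<omega> \<ge> \<delta>} \<le> expectation (F n) / \<delta>"
      using nonneg \<open>\<delta> > 0\<close> by (intro integral_Markov_inequality_measure[OF int, where A="{}"]) auto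
    also have "\<dots> \<le> \<epsilon>" using elim \<open>\<delta> > 0\<close> by (simp add: field_simps)
    finally have "prob {\<omega>\<in>space M. F n \<omega> \<ge> \<delta>} \<le> \<epsilon>" .
    moreover have "prob {\<omega>\<in>space M. F n \<omega> < \<delta>} = 1 - prob {\<omega>\<in>space M. F n \<omega> \<ge> \<delta>}"
      by (subst prob_compl[symmetric]) (auto intro!: arg_cong[where f=prob])
    ultimately show ?case
      by (intro bexI[of _ "{\<omega>\<in>space M. F n \<omega> < \<delta>}"]) auto
  qed
qed

end

text \<open>Clipping at level \<open>k\<close> is eventually inactive at each point and its error
  never exceeds the absolute value of \<open>f\<close>, so dominated convergence applies.\<close>

lemma clip_tendsto_integral:
  fixes f :: "'b \<Rightarrow> real"
  assumes "integrable D f"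
  shows "(\<lambda>k. \<integral>x. \<bar>f x - max (- real k) (min (real k) (f x))\<bar> \<partial>D) \<longlonglongrightarrow> 0"
proof -
  have [measurable]: "f \<in> borel_measurable D" using assms by auto
  have "(\<lambda>k. \<integral>x. \<bar>f x - max (- real k) (min (real k) (f x))\<bar> \<partial>D) \<longlonglongrightarrow> (\<integral>x. 0 \<partial>D)"
  proof (rule integral_dominated_convergence)
    show "AE x in D. (\<lambda>k. \<bar>f x - max (- real k) (min (real k) (f x))\<bar>) \<longlonglongrightarrow> 0"
    proof (intro AE_I2 tendsto_eventually)
      fix x
      show "\<forall>\<^sub>F k in sequentially. \<bar>f x - max (- real k) (min (real k) (f x))\<bar> = 0"
        using eventually_ge_at_top[of "nat \<lceil>\<bar>f x\<bar>\<rceil>"]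
      proof eventually_elim
        case (elim k)
        then have "\<bar>f x\<bar> \<le> real k" by linarith
        then show ?case by auto
      qed
    qed
    show "integrable D (\<lambda>x. \<bar>f x\<bar>)" using assms by simp
    show "AE x in D. norm \<bar>f x - max (- real k) (min (real k) (f x))\<bar> \<le> \<bar>f x\<bar>" for k
      by (intro AE_I2) auto
  qed auto
  then show ?thesis by simp
qed

text \<open>\<open>D\<close> is both the target space of the variables and their common law, so
  measurability and integrals of \<open>f (Z i)\<close> refer to a single measure.\<close>

locale iid_sequence = prob_space P for P :: "'a measure" +
  fixes Z :: "nat \<Rightarrow> 'a \<Rightarrow> 'b" and D :: "'b measure"
  assumes indep_Z: "indep_vars (\<lambda>_. D) Z UNIV"
    and distr_Z: "\<And>i. distr P D (Z i) = D"
begin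

definition avg :: "('b \<Rightarrow> real) \<Rightarrow> nat \<Rightarrow> 'a \<Rightarrow> real" where
  "avg f n \<omega> = (\<Sum>i<n. f (Z i \<omega>)) / real n"

lemma Z_measurable [measurable]: "Z i \<in> measurable P D"
  using indep_Z by (auto simp: indep_vars_def2)

lemma integrable_Z: 
  fixes f :: "'b \<Rightarrow> 'c::{banach, second_countable_topology}"
  shows "integrable D f \<Longrightarrow> integrable P (\<lambda>\<omega>. f (Z i \<omega>))"
proof -
  assume f: "integrable D f"
  then have [measurable]: "f \<in> borel_measurable D" by auto
  have "integrable (distr P D (Z i)) f" using f by (simp add: distr_Z)
  then show ?thesis by (subst (asm) integrable_distr_eq) auto
qed

lemma integral_Z: 
  fixes f :: "'b \<Rightarrow> 'c::{banach, second_countable_topology}"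
  shows "f \<in> borel_measurable D \<Longrightarrow> (\<integral>\<omega>. f (Z i \<omega>) \<partial>P) = integral\<^sup>L D f"
proof -
  assume [measurable]: "f \<in> borel_measurable D"
  have "integral\<^sup>L (distr P D (Z i)) f = (\<integral>\<omega>. f (Z i \<omega>) \<partial>P)"
    by (rule integral_distr) auto
  then show ?thesis by (simp add: distr_Z)
qed

lemma prob_space_D: "prob_space D"
  by (subst distr_Z[symmetric, of 0], rule prob_space_distr) auto

lemma integrable_avg: "integrable D f \<Longrightarrow> integrable P (avg f n)"
  unfolding avg_def by (auto intro!: integrable_Z)

lemma expectation_avg:
  assumes "integrable D f" "n > 0"
  shows "expectation (avg f n) = integral\<^sup>L D f"
proof -
  have "expectation (avg f n) = (\<Sum>i<n. integral\<^sup>L D f) / real n"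
    unfolding avg_def using assms by (simp add: integrable_Z integral_Z)
  then show ?thesis using assms(2) by simp
qed

lemma avg_abs: "\<bar>avg f n \<omega>\<bar> \<le> avg (\<lambda>z. \<bar>f z\<bar>) n \<omega>"
  unfolding avg_def by (simp add: divide_right_mono)

lemma avg_diff: "avg (\<lambda>z. f z - g z) n \<omega> = avg f n \<omega> - avg g n \<omega>"
  unfolding avg_def by (simp add: sum_subtractf diff_divide_distrib)

lemma avg_add: "avg (\<lambda>z. f z + g z) n \<omega> = avg f n \<omega> + avg g n \<omega>"
  unfolding avg_def by (simp add: sum.distrib add_divide_distrib)

lemma avg_cmult: "avg (\<lambda>z. c * f z) n \<omega> = c * avg f n \<omega>"
  unfolding avg_def by (simp add: sum_distrib_left)

lemma avg_sum: "avg (\<lambda>z. \<Sum>i\<in>I. f i z) n \<omega> = (\<Sum>i\<in>I. avg (f i) n \<omega>)"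
  unfolding avg_def by (subst sum.swap) (simp add: sum_divide_distrib)

lemma avg_mono: "(\<And>i. i < n \<Longrightarrow> f (Z i \<omega>) \<le> g (Z i \<omega>)) \<Longrightarrow> avg f n \<omega> \<le> avg g n \<omega>"
  unfolding avg_def by (intro divide_right_mono sum_mono) auto

lemma avg_const: "n > 0 \<Longrightarrow> avg (\<lambda>z. c) n \<omega> = c"
  unfolding avg_def by simp

lemma product_expectation_Z:
  fixes f g :: "'b \<Rightarrow> real"
  assumes f: "integrable D f" and g: "integrable D g" and "i \<noteq> j"
  shows "expectation (\<lambda>\<omega>. f (Z i \<omega>) * g (Z j \<omega>)) = integral\<^sup>L D f * integral\<^sup>L D g"
    "integrable P (\<lambda>\<omega>. f (Z i \<omega>) * g (Z j \<omega>))"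
proof -
  have [measurable]: "f \<in> borel_measurable D" "g \<in> borel_measurable D" using f g by auto
  let ?h = "\<lambda>k. if k = i then f else g"
  have "indep_vars (\<lambda>_. borel) (\<lambda>k \<omega>. ?h k (Z k \<omega>)) UNIV"
    using indep_Z by (rule indep_vars_compose2) auto
  then have ind: "indep_vars (\<lambda>_. borel) (\<lambda>k \<omega>. ?h k (Z k \<omega>)) {i, j}"
    by (rule indep_vars_subset) auto
  have int: "integrable P (\<lambda>\<omega>. ?h k (Z k \<omega>))" for k
    using f g by (auto intro: integrable_Z)
  have "expectation (\<lambda>\<omega>. \<Prod>k\<in>{i,j}. ?h k (Z k \<omega>)) = (\<Prod>k\<in>{i,j}. expectation (\<lambda>\<omega>. ?h k (Z k \<omega>)))"
    by (rule indep_vars_lebesgue_integral[OF _ ind int]) auto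
  then show "expectation (\<lambda>\<omega>. f (Z i \<omega>) * g (Z j \<omega>)) = integral\<^sup>L D f * integral\<^sup>L D g"
    using \<open>i \<noteq> j\<close> by (simp add: integral_Z)
  have "integrable P (\<lambda>\<omega>. \<Prod>k\<in>{i,j}. ?h k (Z k \<omega>))"
    by (rule indep_vars_integrable[OF _ ind int]) auto
  then show "integrable P (\<lambda>\<omega>. f (Z i \<omega>) * g (Z j \<omega>))"
    using \<open>i \<noteq> j\<close> by simp
qed

lemma expectation_sum_square:
  fixes f :: "'b \<Rightarrow> real"
  assumes f: "integrable D f" "integrable D (\<lambda>z. (f z)\<^sup>2)" and mean: "integral\<^sup>L D f = 0"
  shows "expectation (\<lambda>\<omega>. (\<Sum>i<n. f (Z i \<omega>))\<^sup>2) = real n * integral\<^sup>L D (\<lambda>z. (f z)\<^sup>2)"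
    and "integrable P (\<lambda>\<omega>. (\<Sum>i<n. f (Z i \<omega>))\<^sup>2)"
proof -
  have [measurable]: "f \<in> borel_measurable D" using f by auto
  have int: "integrable P (\<lambda>\<omega>. f (Z i \<omega>) * f (Z j \<omega>))" for i j
    using product_expectation_Z(2)[OF f(1) f(1)] integrable_Z[OF f(2)]
    by (cases "i = j") (auto simp: power2_eq_square)
  have eq: "(\<Sum>i<n. f (Z i \<omega>))\<^sup>2 = (\<Sum>i<n. \<Sum>j<n. f (Z i \<omega>) * f (Z j \<omega>))" for \<omega>
    by (simp add: power2_eq_square sum_product)
  show "integrable P (\<lambda>\<omega>. (\<Sum>i<n. f (Z i \<omega>))\<^sup>2)"
    unfolding eq using int by auto
  have "expectation (\<lambda>\<omega>. f (Z i \<omega>) * f (Z j \<omega>)) = (if j = i then integral\<^sup>L D (\<lambda>z. (f z)\<^sup>2) else 0)" for i j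
    using product_expectation_Z(1)[OF f(1) f(1), of i j] mean
      integral_Z[of "\<lambda>z. (f z)\<^sup>2" i] by (auto simp: power2_eq_square)
  then show "expectation (\<lambda>\<omega>. (\<Sum>i<n. f (Z i \<omega>))\<^sup>2) = real n * integral\<^sup>L D (\<lambda>z. (f z)\<^sup>2)"
    unfolding eq using int by (simp add: Bochner_Integration.integral_sum)
qed

text \<open>The L1 norm is at most the L2 norm, in the form that the variance of the absolute
  average is nonnegative.\<close>

lemma expectation_abs_avg_le:
  fixes f :: "'b \<Rightarrow> real"
  assumes f: "integrable D f" "integrable D (\<lambda>z. (f z)\<^sup>2)" and mean: "integral\<^sup>L D f = 0" and n: "n > 0"
  shows "expectation (\<lambda>\<omega>. \<bar>avg f n \<omega>\<bar>) \<le> sqrt (integral\<^sup>L D (\<lambda>z. (f z)\<^sup>2) / n)"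
proof -
  have sq: "(avg f n \<omega>)\<^sup>2 = (\<Sum>i<n. f (Z i \<omega>))\<^sup>2 / (real n)\<^sup>2" for \<omega>
    by (simp add: avg_def power_divide)
  have int2: "integrable P (\<lambda>\<omega>. \<bar>avg f n \<omega>\<bar>\<^sup>2)"
    unfolding power2_abs sq using expectation_sum_square(2)[OF f mean] by auto
  have "(expectation (\<lambda>\<omega>. \<bar>avg f n \<omega>\<bar>))\<^sup>2 \<le> expectation (\<lambda>\<omega>. \<bar>avg f n \<omega>\<bar>\<^sup>2)"
    using variance_positive[of "\<lambda>\<omega>. \<bar>avg f n \<omega>\<bar>"] integrable_avg[OF f(1), of n] int2
    by (subst (asm) variance_eq) auto
  also have "\<dots> = integral\<^sup>L D (\<lambda>z. (f z)\<^sup>2) / n"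
    unfolding power2_abs sq using expectation_sum_square(1)[OF f mean, of n] n
    by (simp add: power2_eq_square)
  finally show ?thesis by (rule real_le_rsqrt)
qed

text \<open>Only integrability is assumed, so the variance bound is applied to a clipped \<open>f\<close>.\<close>
lemma weak_law_of_large_numbers:
  fixes f :: "'b \<Rightarrow> real"
  assumes f: "integrable D f" and "\<delta> > 0"
  shows "whp (\<lambda>n \<omega>. \<bar>avg f n \<omega> - integral\<^sup>L D f\<bar> < \<delta>)"
proof (rule whp_Markov[OF _ _ _ \<open>\<delta> > 0\<close>])
  interpret D: prob_space D by (rule prob_space_D)
  have [measurable]: "f \<in> borel_measurable D" using f by auto
  show "integrable P (\<lambda>\<omega>. \<bar>avg f n \<omega> - integral\<^sup>L D f\<bar>)" for n
    using integrable_avg[OF f] by auto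
  fix \<epsilon> :: real assume "\<epsilon> > 0"
  define g where "g k x = max (- real k) (min (real k) (f x))" for k x
  have g_le: "\<bar>g k x\<bar> \<le> real k" for k x unfolding g_def by auto
  have g[measurable]: "g k \<in> borel_measurable D" for k unfolding g_def by measurable
  have intg: "integrable D (g k)" for k
    by (rule D.integrable_const_bound[of _ "real k"]) (auto simp: g_le)
  have "\<forall>\<^sub>F k in sequentially. (\<integral>x. \<bar>f x - g k x\<bar> \<partial>D) < \<epsilon> / 3"
    using order_tendstoD(2)[OF clip_tendsto_integral[OF f], of "\<epsilon>/3"] \<open>\<epsilon> > 0\<close>
    unfolding g_def by auto
  then obtain k where k: "(\<integral>x. \<bar>f x - g k x\<bar> \<partial>D) < \<epsilon> / 3"
    by (auto simp: eventually_sequentially)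
  \<comment> \<open>Centring the clipped function splits the deviation of \<open>avg f\<close> into
    the clipping error, a centred bounded average and a difference of means; each gets a third of
    \<epsilon>.\<close>
  define g0 where "g0 x = g k x - integral\<^sup>L D (g k)" for x
  have g0_le: "\<bar>g0 x\<bar> \<le> real k + real k" for x
  proof -
    have "\<bar>integral\<^sup>L D (g k)\<bar> \<le> (\<integral>x. real k \<partial>D)"
      by (rule order.trans[OF integral_abs_bound], rule integral_mono) (auto simp: intg g_le)
    then have "\<bar>integral\<^sup>L D (g k)\<bar> \<le> real k" by (simp add: D.prob_space)
    then show ?thesis using g_le[of k x] unfolding g0_def by linarith
  qed
  have [measurable]: "g0 \<in> borel_measurable D" unfolding g0_def by measurable
  have g0: "integrable D g0" "integrable D (\<lambda>z. (g0 z)\<^sup>2)" "integral\<^sup>L D g0 = 0"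
  proof -
    show "integrable D g0" unfolding g0_def using intg[of k] by simp
    have "(g0 x)\<^sup>2 \<le> (real k + real k)\<^sup>2" for x
      using power_mono[OF g0_le[of x], of 2] by simp
    then show "integrable D (\<lambda>z. (g0 z)\<^sup>2)"
      by (intro D.integrable_const_bound[of _ "(real k + real k)\<^sup>2"]) auto
    show "integral\<^sup>L D g0 = 0" unfolding g0_def using intg[of k] by (simp add: D.prob_space)
  qed
  define V where "V = integral\<^sup>L D (\<lambda>z. (g0 z)\<^sup>2)"
  have "(\<lambda>n. sqrt (V / real n)) \<longlonglongrightarrow> sqrt 0"
    by (intro tendsto_intros tendsto_divide_0[OF tendsto_const] filterlim_real_at_infinity_sequentially)
  then have "\<forall>\<^sub>F n in sequentially. sqrt (V / real n) < \<epsilon> / 3"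
    using \<open>\<epsilon> > 0\<close> by (intro order_tendstoD) auto
  then show "\<forall>\<^sub>F n in sequentially. expectation (\<lambda>\<omega>. \<bar>avg f n \<omega> - integral\<^sup>L D f\<bar>) \<le> \<epsilon>"
    using eventually_gt_at_top[of 0]
  proof eventually_elim
    case (elim n)
    have fg: "integrable D (\<lambda>x. \<bar>f x - g k x\<bar>)" using f intg by auto
    have "\<bar>integral\<^sup>L D (g k) - integral\<^sup>L D f\<bar> = \<bar>\<integral>x. f x - g k x \<partial>D\<bar>"
      using f intg[of k] by simp
    also have "\<dots> \<le> (\<integral>x. \<bar>f x - g k x\<bar> \<partial>D)" by (rule integral_abs_bound)
    finally have mean: "\<bar>integral\<^sup>L D (g k) - integral\<^sup>L D f\<bar> \<le> \<epsilon> / 3" using k by simp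
    have "expectation (\<lambda>\<omega>. \<bar>avg f n \<omega> - integral\<^sup>L D f\<bar>)
      \<le> expectation (\<lambda>\<omega>. avg (\<lambda>x. \<bar>f x - g k x\<bar>) n \<omega> + \<bar>avg g0 n \<omega>\<bar> + \<epsilon> / 3)"
    proof (rule integral_mono)
      fix \<omega>
      have "avg f n \<omega> - integral\<^sup>L D f = avg (\<lambda>x. f x - g k x) n \<omega> + avg g0 n \<omega>
         + (integral\<^sup>L D (g k) - integral\<^sup>L D f)"
        using elim unfolding g0_def avg_diff by (simp add: avg_const)
      then show "\<bar>avg f n \<omega> - integral\<^sup>L D f\<bar> \<le> avg (\<lambda>x. \<bar>f x - g k x\<bar>) n \<omega> + \<bar>avg g0 n \<omega>\<bar> + \<epsilon> / 3"
        using mean avg_abs[of "\<lambda>x. f x - g k x" n \<omega>] by linarith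
    qed (use integrable_avg[OF f] integrable_avg[OF fg] integrable_avg[OF g0(1)] in auto)
    also have "\<dots> = (\<integral>x. \<bar>f x - g k x\<bar> \<partial>D) + expectation (\<lambda>\<omega>. \<bar>avg g0 n \<omega>\<bar>) + \<epsilon> / 3"
      using integrable_avg[OF fg, of n] integrable_avg[OF g0(1), of n] expectation_avg[OF fg] elim
      by (simp add: prob_space)
    also have "expectation (\<lambda>\<omega>. \<bar>avg g0 n \<omega>\<bar>) \<le> sqrt (V / real n)"
      unfolding V_def using elim by (intro expectation_abs_avg_le g0) auto
    finally show ?case using k elim by linarith
  qed
qed auto

end

section \<open>A chi-square limit theorem from characteristic functions\<close>

lemma real_distribution_std_normal: "real_distribution std_normal_distribution"
  by (simp add: real_distribution_def real_distribution_axioms_def prob_space_normal_density)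

abbreviation normal_product :: "nat \<Rightarrow> (nat \<Rightarrow> real) measure" where
  "normal_product d \<equiv> \<Pi>\<^sub>M i\<in>{..<d}. std_normal_distribution"

lemma prob_space_normal_product: "prob_space (normal_product d)"
  by (intro prob_space_PiM prob_space_normal_density) auto

lemma real_distribution_chi_square: "real_distribution (chi_square d)"
  unfolding chi_square_def
  by (intro real_distribution.intro prob_space.prob_space_distr prob_space_normal_product)
     (auto simp: real_distribution_axioms_def)

text \<open>On \<open>A\<close> the Lipschitz constant \<open>1 / (y - x)\<close> of the step
  controls the difference; off \<open>A\<close>, an event of probability at most \<epsilon>, the
  difference is at most 1.\<close>

lemma integral_cts_step_diff_le:
  fixes V W :: "'a \<Rightarrow> real"
  assumes "prob_space P" and [measurable]: "V \<in> borel_measurable P" "W \<in> borel_measurable P"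
    and xy: "x < y" and A: "A \<in> sets P" "measure P A \<ge> 1 - \<epsilon>" and close: "\<And>\<omega>. \<omega> \<in> A \<Longrightarrow> \<bar>W \<omega> - V \<omega>\<bar> \<le> \<delta>"
    and "\<delta> \<ge> 0"
  shows "\<bar>(\<integral>\<omega>. cts_step x y (W \<omega>) \<partial>P) - (\<integral>\<omega>. cts_step x y (V \<omega>) \<partial>P)\<bar> \<le> \<delta> / (y - x) + \<epsilon>"
proof -
  interpret prob_space P by fact
  have [measurable]: "cts_step x y \<in> borel_measurable borel" unfolding cts_step_def by measurable
  have step: "0 \<le> cts_step x y v" "cts_step x y v \<le> 1" for v
    using xy by (auto simp: cts_step_def field_simps)
  have Lip: "\<bar>cts_step x y v - cts_step x y w\<bar> \<le> \<bar>v - w\<bar> / (y - x)" for v w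
    using xy by (auto simp: cts_step_def divide_simps)
  have int: "integrable P (\<lambda>\<omega>. cts_step x y (U \<omega>))" if [measurable]: "U \<in> borel_measurable P" for U
    using step by (intro integrable_const_bound[of _ 1]) auto
  have ind: "integrable P (\<lambda>\<omega>. indicator (space P - A) \<omega> :: real)"
    using A by (intro integrable_const_bound[of _ 1]) auto
  have "\<bar>(\<integral>\<omega>. cts_step x y (W \<omega>) \<partial>P) - (\<integral>\<omega>. cts_step x y (V \<omega>) \<partial>P)\<bar>
      = \<bar>\<integral>\<omega>. cts_step x y (W \<omega>) - cts_step x y (V \<omega>) \<partial>P\<bar>"
    by (simp add: int)
  also have "\<dots> \<le> (\<integral>\<omega>. \<bar>cts_step x y (W \<omega>) - cts_step x y (V \<omega>)\<bar> \<partial>P)"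
    by (rule integral_abs_bound)
  also have "\<dots> \<le> (\<integral>\<omega>. \<delta> / (y - x) + indicator (space P - A) \<omega> \<partial>P)"
  proof (rule integral_mono)
    fix \<omega> assume w: "\<omega> \<in> space P"
    show "\<bar>cts_step x y (W \<omega>) - cts_step x y (V \<omega>)\<bar> \<le> \<delta> / (y - x) + indicator (space P - A) \<omega>"
    proof (cases "\<omega> \<in> A")
      case True
      have "\<bar>cts_step x y (W \<omega>) - cts_step x y (V \<omega>)\<bar> \<le> \<bar>W \<omega> - V \<omega>\<bar> / (y - x)" by (rule Lip)
      also have "\<dots> \<le> \<delta> / (y - x)" using close[OF True] xy by (simp add: divide_right_mono)
      finally show ?thesis by (simp add: indicator_def True)
    next
      case False
      have "\<bar>cts_step x y (W \<omega>) - cts_step x y (V \<omega>)\<bar> \<le> 1"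
        using step[of "W \<omega>"] step[of "V \<omega>"] by linarith
      then show ?thesis using False w xy \<open>\<delta> \<ge> 0\<close> by (simp add: add_increasing)
    qed
  qed (use A int ind in auto)
  also have "\<dots> = \<delta> / (y - x) + measure P (space P - A)"
    using A ind by (simp add: prob_space)
  also have "\<dots> \<le> \<delta> / (y - x) + \<epsilon>" using A by (simp add: prob_compl)
  finally show ?thesis .
qed

text \<open>Slutsky's theorem, tested on the piecewise linear steps that suffice for weak
  convergence.\<close>

lemma (in prob_space) cts_step_Slutsky:
  fixes V W :: "nat \<Rightarrow> 'a \<Rightarrow> real"
  assumes V: "\<And>n. V n \<in> borel_measurable M" and W: "\<And>n. W n \<in> borel_measurable M"
    and close: "\<And>\<delta>. \<delta> > 0 \<Longrightarrow> whp (\<lambda>n \<omega>. \<bar>W n \<omega> - V n \<omega>\<bar> \<le> \<delta>)"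
    and conv: "(\<lambda>n. \<integral>\<omega>. cts_step x y (V n \<omega>) \<partial>M) \<longlonglongrightarrow> c" and xy: "x < y"
  shows "(\<lambda>n. \<integral>\<omega>. cts_step x y (W n \<omega>) \<partial>M) \<longlonglongrightarrow> c"
proof -
  have "(\<lambda>n. (\<integral>\<omega>. cts_step x y (W n \<omega>) \<partial>M) - (\<integral>\<omega>. cts_step x y (V n \<omega>) \<partial>M)) \<longlonglongrightarrow> 0"
  proof (rule tendstoI)
    fix e :: real assume "e > 0"
    then have "e / 3 * (y - x) > 0" using xy by simp
    then have "whp (\<lambda>n \<omega>. \<bar>W n \<omega> - V n \<omega>\<bar> \<le> e / 3 * (y - x))" by (rule close)
    then have "\<forall>\<^sub>F n in sequentially. \<exists>A\<in>events. prob A \<ge> 1 - e / 3 \<and>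
        (\<forall>\<omega>\<in>A. \<bar>W n \<omega> - V n \<omega>\<bar> \<le> e / 3 * (y - x))"
      using \<open>e > 0\<close> unfolding whp_def by auto
    then show "\<forall>\<^sub>F n in sequentially.
        dist ((\<integral>\<omega>. cts_step x y (W n \<omega>) \<partial>M) - (\<integral>\<omega>. cts_step x y (V n \<omega>) \<partial>M)) 0 < e"
    proof eventually_elim
      case (elim n)
      then obtain A where A: "A \<in> events" "prob A \<ge> 1 - e / 3"
        "\<And>\<omega>. \<omega> \<in> A \<Longrightarrow> \<bar>W n \<omega> - V n \<omega>\<bar> \<le> e / 3 * (y - x)" by blast
      have "\<bar>(\<integral>\<omega>. cts_step x y (W n \<omega>) \<partial>M) - (\<integral>\<omega>. cts_step x y (V n \<omega>) \<partial>M)\<bar>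
          \<le> (e / 3 * (y - x)) / (y - x) + e / 3"
        using xy \<open>e > 0\<close>
        by (intro integral_cts_step_diff_le[OF prob_space_axioms V W xy A]) auto
      also have "(e / 3 * (y - x)) / (y - x) = e / 3" using xy by (intro nonzero_mult_div_cancel_right) simp
      also have "e / 3 + e / 3 < e" using \<open>e > 0\<close> by simp
      finally show ?case by simp
    qed
  qed
  from tendsto_add[OF this conv] show ?thesis by simp
qed

text \<open>A continuity theorem for Laplace transforms: in the variable \<open>u = exp (- v)\<close> the step functions
  become continuous functions on \<open>[0, 1]\<close>, which polynomials approximate uniformly.\<close>
lemma cts_step_tendsto_if_Laplace_tendsto:
  fixes V :: "nat \<Rightarrow> 'a \<Rightarrow> real" and C :: "real measure"
  assumes "prob_space P" "real_distribution C"
    and V[measurable]: "\<And>n. V n \<in> borel_measurable P" and V_pos: "\<And>n \<omega>. V n \<omega> \<ge> 0"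
    and C_pos: "AE v in C. v \<ge> 0"
    and Laplace: "\<And>k::nat. (\<lambda>n. \<integral>\<omega>. exp (- (real k * V n \<omega>)) \<partial>P) \<longlonglongrightarrow> (\<integral>v. exp (- (real k * v)) \<partial>C)"
    and xy: "x < y"
  shows "(\<lambda>n. \<integral>\<omega>. cts_step x y (V n \<omega>) \<partial>P) \<longlonglongrightarrow> (\<integral>v. cts_step x y v \<partial>C)"
proof (rule tendstoI)
  interpret P: prob_space P by fact
  interpret C: real_distribution C by fact
  fix e :: real assume "e > 0"
  \<comment> \<open>This is the step in the variable \<open>u\<close>, that is
    \<open>g (exp (- v)) = cts_step x y v\<close>. The value 0 for \<open>u \<le> 0\<close> is the
    continuous extension, because the step vanishes beyond \<open>y\<close>.\<close>
  define g where "g u = (if u \<le> 0 then 0 else cts_step x y (- ln u))" for u :: real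
  have [measurable]: "cts_step x y \<in> borel_measurable borel" unfolding cts_step_def by measurable
  have step: "\<bar>cts_step x y v\<bar> \<le> 1" for v
    using xy by (auto simp: cts_step_def field_simps)
  have g0: "g u = 0" if "u \<le> exp (- y)" for u
  proof (cases "u \<le> 0")
    case False
    then have "ln u \<le> - y" using that ln_le_cancel_iff[of u "exp (- y)"] by simp
    then show ?thesis using False xy by (auto simp: g_def cts_step_def)
  qed (simp add: g_def)
  have cstep: "continuous_on UNIV (cts_step x y)"
    using cts_step_uniformly_continuous[OF xy] by (rule uniformly_continuous_imp_continuous)
  \<comment> \<open>\<open>y\<close> may be negative and \<open>exp (- y)\<close> then exceeds 1;
    the \<open>max\<close> keeps the second interval nonempty while the union still covers
    \<open>{0..1}\<close>.\<close>
  have "continuous_on ({0..exp (- y)} \<union> {exp (- y)..max 1 (exp (- y))}) g"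
  proof (intro continuous_on_closed_Un)
    show "continuous_on {0..exp (- y)} g"
      by (rule continuous_on_cong[THEN iffD1, OF refl _ continuous_on_const[of _ 0]]) (simp add: g0)
    have pos: "u > 0" if "u \<ge> exp (- y)" for u using that exp_gt_zero[of "-y"] by linarith
    have "continuous_on {exp (- y)..max 1 (exp (- y))} (\<lambda>u. cts_step x y (- ln u))"
      by (rule continuous_on_compose2[OF cstep]) (auto intro!: continuous_intros dest: pos)
    then show "continuous_on {exp (- y)..max 1 (exp (- y))} g"
      by (rule continuous_on_cong[THEN iffD1, rotated 2]) (auto simp: g_def dest: pos)
  qed auto
  then have "continuous_on {0..1} g"
    by (rule continuous_on_subset) auto
  from Bernstein_Weierstrass[OF this, of "e / 3"] \<open>e > 0\<close> obtain N where
    "\<forall>n u. N \<le> n \<and> u \<in> {0..1} \<longrightarrow> \<bar>g u - (\<Sum>k\<le>n. g (k / n) * Bernstein n k u)\<bar> < e / 3" by auto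
  then have N: "\<bar>g u - (\<Sum>k\<le>N. g (k / N) * Bernstein N k u)\<bar> < e / 3" if "u \<in> {0..1}" for u
    using that by blast
  define q where "q u = (\<Sum>k\<le>N. g (k / N) * Bernstein N k u)" for u
  \<comment> \<open>Monomials in \<open>u = exp (- v)\<close> are the exponentials
    \<open>exp (- (i * v))\<close>, so convergence of the Laplace transforms at natural numbers
    settles every polynomial.\<close>
  have "real_polynomial_function q" unfolding q_def Bernstein_def
    by (intro real_polynomial_function_sum real_polynomial_function.intros real_polynomial_function_power
        real_polynomial_function_diff) auto
  then obtain a m where q: "q = (\<lambda>u. \<Sum>i\<le>m. a i * u ^ i)"
    using real_polynomial_function_iff_sum by metis
  have qV: "q (exp (- v)) = (\<Sum>i\<le>m. a i * exp (- (real i * v)))" for v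
    unfolding q by (simp add: exp_of_nat_mult[symmetric])
  have close: "\<bar>cts_step x y v - q (exp (- v))\<bar> \<le> e / 3" if "v \<ge> 0" for v
    using N[of "exp (- v)"] that unfolding q_def g_def by (auto simp: less_imp_le)
  have intP: "integrable P (\<lambda>\<omega>. exp (- (real i * V n \<omega>)))" for i n
    by (rule P.integrable_const_bound[of _ 1]) (auto simp: V_pos)
  have intC: "integrable C (\<lambda>v. exp (- (real i * v)))" for i
    using C_pos by (intro C.integrable_const_bound[of _ 1]) auto
  have stepP: "integrable P (\<lambda>\<omega>. cts_step x y (V n \<omega>))" for n
    by (rule P.integrable_const_bound[of _ 1]) (auto simp: step)
  have stepC: "integrable C (cts_step x y)"
    by (rule C.integrable_const_bound[of _ 1]) (auto simp: step)
  have "(\<lambda>n. \<integral>\<omega>. q (exp (- V n \<omega>)) \<partial>P) \<longlonglongrightarrow> (\<integral>v. q (exp (- v)) \<partial>C)"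
    unfolding qV using intP intC by (auto intro!: tendsto_intros Laplace)
  then have "\<forall>\<^sub>F n in sequentially. dist (\<integral>\<omega>. q (exp (- V n \<omega>)) \<partial>P) (\<integral>v. q (exp (- v)) \<partial>C) < e / 3"
    using \<open>e > 0\<close> by (intro tendstoD) auto
  then show "\<forall>\<^sub>F n in sequentially. dist (\<integral>\<omega>. cts_step x y (V n \<omega>) \<partial>P) (\<integral>v. cts_step x y v \<partial>C) < e"
  proof eventually_elim
    case (elim n)
    have "\<bar>(\<integral>\<omega>. cts_step x y (V n \<omega>) \<partial>P) - (\<integral>\<omega>. q (exp (- V n \<omega>)) \<partial>P)\<bar>
        = \<bar>\<integral>\<omega>. cts_step x y (V n \<omega>) - q (exp (- V n \<omega>)) \<partial>P\<bar>"
      unfolding qV using stepP intP by simp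
    also have "\<dots> \<le> (\<integral>\<omega>. \<bar>cts_step x y (V n \<omega>) - q (exp (- V n \<omega>))\<bar> \<partial>P)" by (rule integral_abs_bound)
    also have "\<dots> \<le> (\<integral>\<omega>. e / 3 \<partial>P)"
      using stepP intP V_pos close by (intro integral_mono) (auto simp: qV)
    finally have 1: "\<bar>(\<integral>\<omega>. cts_step x y (V n \<omega>) \<partial>P) - (\<integral>\<omega>. q (exp (- V n \<omega>)) \<partial>P)\<bar> \<le> e / 3"
      by (simp add: P.prob_space)
    have "\<bar>(\<integral>v. cts_step x y v \<partial>C) - (\<integral>v. q (exp (- v)) \<partial>C)\<bar>
        = \<bar>\<integral>v. cts_step x y v - q (exp (- v)) \<partial>C\<bar>"
      unfolding qV using stepC intC by simp
    also have "\<dots> \<le> (\<integral>v. \<bar>cts_step x y v - q (exp (- v))\<bar> \<partial>C)" by (rule integral_abs_bound)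
    also have "\<dots> \<le> (\<integral>v. e / 3 \<partial>C)"
      using stepC intC C_pos close by (intro integral_mono_AE) (auto simp: qV)
    finally have 2: "\<bar>(\<integral>v. cts_step x y v \<partial>C) - (\<integral>v. q (exp (- v)) \<partial>C)\<bar> \<le> e / 3"
      using C.prob_space by simp
    show ?case using elim 1 2 unfolding dist_real_def by linarith
  qed
qed

lemma integral_normal_product_iexp:
  "(\<integral>g. iexp (\<Sum>j<d. c j * g j) \<partial>normal_product d) = of_real (exp (- (\<Sum>j<d. (c j)\<^sup>2) / 2))"
proof -
  interpret real_distribution std_normal_distribution by (rule real_distribution_std_normal)
  interpret product_sigma_finite "\<lambda>i::nat. std_normal_distribution" by standard
  have "(\<integral>g. iexp (\<Sum>j<d. c j * g j) \<partial>normal_product d) = (\<integral>g. (\<Prod>j<d. iexp (c j * g j)) \<partial>normal_product d)"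
    by (simp add: sum_distrib_left exp_sum)
  also have "\<dots> = (\<Prod>j<d. \<integral>x. iexp (c j * x) \<partial>std_normal_distribution)"
    by (rule product_integral_prod) (auto intro!: integrable_const_bound[of _ 1])
  also have "\<dots> = (\<Prod>j<d. char std_normal_distribution (c j))"
    by (simp add: char_def)
  also have "\<dots> = of_real (exp (- (\<Sum>j<d. (c j)\<^sup>2) / 2))"
    by (simp add: char_std_normal_distribution exp_of_real exp_sum[symmetric] sum_negf sum_divide_distrib
       del: of_real_prod flip: of_real_prod)
  finally show ?thesis .
qed

text \<open>Writing \<open>exp (- k |z|\<^sup>2)\<close> as a Gaussian mixture of the characters \<open>z \<mapsto> exp (\<i> g \<bullet> z)\<close> turns
  convergence of the characteristic functions into convergence of the Laplace transforms of \<open>|z|\<^sup>2\<close>.\<close>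
lemma Laplace_sum_squares_tendsto:
  fixes Z :: "nat \<Rightarrow> nat \<Rightarrow> 'a \<Rightarrow> real"
  assumes "prob_space P" and Z[measurable]: "\<And>n j. Z n j \<in> borel_measurable P"
    and chars: "\<And>t :: nat \<Rightarrow> real. (\<lambda>n. \<integral>\<omega>. iexp (\<Sum>j<d. t j * Z n j \<omega>) \<partial>P)
        \<longlonglongrightarrow> of_real (exp (- (\<Sum>j<d. (t j)\<^sup>2) / 2))"
  shows "(\<lambda>n. \<integral>\<omega>. exp (- (real k * (\<Sum>j<d. (Z n j \<omega>)\<^sup>2))) \<partial>P) \<longlonglongrightarrow> (\<integral>v. exp (- (real k * v)) \<partial>chi_square d)"
proof -
  interpret P: prob_space P by fact
  interpret G: prob_space "normal_product d" by (rule prob_space_normal_product)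
  interpret PG: pair_prob_space P "normal_product d" ..
  \<comment> \<open>With this scale the characteristic function of a standard normal variable at
    \<open>s * z\<close> is \<open>exp (- (k * z^2))\<close>.\<close>
  define s where "s = sqrt (2 * real k)"
  have s: "s\<^sup>2 = 2 * real k" unfolding s_def by simp
  have halves: "exp (- (\<Sum>j<d. (s * z j)\<^sup>2) / 2) = exp (- (real k * (\<Sum>j<d. (z j)\<^sup>2)))" for z :: "nat \<Rightarrow> real"
    unfolding power_mult_distrib s sum_distrib_left[symmetric] by simp
  have mix: "of_real (\<integral>\<omega>. exp (- (real k * (\<Sum>j<d. (Z n j \<omega>)\<^sup>2))) \<partial>P)
      = (\<integral>g. (\<integral>\<omega>. iexp (\<Sum>j<d. (s * g j) * Z n j \<omega>) \<partial>P) \<partial>normal_product d)" for n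
  proof -
    have "of_real (\<integral>\<omega>. exp (- (real k * (\<Sum>j<d. (Z n j \<omega>)\<^sup>2))) \<partial>P) 
        = (\<integral>\<omega>. of_real (exp (- (\<Sum>j<d. (s * Z n j \<omega>)\<^sup>2) / 2)) \<partial>P :: complex)"
      unfolding integral_complex_of_real halves ..
    \<comment> \<open>The Gaussian characteristic function is read backwards, with the random point
      as frequency. The next two steps exchange the roles, so that \<open>g\<close> becomes the
      frequency and \<open>chars\<close> applies at \<open>s * g j\<close>.\<close>
    also have "\<dots> = (\<integral>\<omega>. (\<integral>g. iexp (\<Sum>j<d. (s * Z n j \<omega>) * g j) \<partial>normal_product d) \<partial>P)"
      by (simp only: integral_normal_product_iexp)
    also have "\<dots> = (\<integral>\<omega>. (\<integral>g. iexp (\<Sum>j<d. (s * g j) * Z n j \<omega>) \<partial>normal_product d) \<partial>P)"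
      by (simp only: mult.assoc mult.commute mult.left_commute)
    also have "\<dots> = (\<integral>g. (\<integral>\<omega>. iexp (\<Sum>j<d. (s * g j) * Z n j \<omega>) \<partial>P) \<partial>normal_product d)"
      by (rule PG.Fubini_integral[symmetric])
         (auto intro!: PG.P.integrable_const_bound[of _ 1] simp: split_beta')
    finally show ?thesis .
  qed
  have lim: "of_real (\<integral>v. exp (- (real k * v)) \<partial>chi_square d)
      = (\<integral>g. of_real (exp (- (\<Sum>j<d. (s * g j)\<^sup>2) / 2)) \<partial>normal_product d :: complex)"
    unfolding chi_square_def
    unfolding integral_complex_of_real halves by (subst integral_distr) auto
  have "(\<lambda>n. \<integral>g. (\<integral>\<omega>. iexp (\<Sum>j<d. (s * g j) * Z n j \<omega>) \<partial>P) \<partial>normal_product d)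
     \<longlonglongrightarrow> (\<integral>g. of_real (exp (- (\<Sum>j<d. (s * g j)\<^sup>2) / 2)) \<partial>normal_product d)"
  proof (rule integral_dominated_convergence[where w="\<lambda>_. 1"])
    show "AE g in normal_product d. norm (\<integral>\<omega>. iexp (\<Sum>j<d. (s * g j) * Z n j \<omega>) \<partial>P) \<le> 1" for n
    proof (intro AE_I2)
      fix g :: "nat \<Rightarrow> real"
      have "norm (\<integral>\<omega>. iexp (\<Sum>j<d. (s * g j) * Z n j \<omega>) \<partial>P) \<le> (\<integral>\<omega>. norm (iexp (\<Sum>j<d. (s * g j) * Z n j \<omega>)) \<partial>P)"
        by (rule integral_norm_bound)
      then show "norm (\<integral>\<omega>. iexp (\<Sum>j<d. (s * g j) * Z n j \<omega>) \<partial>P) \<le> 1" by (simp add: P.prob_space)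
    qed
    show "AE g in normal_product d. (\<lambda>n. \<integral>\<omega>. iexp (\<Sum>j<d. (s * g j) * Z n j \<omega>) \<partial>P)
        \<longlonglongrightarrow> of_real (exp (- (\<Sum>j<d. (s * g j)\<^sup>2) / 2))"
      by (intro AE_I2 chars)
    show "(\<lambda>g. \<integral>\<omega>. iexp (\<Sum>j<d. (s * g j) * Z n j \<omega>) \<partial>P) \<in> borel_measurable (normal_product d)" for n
      by measurable
  qed auto
  then show ?thesis
    unfolding mix[symmetric] lim[symmetric] by (simp only: tendsto_of_real_iff)
qed

text \<open>On the test functions \<open>cts_step x y\<close> the limit for the sum of squares
  follows from Laplace transforms, and it is stable under small perturbations, so \<open>W\<close>
  may take the place of the sum.\<close>

lemma (in prob_space) weak_conv_chi_square:
  fixes Z :: "nat \<Rightarrow> nat \<Rightarrow> 'a \<Rightarrow> real" and W :: "nat \<Rightarrow> 'a \<Rightarrow> real"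
  assumes Z[measurable]: "\<And>n j. Z n j \<in> borel_measurable M"
    and chars: "\<And>t :: nat \<Rightarrow> real. (\<lambda>n. \<integral>\<omega>. iexp (\<Sum>j<d. t j * Z n j \<omega>) \<partial>M)
        \<longlonglongrightarrow> of_real (exp (- (\<Sum>j<d. (t j)\<^sup>2) / 2))"
    and W[measurable]: "\<And>n. W n \<in> borel_measurable M"
    and close: "\<And>\<delta>. \<delta> > 0 \<Longrightarrow> whp (\<lambda>n \<omega>. \<bar>W n \<omega> - (\<Sum>j<d. (Z n j \<omega>)\<^sup>2)\<bar> \<le> \<delta>)"
  shows "weak_conv_m (\<lambda>n. distr M borel (W n)) (chi_square d)"
proof (rule integral_cts_step_conv_imp_weak_conv)
  show "real_distribution (distr M borel (W n))" for n by simp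
  show "real_distribution (chi_square d)" by (rule real_distribution_chi_square)
  fix x y :: real assume xy: "x < y"
  have [measurable]: "cts_step x y \<in> borel_measurable borel" unfolding cts_step_def by measurable
  have "AE v in chi_square d. v \<ge> 0"
    unfolding chi_square_def by (subst AE_distr_iff) (auto intro!: AE_I2 sum_nonneg)
  then have "(\<lambda>n. \<integral>\<omega>. cts_step x y (\<Sum>j<d. (Z n j \<omega>)\<^sup>2) \<partial>M) \<longlonglongrightarrow> (\<integral>v. cts_step x y v \<partial>chi_square d)"
    by (intro cts_step_tendsto_if_Laplace_tendsto Laplace_sum_squares_tendsto chars xy
        real_distribution_chi_square prob_space_axioms) (auto intro: sum_nonneg)
  then have "(\<lambda>n. \<integral>\<omega>. cts_step x y (W n \<omega>) \<partial>M) \<longlonglongrightarrow> (\<integral>v. cts_step x y v \<partial>chi_square d)"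
    by (intro cts_step_Slutsky[OF _ _ close _ xy]) auto
  then show "(\<lambda>n. integral\<^sup>L (distr M borel (W n)) (cts_step x y)) \<longlonglongrightarrow> integral\<^sup>L (chi_square d) (cts_step x y)"
    by (simp add: integral_distr)
qed

section \<open>Symmetric positive matrices and matrix inversion\<close>

lemma matrix_inv_inverse:
  fixes A :: "real ^ 'n ^ 'n"
  assumes "invertible A"
  shows "A ** matrix_inv A = mat 1" "matrix_inv A ** A = mat 1"
proof -
  have "A ** matrix_inv A = mat 1 \<and> matrix_inv A ** A = mat 1"
    using assms unfolding invertible_def matrix_inv_def by (rule someI_ex)
  then show "A ** matrix_inv A = mat 1" "matrix_inv A ** A = mat 1" by auto
qed

lemma matrix_inv_unique:
  fixes A :: "real ^ 'n ^ 'n"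
  assumes "A ** B = mat 1"
  shows "matrix_inv A = B"
proof -
  have "B ** A = mat 1" using assms by (simp add: matrix_left_right_inverse)
  then have "invertible A" using assms by (auto simp: invertible_def)
  then have "matrix_inv A = matrix_inv A ** (A ** B)" using assms by simp
  also have "\<dots> = B" using matrix_inv_inverse(2)[OF \<open>invertible A\<close>] by (simp add: matrix_mul_assoc)
  finally show ?thesis .
qed

text \<open>Gram-Schmidt for the inner product \<open>u \<bullet> (B *v v)\<close>. While
  \<open>k\<close> is below the dimension some \<open>v\<close> lies outside the span of the vectors
  found, and its residual \<open>w\<close> can be normalised because \<open>B\<close> is
  positive.\<close>

lemma positive_bilinear_orthonormal_sequence:
  fixes B :: "real ^ 'n ^ 'n"
  assumes sym: "transpose B = B" and pos: "\<And>v. v \<noteq> 0 \<Longrightarrow> v \<bullet> (B *v v) > 0"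
    and "k \<le> CARD('n)"
  shows "\<exists>e :: nat \<Rightarrow> real ^ 'n. \<forall>i<k. \<forall>j<k. e i \<bullet> (B *v e j) = (if i = j then 1 else 0)"
  using \<open>k \<le> CARD('n)\<close>
proof (induction k)
  case (Suc k)
  have symB: "u \<bullet> (B *v v) = v \<bullet> (B *v u)" for u v
    by (metis sym dot_lmul_matrix inner_commute vector_transpose_matrix)
  from Suc obtain e :: "nat \<Rightarrow> real ^ 'n" where
    e: "\<And>i j. i < k \<Longrightarrow> j < k \<Longrightarrow> e i \<bullet> (B *v e j) = (if i = j then 1 else 0)" by auto
  have "dim (e ` {..<k}) \<le> card (e ` {..<k})" by (rule dim_le_card') simp
  also have "\<dots> < CARD('n)" using Suc.prems card_image_le[of "{..<k}" e] by simp
  finally have "span (e ` {..<k}) \<noteq> UNIV"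
    by (metis DIM_cart DIM_real dim_UNIV dim_span less_irrefl mult.right_neutral)
  then obtain v where v: "v \<notin> span (e ` {..<k})" by auto
  define w where "w = v - (\<Sum>i<k. (v \<bullet> (B *v e i)) *\<^sub>R e i)"
  have "(\<Sum>i<k. (v \<bullet> (B *v e i)) *\<^sub>R e i) \<in> span (e ` {..<k})"
    by (intro span_sum span_mul span_base) auto
  then have "w \<noteq> 0" using v unfolding w_def by auto
  then have ww: "w \<bullet> (B *v w) > 0" by (rule pos)
  have we: "w \<bullet> (B *v e j) = 0" if "j < k" for j
  proof -
    have "w \<bullet> (B *v e j) = v \<bullet> (B *v e j) - (\<Sum>i<k. (v \<bullet> (B *v e i)) * (e i \<bullet> (B *v e j)))"
      unfolding w_def by (simp add: inner_diff_left inner_sum_left)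
    also have "(\<Sum>i<k. (v \<bullet> (B *v e i)) * (e i \<bullet> (B *v e j))) = (\<Sum>i<k. if i = j then v \<bullet> (B *v e i) else 0)"
      using that by (intro sum.cong) (auto simp: e)
    finally show ?thesis using that by simp
  qed
  define f where "f = e(k := w /\<^sub>R sqrt (w \<bullet> (B *v w)))"
  have "f i \<bullet> (B *v f j) = (if i = j then 1 else 0)" if "i < Suc k" "j < Suc k" for i j
    using that e we symB[of "e i" w] ww
    by (auto simp: f_def less_Suc_eq matrix_vector_mult_scaleR real_sqrt_mult_self power2_eq_square[symmetric] field_simps)
  then show ?case by blast
qed simp

text \<open>With the orthonormal vectors as rows of \<open>E\<close> one has
  \<open>E B E^T = 1\<close>, hence \<open>B\<close> has the inverse \<open>E^T E\<close> and its
  form at \<open>a\<close> is the squared length of \<open>E a\<close>.\<close>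

lemma positive_symmetric_inverse_sum_squares:
  fixes B :: "real ^ 'n ^ 'n"
  assumes sym: "transpose B = B" and pos: "\<And>v. v \<noteq> 0 \<Longrightarrow> v \<bullet> (B *v v) > 0"
  obtains e :: "nat \<Rightarrow> real ^ 'n" where
    "\<And>i j. i < CARD('n) \<Longrightarrow> j < CARD('n) \<Longrightarrow> e i \<bullet> (B *v e j) = (if i = j then 1 else 0)"
    "\<And>a. a \<bullet> (matrix_inv B *v a) = (\<Sum>j<CARD('n). (e j \<bullet> a)\<^sup>2)"
proof -
  obtain e :: "nat \<Rightarrow> real ^ 'n" where
    e: "\<And>i j. i < CARD('n) \<Longrightarrow> j < CARD('n) \<Longrightarrow> e i \<bullet> (B *v e j) = (if i = j then 1 else 0)"
    using positive_bilinear_orthonormal_sequence[OF sym pos, of "CARD('n)"] by auto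
  \<comment> \<open>Matrix rows are indexed by the type \<open>'n\<close>, the orthonormal sequence
    by the numbers below its cardinality; \<phi> translates between them.\<close>
  obtain \<phi> where \<phi>: "bij_betw \<phi> (UNIV :: 'n set) {..<CARD('n)}"
    using finite_same_card_bij[of "UNIV :: 'n set" "{..<CARD('n)}"] by auto
  have \<phi>_less: "\<phi> i < CARD('n)" for i using \<phi> by (auto simp: bij_betw_def)
  have \<phi>_inj: "\<phi> i = \<phi> j \<longleftrightarrow> i = j" for i j using \<phi> by (auto simp: bij_betw_def inj_on_def)
  define E :: "real ^ 'n ^ 'n" where "E = (\<chi> i. e (\<phi> i))"
  have Ev: "(E *v v) $ i = e (\<phi> i) \<bullet> v" for v i
    by (simp add: E_def matrix_vector_mul_component)
  have col: "transpose E *v axis j 1 = e (\<phi> j)" for j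
    by (simp add: matrix_vector_mult_basis column_transpose row_def E_def vec_eq_iff)
  have "E ** (B ** transpose E) = mat 1"
  proof (rule matrix_eq[THEN iffD2], rule allI)
    fix x :: "real ^ 'n"
    show "E ** (B ** transpose E) *v x = mat 1 *v x"
    proof -
      have "(E ** (B ** transpose E)) $ i $ j = (if i = j then 1 else 0)" for i j
      proof -
        have "(E ** (B ** transpose E)) $ i $ j = ((E ** (B ** transpose E)) *v axis j 1) $ i"
          by (simp add: matrix_vector_mult_basis column_def)
        also have "\<dots> = e (\<phi> i) \<bullet> (B *v e (\<phi> j))"
          by (simp only: matrix_vector_mul_assoc[symmetric] Ev col)
        finally show ?thesis by (simp add: e \<phi>_less \<phi>_inj)
      qed
      then have "E ** (B ** transpose E) = mat 1" by (simp add: vec_eq_iff mat_def)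
      then show ?thesis by simp
    qed
  qed
  then have "(B ** transpose E) ** E = mat 1" by (rule matrix_left_right_inverse[THEN iffD1])
  then have 1: "B ** (transpose E ** E) = mat 1" by (simp add: matrix_mul_assoc)
  have inv: "matrix_inv B = transpose E ** E"
    using 1 by (rule matrix_inv_unique)
  have "a \<bullet> (matrix_inv B *v a) = (\<Sum>j<CARD('n). (e j \<bullet> a)\<^sup>2)" for a
  proof -
    have "a \<bullet> (matrix_inv B *v a) = (E *v a) \<bullet> (E *v a)"
      unfolding inv matrix_vector_mul_assoc[symmetric]
      by (metis dot_lmul_matrix inner_commute vector_transpose_matrix transpose_transpose)
    also have "\<dots> = (\<Sum>i\<in>UNIV. (e (\<phi> i) \<bullet> a)\<^sup>2)"
      by (simp add: inner_vec_def Ev power2_eq_square)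
    also have "\<dots> = (\<Sum>j<CARD('n). (e j \<bullet> a)\<^sup>2)"
      by (rule sum.reindex_bij_betw[OF \<phi>])
    finally show ?thesis .
  qed
  with e that show ?thesis by blast
qed

text \<open>Cramer's rule makes the entries of the inverse rational functions of the entries of
  \<open>A\<close>; continuity and measurability of inversion are read off from it.\<close>

lemma matrix_inv_Cramer:
  fixes A :: "real ^ 'n ^ 'n"
  assumes "det A \<noteq> 0"
  shows "matrix_inv A $ k $ l = det (\<chi> i j. if j = k then (if i = l then 1 else 0) else A $ i $ j) / det A"
proof -
  have "invertible A" using assms by (simp add: invertible_det_nz)
  then have "A *v (matrix_inv A *v axis l 1) = axis l 1"
    by (simp add: matrix_vector_mul_assoc matrix_inv_inverse)
  from cramer[OF assms, THEN iffD1, OF this]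
  have "(matrix_inv A *v axis l 1) $ k = det (\<chi> i j. if j = k then axis l 1 $ i else A $ i $ j) / det A"
    by simp
  moreover have "(matrix_inv A *v axis l 1) $ k = matrix_inv A $ k $ l"
    by (simp add: matrix_vector_mult_basis column_def)
  moreover have "(\<chi> i j. if j = k then axis l 1 $ i else A $ i $ j) =
      (\<chi> i j. if j = k then (if i = l then 1 else 0) else A $ i $ j)"
    by (simp add: vec_eq_iff axis_def)
  ultimately show ?thesis by (simp only:)
qed

lemma matrix_inv_singular:
  fixes A A' :: "real ^ 'n ^ 'n"
  assumes "det A = 0" "det A' = 0"
  shows "matrix_inv A = matrix_inv A'"
proof -
  have "\<not> invertible A" "\<not> invertible A'" using assms by (auto simp: invertible_det_nz)
  then have "(\<lambda>C. A ** C = mat 1 \<and> C ** A = mat 1) = (\<lambda>C. A' ** C = mat 1 \<and> C ** A' = mat 1)"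
    unfolding invertible_def by metis
  then show ?thesis unfolding matrix_inv_def by (simp only:)
qed

lemma tendsto_det:
  fixes A :: "'b \<Rightarrow> real ^ 'n ^ 'n"
  assumes "\<And>i j. ((\<lambda>x. A x $ i $ j) \<longlongrightarrow> A' $ i $ j) F"
  shows "((\<lambda>x. det (A x)) \<longlongrightarrow> det A') F"
  unfolding det_def by (intro tendsto_intros assms)

lemma measurable_det [measurable (raw)]:
  fixes A :: "'b \<Rightarrow> real ^ 'n ^ 'n"
  assumes [measurable]: "\<And>i j. (\<lambda>x. A x $ i $ j) \<in> borel_measurable N"
  shows "(\<lambda>x. det (A x)) \<in> borel_measurable N"
  unfolding det_def by measurable

lemma tendsto_matrix_inv:
  fixes A :: "'b \<Rightarrow> real ^ 'n ^ 'n"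
  assumes A: "\<And>i j. ((\<lambda>x. A x $ i $ j) \<longlongrightarrow> A' $ i $ j) F" and "det A' \<noteq> 0"
  shows "((\<lambda>x. matrix_inv (A x) $ k $ l) \<longlongrightarrow> matrix_inv A' $ k $ l) F"
proof -
  have det: "((\<lambda>x. det (A x)) \<longlongrightarrow> det A') F" by (rule tendsto_det[OF A])
  then have "\<forall>\<^sub>F x in F. det (A x) \<noteq> 0" using \<open>det A' \<noteq> 0\<close> by (rule tendsto_imp_eventually_ne)
  then have ev: "\<forall>\<^sub>F x in F. det (\<chi> i j. if j = k then (if i = l then 1 else 0) else A x $ i $ j) / det (A x)
      = matrix_inv (A x) $ k $ l"
    by eventually_elim (simp add: matrix_inv_Cramer)
  have "((\<lambda>x. det (\<chi> i j. if j = k then (if i = l then 1 else 0) else A x $ i $ j) / det (A x)) \<longlongrightarrow>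
      det (\<chi> i j. if j = k then (if i = l then 1 else 0) else A' $ i $ j) / det A') F"
    using \<open>det A' \<noteq> 0\<close> by (intro tendsto_divide det tendsto_det) (auto intro: A)
  then show ?thesis
    unfolding matrix_inv_Cramer[OF \<open>det A' \<noteq> 0\<close>] by (rule Lim_transform_eventually[OF _ ev])
qed

text \<open>On singular matrices \<open>matrix_inv\<close> is a choice from the empty set, hence constant.\<close>
lemma measurable_matrix_inv:
  fixes A :: "'b \<Rightarrow> real ^ 'n ^ 'n"
  assumes [measurable]: "\<And>i j. (\<lambda>x. A x $ i $ j) \<in> borel_measurable N"
  shows "(\<lambda>x. matrix_inv (A x) $ k $ l) \<in> borel_measurable N"
proof -
  have [measurable]: "(\<lambda>x. det (\<chi> i j. if j = k then (if i = l then 1 else 0) else A x $ i $ j)) \<in> borel_measurable N"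
    by (rule measurable_det) simp
  \<comment> \<open>The zero matrix serves as the reference singular matrix.\<close>
  have "det (0 :: real ^ 'n ^ 'n) = 0"
    by (rule det_zero_row(1)[of undefined]) (simp add: row_def vec_eq_iff)
  then have "(\<lambda>x. matrix_inv (A x) $ k $ l) = (\<lambda>x. if det (A x) = 0 then matrix_inv (0 :: real ^ 'n ^ 'n) $ k $ l
     else det (\<chi> i j. if j = k then (if i = l then 1 else 0) else A x $ i $ j) / det (A x))"
    using matrix_inv_singular[of "A _" "0 :: real ^ 'n ^ 'n"] matrix_inv_Cramer[of "A _"]
    by (intro ext) (simp split: if_split)
  then show ?thesis by simp
qed

lemma matrix_mult_component: "(A ** B) $ i $ j = (\<Sum>k\<in>UNIV. A $ i $ k * B $ k $ j)"
  by (simp add: matrix_matrix_mult_def)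

lemma positive_matrix_det_nz:
  fixes A :: "real ^ 'n ^ 'n"
  assumes "\<And>v. v \<noteq> 0 \<Longrightarrow> v \<bullet> (A *v v) > 0"
  shows "det A \<noteq> 0"
proof
  assume "det A = 0"
  then have "\<not> invertible A" by (simp add: invertible_det_nz)
  then obtain v where "v \<noteq> 0" "A *v v = 0"
    by (metis invertible_left_inverse matrix_left_invertible_ker)
  with assms[of v] show False by simp
qed

section \<open>The loss function and its derivatives\<close>

lemma logistic_bounds: "0 < logistic s" "logistic s < 1"
  by (auto simp: logistic_def divide_simps add_pos_pos)

lemma one_minus_logistic: "1 - logistic s = 1 / (1 + exp s)"
  by (simp add: logistic_def field_simps add_pos_pos[THEN less_imp_neq, symmetric])

lemma DERIV_logistic: "(logistic has_real_derivative logistic s * (1 - logistic s)) (at s)"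
proof -
  have nz: "1 + exp s \<noteq> 0" for s :: real using exp_gt_zero[of s] by linarith
  show ?thesis
    unfolding one_minus_logistic unfolding logistic_def[abs_def]
    using nz[of s] by (auto intro!: derivative_eq_intros simp: divide_simps power2_eq_square) (simp add: algebra_simps)
qed

lemma strict_mono_logistic: "strict_mono logistic"
proof (rule strict_monoI)
  fix s t :: real assume "s < t"
  then show "logistic s < logistic t"
    by (rule DERIV_pos_imp_increasing) (use DERIV_logistic logistic_bounds in \<open>auto intro!: exI[of _ "logistic _ * (1 - logistic _)"]\<close>)
qed

lemma logistic_less_iff: "logistic s < logistic t \<longleftrightarrow> s < t"
  using strict_mono_less[OF strict_mono_logistic] .

lemma logistic_le_iff: "logistic s \<le> logistic t \<longleftrightarrow> s \<le> t"
  using strict_mono_less_eq[OF strict_mono_logistic] .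

lemma DERIV_logistic_powr:
  "((\<lambda>s. logistic s powr l) has_real_derivative l * logistic s powr l * (1 - logistic s)) (at s)"
  using logistic_bounds[of s]
  by (auto intro!: derivative_eq_intros DERIV_logistic[THEN DERIV_cong] simp: powr_diff)

lemma DERIV_one_minus_logistic_powr:
  "((\<lambda>s. (1 - logistic s) powr l) has_real_derivative - (l * (1 - logistic s) powr l * logistic s)) (at s)"
  using logistic_bounds[of s]
  by (auto intro!: derivative_eq_intros DERIV_logistic[THEN DERIV_cong] simp: powr_diff)

text \<open>The factor h of the overview. For \<open>l > 0\<close> it tends to 0 as the fitted
  probability approaches 0 or 1; for \<open>l = 0\<close> it is 1, and \<open>score\<close> is the
  derivative of the negative log-likelihood.\<close>

definition score_weight :: "real \<Rightarrow> real \<Rightarrow> real" where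
  "score_weight l s = logistic s powr l * (1 - logistic s) + (1 - logistic s) powr l * logistic s"

definition score :: "real \<Rightarrow> real \<Rightarrow> real \<Rightarrow> real" where
  "score l s y = score_weight l s * (logistic s - y)"

text \<open>The derivative of \<open>score\<close> in \<open>s\<close>, arranged so that powers
  occur with exponent \<open>l\<close> only. The exponent \<open>l - 1\<close> would be unbounded
  for \<open>l < 1\<close>, whereas every factor here is bounded with bounded derivative.\<close>

definition score_deriv :: "real \<Rightarrow> real \<Rightarrow> real \<Rightarrow> real" where
  "score_deriv l s y =
     (l * logistic s powr l * (1 - logistic s) * (1 - logistic s)
       - logistic s powr l * (logistic s * (1 - logistic s))
       - l * (1 - logistic s) powr l * logistic s * logistic s
       + (1 - logistic s) powr l * (logistic s * (1 - logistic s))) * (logistic s - y)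
     + score_weight l s * (logistic s * (1 - logistic s))"

text \<open>The summand of the objective, rescaled by \<open>1 / (1 + l)\<close> for \<open>l > 0\<close> so that its derivative
  \<open>score\<close> is given by one formula for all \<open>l \<ge> 0\<close>.  It is affine in \<open>y\<close>.\<close>
definition loss :: "real \<Rightarrow> real \<Rightarrow> real \<Rightarrow> real" where
  "loss l s y = (if l = 0 then ln (1 + exp s) - y * s
     else (logistic s powr l * logistic s + (1 - logistic s) powr l * (1 - logistic s)
       - (1 + 1 / l) * (y * logistic s powr l + (1 - y) * (1 - logistic s) powr l)) / (1 + l))"

lemma score_weight_0 [simp]: "score_weight 0 s = 1"
  using logistic_bounds[of s] by (simp add: score_weight_def)

lemma score_weight_pos: "score_weight l s > 0"
  using logistic_bounds[of s] by (auto simp: score_weight_def intro!: add_pos_pos mult_pos_pos)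

lemma logistic_powr_le_1: "l \<ge> 0 \<Longrightarrow> logistic s powr l \<le> 1" "l \<ge> 0 \<Longrightarrow> (1 - logistic s) powr l \<le> 1"
  using logistic_bounds[of s] by (auto intro!: powr_le1)

lemma score_weight_le_1:
  assumes "l \<ge> 0" shows "score_weight l s \<le> 1"
proof -
  have "score_weight l s \<le> 1 * (1 - logistic s) + 1 * logistic s"
    unfolding score_weight_def using logistic_bounds[of s] assms
    by (intro add_mono mult_right_mono logistic_powr_le_1) auto
  then show ?thesis by simp
qed

lemma score_abs_le:
  assumes "l \<ge> 0" "0 \<le> y" "y \<le> 1" shows "\<bar>score l s y\<bar> \<le> 1"
proof -
  have "\<bar>score_weight l s\<bar> * \<bar>logistic s - y\<bar> \<le> 1 * 1"
    using score_weight_le_1[OF assms(1), of s] score_weight_pos[of l s] logistic_bounds[of s] assms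
    by (intro mult_mono) auto
  then show ?thesis by (simp add: score_def abs_mult)
qed

lemma DERIV_loss:
  assumes "l \<ge> 0"
  shows "((\<lambda>s. loss l s y) has_real_derivative score l s y) (at s)"
proof (cases "l = 0")
  case True
  have "1 + exp s > 0" by (simp add: add_pos_pos)
  then have "((\<lambda>s. ln (1 + exp s) - y * s) has_real_derivative logistic s - y) (at s)"
    by (auto intro!: derivative_eq_intros simp: logistic_def)
  then show ?thesis using True by (simp add: loss_def score_def)
next
  case False
  then have l: "l > 0" using assms by simp
  let ?p = "logistic s" and ?P = "logistic s powr l" and ?Q = "(1 - logistic s) powr l"
  have "((\<lambda>s. (logistic s powr l * logistic s + (1 - logistic s) powr l * (1 - logistic s)
       - (1 + 1 / l) * (y * logistic s powr l + (1 - y) * (1 - logistic s) powr l)) / (1 + l)) has_real_derivative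
     ((l * ?P * (1 - ?p) * ?p + ?P * (?p * (1 - ?p))) + (- (l * ?Q * ?p) * (1 - ?p) - ?Q * (?p * (1 - ?p)))
      - (1 + 1 / l) * (y * (l * ?P * (1 - ?p)) + (1 - y) * (- (l * ?Q * ?p)))) / (1 + l)) (at s)"
    by (rule DERIV_cong, (rule DERIV_cdivide DERIV_add DERIV_diff DERIV_logistic_powr DERIV_one_minus_logistic_powr DERIV_logistic DERIV_const DERIV_mult)+)
       (simp add: algebra_simps)
  also have "((l * ?P * (1 - ?p) * ?p + ?P * (?p * (1 - ?p))) + (- (l * ?Q * ?p) * (1 - ?p) - ?Q * (?p * (1 - ?p)))
      - (1 + 1 / l) * (y * (l * ?P * (1 - ?p)) + (1 - y) * (- (l * ?Q * ?p)))) / (1 + l) = score l s y"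
    using l unfolding score_def score_weight_def by (simp add: divide_simps) algebra
  finally show ?thesis using False by (simp add: loss_def)
qed

lemma DERIV_score: "((\<lambda>s. score l s y) has_real_derivative score_deriv l s y) (at s)"
  unfolding score_def[abs_def] score_weight_def[abs_def] score_deriv_def
  by (rule DERIV_cong, (rule DERIV_cdivide DERIV_add DERIV_diff DERIV_logistic_powr DERIV_one_minus_logistic_powr DERIV_logistic DERIV_const DERIV_mult)+)
     (simp add: algebra_simps)

section \<open>Divided differences of the score\<close>

lemma MVT_symmetric:
  fixes f :: "real \<Rightarrow> real"
  assumes "\<And>x. (f has_real_derivative f' x) (at x)"
  shows "\<exists>z. \<bar>z - t\<bar> \<le> \<bar>s - t\<bar> \<and> f s - f t = f' z * (s - t)"
proof (cases s t rule: linorder_cases)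
  case less
  then obtain z where "s < z" "z < t" "f t - f s = (t - s) * f' z"
    using MVT2[of s t f f'] assms by blast
  then show ?thesis by (intro exI[of _ z]) (auto simp: algebra_simps)
next
  case greater
  then obtain z where "t < z" "z < s" "f s - f t = (s - t) * f' z"
    using MVT2[of t s f f'] assms by blast
  then show ?thesis by (intro exI[of _ z]) auto
qed auto

lemma Lipschitz_if_DERIV_bounded:
  fixes f :: "real \<Rightarrow> real"
  assumes "\<And>x. (f has_real_derivative f' x) (at x)" "\<And>x. \<bar>f' x\<bar> \<le> C"
  shows "\<bar>f s - f t\<bar> \<le> C * \<bar>s - t\<bar>"
proof -
  obtain z where "f s - f t = f' z * (s - t)" using MVT_symmetric[OF assms(1), of t s] by blast
  then show ?thesis using assms(2)[of z] by (simp add: abs_mult mult_right_mono)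
qed

text \<open>The Lipschitz condition alone is not preserved by products; together with boundedness it
  is. One constant serves for both bounds.\<close>

definition bounded_Lipschitz :: "(real \<Rightarrow> real) \<Rightarrow> bool" where
  "bounded_Lipschitz f \<longleftrightarrow> (\<exists>C. \<forall>s t. \<bar>f s\<bar> \<le> C \<and> \<bar>f s - f t\<bar> \<le> C * \<bar>s - t\<bar>)"

lemma bounded_Lipschitz_const: "bounded_Lipschitz (\<lambda>s. c)"
  unfolding bounded_Lipschitz_def by (intro exI[of _ "\<bar>c\<bar>"]) auto

lemma bounded_Lipschitz_add:
  assumes "bounded_Lipschitz f" "bounded_Lipschitz g"
  shows "bounded_Lipschitz (\<lambda>s. f s + g s)"
proof -
  obtain C D where C: "\<And>s t. \<bar>f s\<bar> \<le> C \<and> \<bar>f s - f t\<bar> \<le> C * \<bar>s - t\<bar>"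
    and D: "\<And>s t. \<bar>g s\<bar> \<le> D \<and> \<bar>g s - g t\<bar> \<le> D * \<bar>s - t\<bar>"
    using assms unfolding bounded_Lipschitz_def by blast
  have "\<bar>f s + g s\<bar> \<le> C + D \<and> \<bar>(f s + g s) - (f t + g t)\<bar> \<le> (C + D) * \<bar>s - t\<bar>" for s t
    using C[of s t] D[of s t] unfolding distrib_right by linarith
  then show ?thesis unfolding bounded_Lipschitz_def by blast
qed

lemma bounded_Lipschitz_mult:
  assumes "bounded_Lipschitz f" "bounded_Lipschitz g"
  shows "bounded_Lipschitz (\<lambda>s. f s * g s)"
proof -
  obtain C D where C: "\<And>s t. \<bar>f s\<bar> \<le> C \<and> \<bar>f s - f t\<bar> \<le> C * \<bar>s - t\<bar>"
    and D: "\<And>s t. \<bar>g s\<bar> \<le> D \<and> \<bar>g s - g t\<bar> \<le> D * \<bar>s - t\<bar>"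
    using assms unfolding bounded_Lipschitz_def by blast
  have C0: "C \<ge> 0" "D \<ge> 0" using C[of 0 0] D[of 0 0] by auto
  have "\<bar>f s * g s\<bar> \<le> 2 * C * D \<and> \<bar>f s * g s - f t * g t\<bar> \<le> (2 * C * D) * \<bar>s - t\<bar>" for s t
  proof
    have "\<bar>f s\<bar> * \<bar>g s\<bar> \<le> C * D" using C D C0 by (intro mult_mono) auto
    then show "\<bar>f s * g s\<bar> \<le> 2 * C * D" using mult_nonneg_nonneg[OF C0] unfolding abs_mult by linarith
    have "\<bar>f s * g s - f t * g t\<bar> = \<bar>f s * (g s - g t) + (f s - f t) * g t\<bar>" by (simp add: algebra_simps)
    also have "\<dots> \<le> \<bar>f s\<bar> * \<bar>g s - g t\<bar> + \<bar>f s - f t\<bar> * \<bar>g t\<bar>"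
      by (rule order.trans[OF abs_triangle_ineq]) (simp add: abs_mult)
    also have "\<dots> \<le> C * (D * \<bar>s - t\<bar>) + (C * \<bar>s - t\<bar>) * D"
      using C[of s t] D[of s t] D[of t s] C0 by (intro add_mono mult_mono) auto
    finally show "\<bar>f s * g s - f t * g t\<bar> \<le> (2 * C * D) * \<bar>s - t\<bar>" by (simp add: algebra_simps)
  qed
  then show ?thesis unfolding bounded_Lipschitz_def by blast
qed

lemma bounded_Lipschitz_diff:
  assumes "bounded_Lipschitz f" "bounded_Lipschitz g"
  shows "bounded_Lipschitz (\<lambda>s. f s - g s)"
  using bounded_Lipschitz_add[OF assms(1) bounded_Lipschitz_mult[OF bounded_Lipschitz_const[of "-1"] assms(2)]]
  by simp

lemma bounded_Lipschitz_if_DERIV: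
  fixes f :: "real \<Rightarrow> real"
  assumes "\<And>x. (f has_real_derivative f' x) (at x)" "\<And>x. \<bar>f' x\<bar> \<le> C" "\<And>x. \<bar>f x\<bar> \<le> D"
  shows "bounded_Lipschitz f"
proof -
  have "\<bar>f s\<bar> \<le> max C D \<and> \<bar>f s - f t\<bar> \<le> max C D * \<bar>s - t\<bar>" for s t
    using assms(3)[of s] Lipschitz_if_DERIV_bounded[OF assms(1,2), of s t]
      mult_right_mono[of C "max C D" "\<bar>s - t\<bar>"] by auto
  then show ?thesis unfolding bounded_Lipschitz_def by blast
qed

lemma bounded_Lipschitz_score_deriv:
  assumes "l \<ge> 0" shows "bounded_Lipschitz (\<lambda>s. score_deriv l s y)"
proof -
  have p: "\<bar>logistic s\<bar> \<le> 1" "\<bar>1 - logistic s\<bar> \<le> 1" for s using logistic_bounds[of s] by auto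
  have P: "\<bar>logistic s powr l\<bar> \<le> 1" "\<bar>(1 - logistic s) powr l\<bar> \<le> 1" for s
    using logistic_powr_le_1[OF assms] by auto
  have 1: "bounded_Lipschitz logistic"
    using p by (intro bounded_Lipschitz_if_DERIV[OF DERIV_logistic, where C=1 and D=1])
      (auto simp: abs_mult intro!: mult_le_one)
  have 2: "bounded_Lipschitz (\<lambda>s. logistic s powr l)"
  proof (rule bounded_Lipschitz_if_DERIV[OF DERIV_logistic_powr, where C=l and D=1])
    fix s
    have "l * \<bar>logistic s powr l\<bar> * \<bar>1 - logistic s\<bar> \<le> l * 1 * 1"
      using p[of s] P[of s] assms by (intro mult_mono) auto
    then show "\<bar>l * logistic s powr l * (1 - logistic s)\<bar> \<le> l" using assms by (simp add: abs_mult)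
  qed (rule P)
  have 3: "bounded_Lipschitz (\<lambda>s. (1 - logistic s) powr l)"
  proof (rule bounded_Lipschitz_if_DERIV[OF DERIV_one_minus_logistic_powr, where C=l and D=1])
    fix s
    have "l * \<bar>(1 - logistic s) powr l\<bar> * \<bar>logistic s\<bar> \<le> l * 1 * 1"
      using p[of s] P[of s] assms by (intro mult_mono) auto
    then show "\<bar>- (l * (1 - logistic s) powr l * logistic s)\<bar> \<le> l" using assms by (simp add: abs_mult)
  qed (rule P)
  show ?thesis unfolding score_deriv_def score_weight_def
    by (intro bounded_Lipschitz_add bounded_Lipschitz_mult bounded_Lipschitz_diff bounded_Lipschitz_const 1 2 3)
qed

text \<open>The Lipschitz property of \<open>score_deriv\<close> serves small steps and its bound
  serves large ones. The cutoff at 1 later keeps the remainder below a multiple of the squared norm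
  of the covariate, which is integrable.\<close>

lemma score_divided_difference:
  assumes "l \<ge> 0"
  obtains C where "C \<ge> 0" "\<And>y s. y \<in> {0, 1} \<Longrightarrow> \<bar>score_deriv l s y\<bar> \<le> C"
    "\<And>y s t. y \<in> {0, 1} \<Longrightarrow>
      \<exists>c. score l s y - score l t y = c * (s - t) \<and> \<bar>c - score_deriv l t y\<bar> \<le> C * min 1 \<bar>s - t\<bar>"
proof -
  obtain C0 C1 where C: "\<And>s t. \<bar>score_deriv l s 0\<bar> \<le> C0 \<and> \<bar>score_deriv l s 0 - score_deriv l t 0\<bar> \<le> C0 * \<bar>s - t\<bar>"
    "\<And>s t. \<bar>score_deriv l s 1\<bar> \<le> C1 \<and> \<bar>score_deriv l s 1 - score_deriv l t 1\<bar> \<le> C1 * \<bar>s - t\<bar>"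
    using bounded_Lipschitz_score_deriv[OF assms] unfolding bounded_Lipschitz_def by metis
  define C where "C = C0 + C1"
  have C0: "C0 \<ge> 0" "C1 \<ge> 0" using C(1)[of 0 0] C(2)[of 0 0] by auto
  have bd: "\<bar>score_deriv l s y\<bar> \<le> C" "\<bar>score_deriv l s y - score_deriv l t y\<bar> \<le> C * \<bar>s - t\<bar>"
    if "y \<in> {0, 1}" for s t y
    using that C(1)[of s t] C(2)[of s t] C0 mult_nonneg_nonneg[OF C0(1), of "\<bar>s - t\<bar>"]
      mult_nonneg_nonneg[OF C0(2), of "\<bar>s - t\<bar>"]
    unfolding C_def distrib_right by auto
  show ?thesis
  \<comment> \<open>Twice the constant, because a large step compares two values of
    \<open>score_deriv\<close>, each bounded by \<open>C\<close>.\<close>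
  proof (rule that[of "2 * C"])
    show "2 * C \<ge> 0" using C0 by (simp add: C_def)
    show "\<bar>score_deriv l s y\<bar> \<le> 2 * C" if "y \<in> {0, 1}" for y s
      using bd(1)[OF that, of s] by linarith
    fix y s t :: real assume y: "y \<in> {0, 1}"
    obtain z where z: "\<bar>z - t\<bar> \<le> \<bar>s - t\<bar>" "score l s y - score l t y = score_deriv l z y * (s - t)"
      using MVT_symmetric[OF DERIV_score] by blast
    have "\<bar>score_deriv l z y - score_deriv l t y\<bar> \<le> 2 * C * min 1 \<bar>s - t\<bar>"
    proof (cases "\<bar>s - t\<bar> \<le> 1")
      case True
      have "\<bar>score_deriv l z y - score_deriv l t y\<bar> \<le> C * \<bar>z - t\<bar>" by (rule bd[OF y])
      also have "\<dots> \<le> 2 * C * \<bar>s - t\<bar>" using z(1) C0 by (intro mult_mono) (auto simp: C_def)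
      finally show ?thesis using True by simp
    next
      case False
      then show ?thesis using bd(1)[OF y, of z] bd(1)[OF y, of t] by auto
    qed
    with z(2) show "\<exists>c. score l s y - score l t y = c * (s - t) \<and> \<bar>c - score_deriv l t y\<bar> \<le> 2 * C * min 1 \<bar>s - t\<bar>"
      by blast
  qed
qed

lemma score_deriv_mean: "score_deriv l s (logistic s) = score_weight l s * (logistic s * (1 - logistic s))"
  by (simp add: score_deriv_def)

section \<open>Splitting the loss into conditional mean excess and noise\<close>

lemma loss_affine: "loss l s y = loss l s 0 + y * (loss l s 1 - loss l s 0)"
  by (simp add: loss_def divide_simps) (simp add: algebra_simps)

text \<open>The coefficient of \<open>y\<close> in the affine function \<open>loss l s\<close>; in
  differences of losses it is what the noise gets multiplied by.\<close>

definition response :: "real \<Rightarrow> real \<Rightarrow> real" where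
  "response l s = loss l s 1 - loss l s 0"

text \<open>The conditional mean of the excess loss of \<open>s\<close> when \<open>t\<close> is the
  true linear predictor. Since the loss is affine in \<open>y\<close>, averaging replaces
  \<open>y\<close> by its mean \<open>logistic t\<close>.\<close>

definition excess :: "real \<Rightarrow> real \<Rightarrow> real \<Rightarrow> real" where
  "excess l s t = loss l s (logistic t) - loss l t (logistic t)"

lemma loss_diff: "loss l s y - loss l t y = excess l s t + (y - logistic t) * (response l s - response l t)"
  using loss_affine[of l s y] loss_affine[of l t y] loss_affine[of l s "logistic t"] loss_affine[of l t "logistic t"]
  unfolding excess_def response_def by (simp add: algebra_simps)

lemma DERIV_excess:
  assumes "l \<ge> 0"
  shows "((\<lambda>s. excess l s t) has_real_derivative score_weight l s * (logistic s - logistic t)) (at s)"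
  unfolding excess_def using DERIV_loss[OF assms, of "logistic t" s]
  by (auto intro!: derivative_eq_intros simp: score_def)

lemma DERIV_response:
  assumes "l \<ge> 0"
  shows "(response l has_real_derivative - score_weight l s) (at s)"
  unfolding response_def[abs_def]
  by (rule derivative_eq_intros DERIV_loss[OF assms] refl)+ (simp add: score_def algebra_simps)

lemma excess_self [simp]: "excess l t t = 0" by (simp add: excess_def)

text \<open>The derivative has the sign of \<open>s - t\<close>, so the excess grows in both
  directions away from \<open>t\<close>.\<close>

lemma excess_mono_ray:
  assumes "l \<ge> 0" "0 \<le> c" "c \<le> 1"
  shows "excess l (t + c * w) t \<le> excess l (t + w) t"
proof (cases "w \<ge> 0")
  case True
  then have "t + c * w \<le> t + w" using assms by (simp add: mult_left_le_one_le)
  then show ?thesis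
  proof (rule DERIV_nonneg_imp_nondecreasing)
    fix x assume "t + c * w \<le> x"
    moreover have "c * w \<ge> 0" using True assms by simp
    ultimately have "logistic x \<ge> logistic t" by (simp add: logistic_le_iff)
    then show "\<exists>y. ((\<lambda>s. excess l s t) has_real_derivative y) (at x) \<and> 0 \<le> y"
      using DERIV_excess[OF assms(1), of t x] score_weight_pos[of l x]
      by (intro exI[of _ "score_weight l x * (logistic x - logistic t)"] conjI) (auto intro!: mult_nonneg_nonneg)
  qed
next
  case False
  then have "t + w \<le> t + c * w"
    using assms mult_right_mono_neg[of c 1 w] by simp
  then show ?thesis
  proof (rule DERIV_nonpos_imp_nonincreasing)
    fix x assume "x \<le> t + c * w"
    moreover have "c * w \<le> 0" using False assms by (simp add: mult_nonneg_nonpos)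
    ultimately have "logistic x \<le> logistic t" by (simp add: logistic_le_iff)
    then show "\<exists>y. ((\<lambda>s. excess l s t) has_real_derivative y) (at x) \<and> y \<le> 0"
      using DERIV_excess[OF assms(1), of t x] score_weight_pos[of l x]
      by (intro exI[of _ "score_weight l x * (logistic x - logistic t)"] conjI) (auto intro!: mult_nonneg_nonpos)
  qed
qed

lemma excess_pos:
  assumes "l \<ge> 0" "s \<noteq> t"
  shows "excess l s t > 0"
proof (cases "t < s")
  case True
  have "excess l t t < excess l s t"
  proof (rule DERIV_pos_imp_increasing_open[OF True])
    fix x assume "t < x"
    then show "\<exists>y. ((\<lambda>s. excess l s t) has_real_derivative y) (at x) \<and> 0 < y"
      using DERIV_excess[OF assms(1), of t x] score_weight_pos[of l x]
      by (intro exI[of _ "score_weight l x * (logistic x - logistic t)"] conjI) (auto intro!: mult_pos_pos simp: logistic_less_iff)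
  qed (auto intro!: DERIV_isCont[OF DERIV_excess[OF assms(1)]] continuous_at_imp_continuous_on)
  then show ?thesis by simp
next
  case False
  with assms have "s < t" by simp
  then have "excess l s t > excess l t t"
  proof (rule DERIV_neg_imp_decreasing_open)
    fix x assume "x < t"
    then show "\<exists>y. ((\<lambda>s. excess l s t) has_real_derivative y) (at x) \<and> y < 0"
      using DERIV_excess[OF assms(1), of t x] score_weight_pos[of l x]
      by (intro exI[of _ "score_weight l x * (logistic x - logistic t)"] conjI) (auto intro!: mult_pos_neg simp: logistic_less_iff)
  qed (auto intro!: DERIV_isCont[OF DERIV_excess[OF assms(1)]] continuous_at_imp_continuous_on)
  then show ?thesis by simp
qed

lemma excess_nonneg: "l \<ge> 0 \<Longrightarrow> excess l s t \<ge> 0"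
  using excess_pos[of l s t] by (cases "s = t") auto

lemma excess_Lipschitz:
  assumes "l \<ge> 0"
  shows "\<bar>excess l s t - excess l s' t\<bar> \<le> \<bar>s - s'\<bar>"
proof -
  have "\<bar>excess l s t - excess l s' t\<bar> \<le> 1 * \<bar>s - s'\<bar>"
  proof (rule Lipschitz_if_DERIV_bounded[OF DERIV_excess[OF assms]])
    fix x show "\<bar>score_weight l x * (logistic x - logistic t)\<bar> \<le> 1"
      using score_abs_le[OF assms, of "logistic t" x] logistic_bounds[of t] by (simp add: score_def)
  qed
  then show ?thesis by simp
qed

text \<open>For \<open>l = 0\<close> the derivative \<open>logistic s - logistic t\<close> is
  increasing, so the excess is convex in \<open>s\<close>, and it vanishes at \<open>t\<close>. The
  resulting growth along rays is what outweighs noise that is linear in the parameter.\<close>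

lemma excess_0_superlinear:
  assumes "0 \<le> c" "c \<le> 1"
  shows "excess 0 (t + c * w) t \<le> c * excess 0 (t + w) t"
proof -
  have "convex_on UNIV (\<lambda>s. excess 0 s t)"
    by (rule convex_on_realI[OF _ DERIV_excess]) (auto simp: logistic_le_iff)
  from convex_onD[OF this assms, of t "t + w"] show ?thesis
    by (simp add: algebra_simps)
qed

lemma response_antimono:
  assumes "l \<ge> 0"
  shows "antimono (response l)"
proof (rule antimonoI)
  fix s t :: real assume "s \<le> t"
  then show "response l t \<le> response l s"
  proof (rule DERIV_nonpos_imp_nonincreasing)
    fix x
    show "\<exists>y. (response l has_real_derivative y) (at x) \<and> y \<le> 0"
      using DERIV_response[OF assms, of x] score_weight_pos[of l x] by (meson neg_le_0_iff_le less_imp_le)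
  qed
qed

lemma response_Lipschitz:
  assumes "l \<ge> 0"
  shows "\<bar>response l s - response l t\<bar> \<le> \<bar>s - t\<bar>"
proof -
  have "\<bar>response l s - response l t\<bar> \<le> 1 * \<bar>s - t\<bar>"
    using score_weight_le_1[OF assms] score_weight_pos[of l]
    by (intro Lipschitz_if_DERIV_bounded[OF DERIV_response[OF assms]]) (auto simp: less_imp_le)
  then show ?thesis by simp
qed

lemma response_0: "response 0 s = - s" by (simp add: response_def loss_def)

lemma tendsto_logistic: "(logistic \<longlongrightarrow> 1) at_top" "(logistic \<longlongrightarrow> 0) at_bot"
proof -
  show "(logistic \<longlongrightarrow> 0) at_bot"
  proof -
    have "((\<lambda>s::real. exp s / (1 + exp s)) \<longlongrightarrow> 0 / (1 + 0)) at_bot"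
      by (intro tendsto_intros exp_at_bot) auto
    then show ?thesis by (simp add: logistic_def[abs_def])
  qed
  have "((\<lambda>s::real. 1 - 1 / (1 + exp s)) \<longlongrightarrow> 1 - 0) at_top"
    by (intro tendsto_intros tendsto_divide_0[OF tendsto_const] filterlim_at_top_imp_at_infinity
        filterlim_tendsto_add_at_top[OF tendsto_const] exp_at_top)
  then show "(logistic \<longlongrightarrow> 1) at_top"
    by (simp add: one_minus_logistic[symmetric])
qed

text \<open>Finite limits at both ends make the response bounded for \<open>l > 0\<close>; the
  brackets at infinity are built from these limits.\<close>

lemma tendsto_response:
  assumes "l > 0"
  shows "(response l \<longlongrightarrow> - 1 / l) at_top" "(response l \<longlongrightarrow> 1 / l) at_bot"
proof -
  have eq: "response l = (\<lambda>s. ((1 - logistic s) powr l - logistic s powr l) / l)"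
  proof
    fix s
    have "(a - c * P) / d - (a - c * Q) / d = c / d * (Q - P)" for a c d P Q :: real
      by (simp add: diff_divide_distrib right_diff_distrib)
    \<comment> \<open>The factor \<open>1 + 1 / l\<close> of the objective and the rescaling of
      \<open>loss\<close> by \<open>1 + l\<close> combine to \<open>1 / l\<close>.\<close>
    moreover have "(1 + 1 / l) / (1 + l) = 1 / l" using assms by (simp add: divide_simps)
    ultimately have "(a - (1 + 1 / l) * P) / (1 + l) - (a - (1 + 1 / l) * Q) / (1 + l) = 1 / l * (Q - P)" for a P Q :: real
      by (simp only:)
    then show "response l s = ((1 - logistic s) powr l - logistic s powr l) / l"
      using assms by (simp add: response_def loss_def)
  qed
  show "(response l \<longlongrightarrow> - 1 / l) at_top"
  proof -
    have "((\<lambda>s. ((1 - logistic s) powr l - logistic s powr l) / l) \<longlongrightarrow> ((1 - 1) powr l - 1 powr l) / l) at_top"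
      using assms logistic_bounds
      by (intro tendsto_intros tendsto_powr' tendsto_logistic) (auto intro!: always_eventually less_imp_le)
    then show ?thesis unfolding eq by simp
  qed
  show "(response l \<longlongrightarrow> 1 / l) at_bot"
  proof -
    have "((\<lambda>s. ((1 - logistic s) powr l - logistic s powr l) / l) \<longlongrightarrow> ((1 - 0) powr l - 0 powr l) / l) at_bot"
      using assms logistic_bounds
      by (intro tendsto_intros tendsto_powr' tendsto_logistic) (auto intro!: always_eventually less_imp_le)
    then show ?thesis unfolding eq by simp
  qed
qed

section \<open>Closed forms of the weights, and the estimator as a minimiser of the summed
  loss\<close>

lemma score_weight_eq:
  "score_weight l s = (exp (l * s) + exp s) / (1 + exp s) powr (l + 1)"
proof -
  have pos: "1 + exp s > 0" by (simp add: add_pos_pos)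
  have "logistic s powr l = exp (l * s) / (1 + exp s) powr l"
    using pos by (simp add: logistic_def powr_divide exp_powr_real mult.commute)
  moreover have "(1 - logistic s) powr l = 1 / (1 + exp s) powr l"
    using pos by (simp add: one_minus_logistic powr_divide)
  ultimately have "score_weight l s = exp (l * s) / (1 + exp s) powr l * (1 / (1 + exp s))
      + 1 / (1 + exp s) powr l * (exp s / (1 + exp s))"
    unfolding score_weight_def by (simp only: one_minus_logistic) (simp add: logistic_def)
  also have "\<dots> = (exp (l * s) + exp s) / (1 + exp s) powr (l + 1)"
    using pos by (simp add: powr_add add_divide_distrib)
  finally show ?thesis .
qed

lemma logistic_variance_eq: "logistic s * (1 - logistic s) = exp s / (1 + exp s)\<^sup>2"
  by (simp add: one_minus_logistic) (simp add: logistic_def power2_eq_square)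

lemma J_integrand_eq:
  "J_integrand l \<beta> x = (score_weight l (x \<bullet> \<beta>) * (logistic (x \<bullet> \<beta>) * (1 - logistic (x \<bullet> \<beta>)))) *\<^sub>R (\<chi> i j. x $ i * x $ j)"
proof -
  have pos: "1 + exp (x \<bullet> \<beta>) > 0" by (simp add: add_pos_pos)
  have "(1 + exp (x \<bullet> \<beta>)) powr (l + 3) = (1 + exp (x \<bullet> \<beta>)) powr (l + 1) * (1 + exp (x \<bullet> \<beta>)) powr 2"
    by (simp only: powr_add[symmetric]) (simp add: algebra_simps)
  also have "(1 + exp (x \<bullet> \<beta>)) powr 2 = (1 + exp (x \<bullet> \<beta>))\<^sup>2"
    using powr_realpow[OF pos, of 2] by simp
  finally show ?thesis unfolding J_integrand_def score_weight_eq logistic_variance_eq by simp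
qed

lemma K_integrand_eq:
  "K_integrand l \<beta> x = ((score_weight l (x \<bullet> \<beta>))\<^sup>2 * (logistic (x \<bullet> \<beta>) * (1 - logistic (x \<bullet> \<beta>)))) *\<^sub>R (\<chi> i j. x $ i * x $ j)"
proof -
  have pos: "1 + exp (x \<bullet> \<beta>) > 0" by (simp add: add_pos_pos)
  have "(1 + exp (x \<bullet> \<beta>)) powr (2 * (l + 2)) = (1 + exp (x \<bullet> \<beta>)) powr (l + 1) * (1 + exp (x \<bullet> \<beta>)) powr (l + 1) * (1 + exp (x \<bullet> \<beta>)) powr 2"
    by (simp only: powr_add[symmetric]) (simp add: algebra_simps)
  also have "(1 + exp (x \<bullet> \<beta>)) powr 2 = (1 + exp (x \<bullet> \<beta>))\<^sup>2"
    using powr_realpow[OF pos, of 2] by simp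
  finally show ?thesis unfolding K_integrand_def score_weight_eq logistic_variance_eq
    by (simp add: power_divide power2_eq_square)
qed

lemma likelihood_eq:
  assumes "\<And>i. i < n \<Longrightarrow> y i \<in> {0, 1}"
  shows "likelihood n x y \<beta> = exp (- (\<Sum>i<n. loss 0 (x i \<bullet> \<beta>) (y i)))"
proof -
  have "logistic s powr v * (1 - logistic s) powr (1 - v) = exp (- loss 0 s v)" if "v \<in> {0, 1}" for s v
  proof -
    have "exp (ln (1 + exp s)) = 1 + exp s" by (simp add: add_pos_pos)
    then show ?thesis using that logistic_bounds[of s]
      by (auto simp: loss_def exp_diff exp_minus one_minus_logistic inverse_eq_divide) (simp add: logistic_def)
  qed
  then show ?thesis unfolding likelihood_def
    using assms by (simp add: exp_sum sum_negf[symmetric])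
qed

lemma dpd_objective_eq:
  assumes "l > 0"
  shows "dpd_objective l n x y \<beta>
    = 1 / real n powr (1 + l) * ((1 + l) * (\<Sum>i<n. loss l (x i \<bullet> \<beta>) (y i)) + real n / l)"
proof -
  have "logistic s powr (1 + l) + (1 - logistic s) powr (1 + l)
        - (1 + 1 / l) * (v * logistic s powr l + (1 - v) * (1 - logistic s) powr l) = (1 + l) * loss l s v" for s v
    using assms logistic_bounds[of s] by (simp add: loss_def powr_add mult.commute)
  then show ?thesis unfolding dpd_objective_def by (simp add: sum_distrib_left)
qed

text \<open>The likelihood is a decreasing function of the summed loss, and for \<open>l > 0\<close>
  the objective is an increasing affine function of it, so one minimisation problem covers both
  cases.\<close>

lemma is_mdpde_iff:
  assumes "l \<ge> 0" "n > 0" "\<And>i. i < n \<Longrightarrow> y i \<in> {0, 1}"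
  shows "is_mdpde l n x y b \<longleftrightarrow> (\<forall>\<beta>. (\<Sum>i<n. loss l (x i \<bullet> b) (y i)) \<le> (\<Sum>i<n. loss l (x i \<bullet> \<beta>) (y i)))"
proof (cases "l = 0")
  case True
  then show ?thesis
    by (simp add: is_mdpde_def is_arg_max_def likelihood_eq[OF assms(3)] not_less)
next
  case False
  then have "l > 0" using assms by simp
  moreover have "1 / real n powr (1 + l) > 0" using assms by simp
  ultimately show ?thesis
    by (simp add: is_mdpde_def is_arg_min_linorder dpd_objective_eq divide_le_cancel)
qed

section \<open>Finite bracketing of ridge functions\<close>

text \<open>Brackets in the L1 norm of \<open>H\<close> for the functions
  \<open>r (x \<bullet> \<beta>)\<close> with \<beta> in \<open>U\<close>. The gap and the enclosure
  are tested on points of \<open>V\<close> only, so that the induction can pass to a smaller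
  subspace of points together with one of parameters.\<close>

definition brackets :: "(real ^ 'p) measure \<Rightarrow> (real \<Rightarrow> real) \<Rightarrow> (real ^ 'p) set \<Rightarrow> (real ^ 'p) set \<Rightarrow> real
    \<Rightarrow> ((real ^ 'p \<Rightarrow> real) \<times> (real ^ 'p \<Rightarrow> real)) set \<Rightarrow> bool" where
  "brackets H r V U \<epsilon> B \<longleftrightarrow> finite B \<and>
     (\<forall>(lo, up)\<in>B. integrable H lo \<and> integrable H up \<and> (\<forall>x. lo x \<le> up x) \<and>
        (\<integral>x. indicator V x * (up x - lo x) \<partial>H) < \<epsilon>) \<and>
     (\<forall>\<beta>\<in>U. \<exists>(lo, up)\<in>B. \<forall>x\<in>V. lo x \<le> r (x \<bullet> \<beta>) \<and> r (x \<bullet> \<beta>) \<le> up x)"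

lemma brackets_Un:
  assumes "brackets H r V U \<epsilon> B" "brackets H r V U' \<epsilon> B'"
  shows "brackets H r V (U \<union> U') \<epsilon> (B \<union> B')"
  using assms unfolding brackets_def by blast

lemma brackets_UN:
  assumes "finite I" "\<And>i. i \<in> I \<Longrightarrow> \<exists>B. brackets H r V (U i) \<epsilon> B"
  shows "\<exists>B. brackets H r V (\<Union>i\<in>I. U i) \<epsilon> B"
  using assms
proof (induction I rule: finite_induct)
  case empty
  have "brackets H r V {} \<epsilon> {}" by (simp add: brackets_def)
  then show ?case by auto
next
  case (insert i I)
  then show ?case using brackets_Un by fastforce
qed

lemma brackets_subset: "brackets H r V U \<epsilon> B \<Longrightarrow> U' \<subseteq> U \<Longrightarrow> brackets H r V U' \<epsilon> B"
  unfolding brackets_def by blast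

context
  fixes H :: "(real ^ 'p) measure" and r :: "real \<Rightarrow> real" and a b L :: real
  assumes H: "prob_space H" and sets_H: "sets H = sets borel"
    and norm_int: "integrable H norm"
    and anti: "antimono r" and Lip: "\<And>s t. \<bar>r s - r t\<bar> \<le> L * \<bar>s - t\<bar>"
    and lim_bot: "(r \<longlongrightarrow> a) at_bot" and lim_top: "(r \<longlongrightarrow> b) at_top"
begin

interpretation prob_space H by (rule H)

lemma measurable_H: "measurable H N = measurable borel N"
  by (rule measurable_cong_sets[OF sets_H refl])

lemma L_nonneg: "L \<ge> 0" using order.trans[OF abs_ge_zero Lip[of 0 1]] by simp

lemma r_le_a: "r s \<le> a"
  using lim_bot by (rule tendsto_lowerbound)
    (auto intro!: eventually_at_bot_linorder[THEN iffD2] exI[of _ s] antimonoD[OF anti])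

lemma b_le_r: "b \<le> r s"
  using lim_top by (rule tendsto_upperbound)
    (auto intro!: eventually_at_top_linorder[THEN iffD2] exI[of _ s] antimonoD[OF anti])

lemma r_measurable: "r \<in> borel_measurable borel"
proof -
  have "isCont r s" for s
    unfolding continuous_within
  proof (rule metric_tendsto_imp_tendsto)
    show "((\<lambda>t. L * \<bar>t - s\<bar>) \<longlongrightarrow> 0) (at s)" by (auto intro!: tendsto_eq_intros)
    show "\<forall>\<^sub>F t in at s. dist (r t) (r s) \<le> dist (L * \<bar>t - s\<bar>) 0"
      using Lip L_nonneg by (auto simp: dist_real_def)
  qed
  then show ?thesis by (intro borel_measurable_continuous_onI) (simp add: continuous_at_imp_continuous_on)
qed

lemma r_abs_le: "\<bar>r s\<bar> \<le> \<bar>a\<bar> + \<bar>b\<bar>" using r_le_a[of s] b_le_r[of s] by linarith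

text \<open>Moving \<beta> by less than \<delta> changes \<open>r (x \<bullet> \<beta>)\<close> by
  at most \<open>L * \<delta> * norm x\<close>, so one bracket around the centre serves the whole
  ball.\<close>

lemma brackets_ball:
  assumes "\<epsilon> > 0"
  obtains \<delta> where "\<delta> > 0" "\<And>\<beta>. \<exists>B. brackets H r V (ball \<beta> \<delta>) \<epsilon> B"
proof -
  note r_measurable [measurable]
  define A where "A = (\<integral>x. norm x \<partial>H)"
  have A: "A \<ge> 0" unfolding A_def by simp
  \<comment> \<open>The gap integrates to at most \<open>2 * L * \<delta> * A\<close>, which this
    choice keeps at most \<epsilon> / 2; adding 1 excludes zero denominators.\<close>
  define \<delta> where "\<delta> = \<epsilon> / (4 * (L + 1) * (A + 1))"
  have \<delta>: "\<delta> > 0" using assms A L_nonneg unfolding \<delta>_def by (intro divide_pos_pos mult_pos_pos) auto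
  have "brackets H r V (ball \<beta> \<delta>) \<epsilon> {(\<lambda>x. r (x \<bullet> \<beta>) - L * \<delta> * norm x, \<lambda>x. r (x \<bullet> \<beta>) + L * \<delta> * norm x)}" for \<beta>
  proof -
    have int: "integrable H (\<lambda>x. r (x \<bullet> \<beta>))"
      by (rule integrable_const_bound[of _ "\<bar>a\<bar> + \<bar>b\<bar>"]) (auto simp: r_abs_le measurable_H)
    have nn: "0 \<le> L * \<delta> * norm x" for x :: "real ^ 'p" using \<delta> L_nonneg by simp
    have "(\<integral>x. indicator V x * (r (x \<bullet> \<beta>) + L * \<delta> * norm x - (r (x \<bullet> \<beta>) - L * \<delta> * norm x)) \<partial>H)
       \<le> (\<integral>x. 2 * (L * \<delta>) * norm x \<partial>H)"
    proof (rule Bochner_Integration.integral_mono')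
      show "integrable H (\<lambda>x. 2 * (L * \<delta>) * norm x)" using norm_int by simp
      show "indicator V x * (r (x \<bullet> \<beta>) + L * \<delta> * norm x - (r (x \<bullet> \<beta>) - L * \<delta> * norm x)) \<le> 2 * (L * \<delta>) * norm x" for x
        using nn[of x] by (auto simp: indicator_def)
      show "0 \<le> 2 * (L * \<delta>) * norm x" for x :: "real ^ 'p" using nn[of x] by simp
    qed
    also have "\<dots> = 2 * L * \<delta> * A" unfolding A_def by simp
    also have "\<dots> \<le> 2 * (L + 1) * \<delta> * (A + 1)"
      using \<delta> A L_nonneg by (intro mult_mono) auto
    also have "\<dots> = \<epsilon> / 2" unfolding \<delta>_def using A L_nonneg by (simp add: divide_simps)
    also have "\<dots> < \<epsilon>" using assms by simp
    finally have small: "(\<integral>x. indicator V x * (r (x \<bullet> \<beta>) + L * \<delta> * norm x - (r (x \<bullet> \<beta>) - L * \<delta> * norm x)) \<partial>H) < \<epsilon>" .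
    have close: "r (x \<bullet> \<beta>) - L * \<delta> * norm x \<le> r (x \<bullet> \<beta>') \<and> r (x \<bullet> \<beta>') \<le> r (x \<bullet> \<beta>) + L * \<delta> * norm x"
      if "\<beta>' \<in> ball \<beta> \<delta>" for \<beta>' x
    proof -
      have "\<bar>r (x \<bullet> \<beta>) - r (x \<bullet> \<beta>')\<bar> \<le> L * \<bar>x \<bullet> (\<beta> - \<beta>')\<bar>" using Lip by (simp add: inner_diff_right)
      also have "\<dots> \<le> L * (norm x * norm (\<beta> - \<beta>'))" by (intro mult_left_mono Cauchy_Schwarz_ineq2 L_nonneg)
      also have "\<dots> \<le> L * (norm x * \<delta>)" using that L_nonneg by (intro mult_left_mono) (auto simp: dist_norm)
      finally show ?thesis by (simp add: abs_le_iff algebra_simps)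
    qed
    show ?thesis unfolding brackets_def
      using int norm_int nn small close by (auto simp: add_increasing2 intro!: order.trans[OF _ add_increasing2])
  qed
  with \<delta> that show ?thesis by blast
qed

text \<open>A neighbourhood of the point at infinity in direction \<open>u\<close>.  Off the hyperplane orthogonal to \<open>u\<close>
  the functions \<open>r (x \<bullet> \<beta>)\<close> are there almost equal to \<open>a\<close> or \<open>b\<close>; on the hyperplane only the
  component of \<open>\<beta>\<close> orthogonal to \<open>u\<close> matters.\<close>
definition cone_at_infinity :: "(real ^ 'p) set \<Rightarrow> real ^ 'p \<Rightarrow> real \<Rightarrow> (real ^ 'p) set" where
  "cone_at_infinity V u k = {\<beta>\<in>V. norm \<beta> > k \<and> norm (\<beta> /\<^sub>R norm \<beta> - u) < 1 / k}"

text \<open>If \<open>norm x / k < \<bar>x \<bullet> u\<bar> / 2\<close>, every \<beta> in the cone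
  gives \<open>x \<bullet> \<beta>\<close> the sign of \<open>x \<bullet> u\<close> and at least
  \<open>k / 2\<close> times its size, so monotonicity of \<open>r\<close> yields a single bracket
  off the hyperplane. Its gap vanishes as \<open>k\<close> grows, by dominated convergence. On the
  hyperplane the brackets from \<open>IH\<close> are glued in.\<close>

lemma brackets_cone_at_infinity:
  assumes V: "subspace V" and u: "u \<in> V" "norm u = 1" and "\<epsilon> > 0"
    and IH: "\<exists>B. brackets H r (V \<inter> {x. x \<bullet> u = 0}) (V \<inter> {x. x \<bullet> u = 0}) (\<epsilon> / 2) B"
  obtains k :: nat where "k > 0" "\<exists>B. brackets H r V (cone_at_infinity V u k) \<epsilon> B"
proof -
  note r_measurable [measurable]
  define far where "far k x \<longleftrightarrow> norm x / real k < \<bar>x \<bullet> u\<bar> / 2" for k and x :: "real ^ 'p"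
  \<comment> \<open>Points that are not yet \<open>far\<close> get the trivial bounds
    \<open>b\<close> and \<open>a\<close>; each point off the hyperplane is eventually
    \<open>far\<close>.\<close>
  define lo where "lo k x = (if far k x \<and> x \<bullet> u < 0 then r (real k * (x \<bullet> u) / 2) else b)" for k x
  define up where "up k x = (if far k x \<and> x \<bullet> u > 0 then r (real k * (x \<bullet> u) / 2) else a)" for k x
  define N where "N = {x :: real ^ 'p. x \<bullet> u = 0}"
  have [measurable]: "lo k \<in> borel_measurable borel" "up k \<in> borel_measurable borel" for k
    unfolding lo_def far_def up_def by measurable
  have N[measurable]: "N \<in> sets borel" unfolding N_def by measurable
  have V_closed[measurable]: "V \<in> sets borel" using closed_subspace[OF V] by simp
  have ab: "b \<le> a" using r_le_a[of 0] b_le_r[of 0] by linarith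
  have lo_le: "b \<le> lo k x" "lo k x \<le> a" "b \<le> up k x" "up k x \<le> a" for k x
    using ab by (auto simp: lo_def up_def r_le_a b_le_r)
  have lo_up: "lo k x \<le> up k x" for k x
    using ab by (auto simp: lo_def up_def r_le_a b_le_r)
  have lo_abs: "\<bar>lo k x\<bar> \<le> \<bar>a\<bar> + \<bar>b\<bar>" "\<bar>up k x\<bar> \<le> \<bar>a\<bar> + \<bar>b\<bar>" for k x
    using lo_le[of k x] by linarith+
  have int: "integrable H (lo k)" "integrable H (up k)" for k
    by (auto intro!: integrable_const_bound[of _ "\<bar>a\<bar> + \<bar>b\<bar>"] simp: measurable_H lo_abs)
  have scale: "real k * c / 2 = (c / 2) * real k" for c and k :: nat by simp
  have lim: "(\<lambda>k. indicator (- N) x * (up k x - lo k x)) \<longlonglongrightarrow> 0" for x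
  proof (cases "x \<bullet> u = 0")
    case True
    then show ?thesis by (simp add: N_def)
  next
    case False
    have "(\<lambda>k. norm x / real k) \<longlonglongrightarrow> 0"
      by (intro tendsto_divide_0[OF tendsto_const] filterlim_real_at_infinity_sequentially)
    then have far: "\<forall>\<^sub>F k in sequentially. far k x"
      unfolding far_def using False by (intro order_tendstoD) auto
    show ?thesis
    proof (cases "x \<bullet> u > 0")
      case True
      have "(\<lambda>k. r (real k * (x \<bullet> u) / 2)) \<longlonglongrightarrow> b" unfolding scale
        using True by (intro filterlim_compose[OF lim_top] filterlim_tendsto_pos_mult_at_top[OF tendsto_const])
          (auto intro: filterlim_real_sequentially)
      then have "(\<lambda>k. r (real k * (x \<bullet> u) / 2) - b) \<longlonglongrightarrow> b - b" by (intro tendsto_intros)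
      moreover have "\<forall>\<^sub>F k in sequentially. r (real k * (x \<bullet> u) / 2) - b = indicator (- N) x * (up k x - lo k x)"
        using far by eventually_elim (use True in \<open>simp add: N_def lo_def up_def\<close>)
      ultimately show ?thesis by (simp add: Lim_transform_eventually)
    next
      case nonpos: False
      have "(\<lambda>k. r (real k * (x \<bullet> u) / 2)) \<longlonglongrightarrow> a" unfolding scale
        using nonpos False by (intro filterlim_compose[OF lim_bot] filterlim_tendsto_neg_mult_at_bot[OF tendsto_const])
          (auto intro: filterlim_real_sequentially)
      then have "(\<lambda>k. a - r (real k * (x \<bullet> u) / 2)) \<longlonglongrightarrow> a - a" by (intro tendsto_intros)
      moreover have "\<forall>\<^sub>F k in sequentially. a - r (real k * (x \<bullet> u) / 2) = indicator (- N) x * (up k x - lo k x)"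
        using far by eventually_elim (use False nonpos in \<open>simp add: N_def lo_def up_def\<close>)
      ultimately show ?thesis by (simp add: Lim_transform_eventually)
    qed
  qed
  have "(\<lambda>k. \<integral>x. indicator (- N) x * (up k x - lo k x) \<partial>H) \<longlonglongrightarrow> (\<integral>x. 0 \<partial>H)"
  proof (rule integral_dominated_convergence[where w="\<lambda>_. a - b"])
    show "AE x in H. norm (indicator (- N) x * (up k x - lo k x)) \<le> a - b" for k
    proof (rule AE_I2)
      fix x show "norm (indicator (- N) x * (up k x - lo k x)) \<le> a - b"
        using lo_le[of k x] lo_up[of k x] ab by (auto simp: indicator_def)
    qed
  qed (auto simp: measurable_H lim)
  then have "(\<lambda>k. \<integral>x. indicator (- N) x * (up k x - lo k x) \<partial>H) \<longlonglongrightarrow> 0" by simp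
  from order_tendstoD(2)[OF this, of "\<epsilon> / 2"] \<open>\<epsilon> > 0\<close>
  have "\<forall>\<^sub>F k in sequentially. (\<integral>x. indicator (- N) x * (up k x - lo k x) \<partial>H) < \<epsilon> / 2" by auto
  with eventually_gt_at_top[of 0] have "\<forall>\<^sub>F k in sequentially. k > 0 \<and> (\<integral>x. indicator (- N) x * (up k x - lo k x) \<partial>H) < \<epsilon> / 2"
    by eventually_elim auto
  then obtain k where k: "k > 0" "(\<integral>x. indicator (- N) x * (up k x - lo k x) \<partial>H) < \<epsilon> / 2"
    by (auto simp: eventually_sequentially)
  obtain B where B: "brackets H r (V \<inter> N) (V \<inter> N) (\<epsilon> / 2) B" using IH unfolding N_def by blast
  define glue where "glue = (\<lambda>(f, g). (\<lambda>x :: real ^ 'p. if x \<in> N then f x else lo k x :: real, \<lambda>x. if x \<in> N then g x else up k x :: real))"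
  have "brackets H r V (cone_at_infinity V u k) \<epsilon> (glue ` B)"
    unfolding brackets_def
  proof (intro conjI)
    show "finite (glue ` B)" using B by (simp add: brackets_def)
    have "integrable H f' \<and> integrable H g' \<and> (\<forall>x. f' x \<le> g' x) \<and> (\<integral>x. indicator V x * (g' x - f' x) \<partial>H) < \<epsilon>"
      if fg: "(f, g) \<in> B" and f': "f' = (\<lambda>x. if x \<in> N then f x else lo k x)" and g': "g' = (\<lambda>x. if x \<in> N then g x else up k x)" for f g f' g'
    proof -
      have fgp: "integrable H f" "integrable H g" "\<And>x. f x \<le> g x" "(\<integral>x. indicator (V \<inter> N) x * (g x - f x) \<partial>H) < \<epsilon> / 2"
        using B fg unfolding brackets_def by auto
      have glue_int: "integrable H (\<lambda>x. if x \<in> N then p x else q x)" if "integrable H p" "integrable H q" for p q :: "real ^ 'p \<Rightarrow> real"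
      proof -
        have "integrable H (\<lambda>x. indicator N x *\<^sub>R p x + indicator (- N) x *\<^sub>R q x)"
          using that by (intro Bochner_Integration.integrable_add integrable_mult_indicator) (auto simp: sets_H)
        then show ?thesis by (rule Bochner_Integration.integrable_cong[THEN iffD1, rotated 2]) (auto simp: indicator_def)
      qed
      have int': "integrable H f'" "integrable H g'" unfolding f' g' using fgp int by (auto intro: glue_int)
      have i1: "integrable H (\<lambda>x. indicator (V \<inter> N) x * (g x - f x))"
        using integrable_mult_indicator[of "V \<inter> N" H "\<lambda>x. g x - f x"] fgp by (simp add: sets_H)
      have i2: "integrable H (\<lambda>x. indicator (- N) x * (up k x - lo k x))"
        using integrable_mult_indicator[of "- N" H "\<lambda>x. up k x - lo k x"] int by (simp add: sets_H)
      have i3: "integrable H (\<lambda>x. indicator V x * (g' x - f' x))"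
        using integrable_mult_indicator[of V H "\<lambda>x. g' x - f' x"] int' by (simp add: sets_H)
      have "(\<integral>x. indicator V x * (g' x - f' x) \<partial>H)
          \<le> (\<integral>x. indicator (V \<inter> N) x * (g x - f x) + indicator (- N) x * (up k x - lo k x) \<partial>H)"
        using i1 i2 i3 lo_up by (intro integral_mono) (auto simp: f' g' indicator_def)
      also have "\<dots> = (\<integral>x. indicator (V \<inter> N) x * (g x - f x) \<partial>H) + (\<integral>x. indicator (- N) x * (up k x - lo k x) \<partial>H)"
        using i1 i2 by simp
      also have "\<dots> < \<epsilon>" using fgp(4) k(2) by simp
      finally show ?thesis using int' fgp(3) lo_up by (auto simp: f' g')
    qed
    then show "\<forall>(lo, up)\<in>glue ` B. integrable H lo \<and> integrable H up \<and> (\<forall>x. lo x \<le> up x) \<and>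
        (\<integral>x. indicator V x * (up x - lo x) \<partial>H) < \<epsilon>"
      unfolding glue_def by auto
    show "\<forall>\<beta>\<in>cone_at_infinity V u k. \<exists>(lo, up)\<in>glue ` B. \<forall>x\<in>V. lo x \<le> r (x \<bullet> \<beta>) \<and> r (x \<bullet> \<beta>) \<le> up x"
    proof
      fix \<beta> assume "\<beta> \<in> cone_at_infinity V u k"
      then have \<beta>: "\<beta> \<in> V" "norm \<beta> > k" "norm (\<beta> /\<^sub>R norm \<beta> - u) < 1 / k" by (auto simp: cone_at_infinity_def)
      \<comment> \<open>On the hyperplane \<beta> acts through this projection, which lies in the
        smaller subspace and is thus covered by one of the brackets in \<open>B\<close>.\<close>
      define \<beta>' where "\<beta>' = \<beta> - (\<beta> \<bullet> u) *\<^sub>R u"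
      have "u \<bullet> u = 1" using u by (simp add: dot_square_norm)
      then have "\<beta>' \<in> V \<inter> N"
        using \<beta>(1) u V by (auto simp: \<beta>'_def N_def inner_diff_left subspace_diff subspace_scale)
      then have "\<exists>(lo, up)\<in>B. \<forall>x\<in>V \<inter> N. lo x \<le> r (x \<bullet> \<beta>') \<and> r (x \<bullet> \<beta>') \<le> up x"
        using B unfolding brackets_def by (elim conjE) (rule bspec)
      then obtain f g where fg: "(f, g) \<in> B" "\<And>x. x \<in> V \<inter> N \<Longrightarrow> f x \<le> r (x \<bullet> \<beta>') \<and> r (x \<bullet> \<beta>') \<le> g x"
        by auto
      have orth: "x \<bullet> \<beta>' = x \<bullet> \<beta>" if "x \<in> N" for x using that by (simp add: \<beta>'_def N_def inner_diff_right)
      have off: "lo k x \<le> r (x \<bullet> \<beta>) \<and> r (x \<bullet> \<beta>) \<le> up k x" for x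
      proof (cases "far k x")
        case True
        define s where "s = x \<bullet> (\<beta> /\<^sub>R norm \<beta>)"
        have pos: "norm \<beta> > 0" using \<beta>(2) by linarith
        then have xb: "x \<bullet> \<beta> = norm \<beta> * s" by (simp add: s_def)
        have "\<bar>s - x \<bullet> u\<bar> = \<bar>x \<bullet> (\<beta> /\<^sub>R norm \<beta> - u)\<bar>" by (simp add: s_def inner_diff_right)
        also have "\<dots> \<le> norm x * norm (\<beta> /\<^sub>R norm \<beta> - u)" by (rule Cauchy_Schwarz_ineq2)
        also have "\<dots> \<le> norm x * (1 / k)" using \<beta>(3) by (intro mult_left_mono) auto
        also have "\<dots> < \<bar>x \<bullet> u\<bar> / 2" using True by (simp add: far_def)
        finally have s: "\<bar>s - x \<bullet> u\<bar> < \<bar>x \<bullet> u\<bar> / 2" .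
        show ?thesis
        proof (cases "x \<bullet> u > 0")
          case pos': True
          then have "s > (x \<bullet> u) / 2" using s by linarith
          then have "real k * ((x \<bullet> u) / 2) \<le> norm \<beta> * s" using \<beta>(2) pos' by (intro mult_mono) auto
          then have "r (x \<bullet> \<beta>) \<le> r (real k * (x \<bullet> u) / 2)" unfolding xb by (intro antimonoD[OF anti]) simp
          then show ?thesis using pos' True b_le_r by (auto simp: lo_def up_def)
        next
          case False
          have "x \<bullet> u \<noteq> 0" using True by (auto simp: far_def) (simp add: divide_less_0_iff)
          then have neg: "x \<bullet> u < 0" using False by simp
          then have "- s > - (x \<bullet> u) / 2" using s by linarith
          then have "real k * (- (x \<bullet> u) / 2) \<le> norm \<beta> * (- s)" using \<beta>(2) neg by (intro mult_mono) auto
          then have "r (real k * (x \<bullet> u) / 2) \<le> r (x \<bullet> \<beta>)" unfolding xb by (intro antimonoD[OF anti]) simp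
          then show ?thesis using neg True r_le_a by (auto simp: lo_def up_def)
        qed
      next
        case False
        then show ?thesis using r_le_a b_le_r by (simp add: lo_def up_def)
      qed
      show "\<exists>(lo, up)\<in>glue ` B. \<forall>x\<in>V. lo x \<le> r (x \<bullet> \<beta>) \<and> r (x \<bullet> \<beta>) \<le> up x"
        using fg orth off by (intro bexI[OF _ imageI[OF fg(1)]]) (auto simp: glue_def)
    qed
  qed
  with k(1) that show ?thesis by blast
qed

text \<open>By compactness of the unit sphere of \<open>V\<close>, finitely many cones handle all
  directions and leave a bounded set for balls. The zero subspace is no special case: its unit
  sphere is empty.\<close>

lemma brackets_subspace:
  assumes "subspace V" "\<epsilon> > 0"
  shows "\<exists>B. brackets H r V V \<epsilon> B"
  using assms
proof (induction "dim V" arbitrary: V \<epsilon> rule: less_induct)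
  case less
  note V = \<open>subspace V\<close>
  have cones: "\<exists>k::nat. k > 0 \<and> (\<exists>B. brackets H r V (cone_at_infinity V u k) \<epsilon> B)" if u: "u \<in> V \<inter> sphere 0 1" for u
  proof -
    have u': "u \<in> V" "norm u = 1" using u by auto
    let ?V' = "V \<inter> {x. x \<bullet> u = 0}"
    have sub: "subspace ?V'"
      using V by (intro subspace_inter) (auto simp: subspace_def inner_add_left)
    have "u \<notin> ?V'" using u' by (auto simp: dot_square_norm)
    then have "?V' \<subset> V" using u'(1) by blast
    then have "dim ?V' < dim V"
      using sub V by (intro dim_psubset) (simp add: span_eq_iff[THEN iffD2])
    with sub less have "\<exists>B. brackets H r ?V' ?V' (\<epsilon> / 2) B" by simp
    then show ?thesis by (rule brackets_cone_at_infinity[OF V u' \<open>\<epsilon> > 0\<close>]) auto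
  qed
  then have "\<forall>u\<in>V \<inter> sphere 0 1. \<exists>k::nat. (0::nat) < k \<and> (\<exists>B. brackets H r V (cone_at_infinity V u k) \<epsilon> B)"
    by simp
  from bchoice[OF this] obtain k :: "real ^ 'p \<Rightarrow> nat" where
    "\<forall>u\<in>V \<inter> sphere 0 1. (0::nat) < k u \<and> (\<exists>B. brackets H r V (cone_at_infinity V u (k u)) \<epsilon> B)"
    by (elim exE)
  then have k: "(0::nat) < k u" "\<exists>B. brackets H r V (cone_at_infinity V u (k u)) \<epsilon> B" if "u \<in> V \<inter> sphere 0 1" for u
    using that by simp_all
  have comp: "compact (V \<inter> sphere 0 1)"
    using closed_subspace[OF V] by (simp add: closed_Int_compact)
  have cov: "V \<inter> sphere 0 1 \<subseteq> (\<Union>u\<in>V \<inter> sphere 0 1. ball u (1 / real (k u)))"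
  proof
    fix u assume "u \<in> V \<inter> sphere 0 1"
    moreover from this have "u \<in> ball u (1 / real (k u))" using k(1) by simp
    ultimately show "u \<in> (\<Union>u\<in>V \<inter> sphere 0 1. ball u (1 / real (k u)))" by (rule UN_I)
  qed
  obtain C where C: "C \<subseteq> V \<inter> sphere 0 1" "finite C" "V \<inter> sphere 0 1 \<subseteq> (\<Union>u\<in>C. ball u (1 / real (k u)))"
    by (rule compactE_image[OF comp _ cov]) (rule open_ball, rule that)
  \<comment> \<open>The sum dominates all of the finitely many thresholds and also makes sense for
    an empty \<open>C\<close>.\<close>
  define R where "R = real (\<Sum>u\<in>C. k u)"
  have R: "real (k u) \<le> R" if "u \<in> C" for u
    unfolding R_def using C(2) that by (intro of_nat_mono member_le_sum) auto
  obtain \<delta> where \<delta>: "\<delta> > 0" "\<And>\<beta>. \<exists>B. brackets H r V (ball \<beta> \<delta>) \<epsilon> B"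
    using brackets_ball[OF \<open>\<epsilon> > 0\<close>] by blast
  have cov': "cball (0 :: real ^ 'p) R \<subseteq> (\<Union>\<beta>\<in>cball 0 R. ball \<beta> \<delta>)"
    using \<delta>(1) by (intro subsetI UN_I) auto
  obtain C' where C': "finite C'" "cball (0 :: real ^ 'p) R \<subseteq> (\<Union>\<beta>\<in>C'. ball \<beta> \<delta>)"
    by (rule compactE_image[OF compact_cball _ cov']) (rule open_ball, rule that)
  have "\<exists>B. brackets H r V (\<Union>u\<in>C. cone_at_infinity V u (k u)) \<epsilon> B"
    using C(2) by (rule brackets_UN) (rule k(2)[OF subsetD[OF C(1)]])
  then obtain B1 where B1: "brackets H r V (\<Union>u\<in>C. cone_at_infinity V u (k u)) \<epsilon> B1" ..
  have "\<exists>B. brackets H r V (\<Union>\<beta>\<in>C'. ball \<beta> \<delta>) \<epsilon> B"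
    using C'(1) by (rule brackets_UN) (rule \<delta>(2))
  then obtain B2 where B2: "brackets H r V (\<Union>\<beta>\<in>C'. ball \<beta> \<delta>) \<epsilon> B2" ..
  have "V \<subseteq> (\<Union>u\<in>C. cone_at_infinity V u (k u)) \<union> (\<Union>\<beta>\<in>C'. ball \<beta> \<delta>)"
  proof
    fix \<beta> assume \<beta>: "\<beta> \<in> V"
    show "\<beta> \<in> (\<Union>u\<in>C. cone_at_infinity V u (k u)) \<union> (\<Union>\<beta>\<in>C'. ball \<beta> \<delta>)"
    proof (cases "norm \<beta> \<le> R")
      case True
      then show ?thesis using C'(2) by auto
    next
      case False
      have "R \<ge> 0" unfolding R_def by (rule of_nat_0_le_iff)
      then have "\<beta> \<noteq> 0" using False by auto
      then have "\<beta> /\<^sub>R norm \<beta> \<in> V \<inter> sphere 0 1" using \<beta> V by (simp add: subspace_scale)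
      then obtain u where u: "u \<in> C" "\<beta> /\<^sub>R norm \<beta> \<in> ball u (1 / real (k u))" using C(3) by blast
      then have "\<beta> \<in> cone_at_infinity V u (k u)"
        using \<beta> False R[OF u(1)] by (auto simp: cone_at_infinity_def dist_norm norm_minus_commute)
      then show ?thesis using u(1) by blast
    qed
  qed
  then show ?case using brackets_subset[OF brackets_Un[OF B1 B2]] by blast
qed

lemma finite_brackets:
  assumes "\<epsilon> > 0"
  obtains B where "finite B"
    "\<And>lo up. (lo, up) \<in> B \<Longrightarrow> integrable H lo \<and> integrable H up \<and> (\<integral>x. up x - lo x \<partial>H) < \<epsilon>"
    "\<And>\<beta>. \<exists>(lo, up)\<in>B. \<forall>x. lo x \<le> r (x \<bullet> \<beta>) \<and> r (x \<bullet> \<beta>) \<le> up x"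
proof -
  obtain B where "brackets H r UNIV UNIV \<epsilon> B" using brackets_subspace[OF subspace_UNIV assms] by blast
  then show ?thesis by (intro that[of B]) (auto simp: brackets_def)
qed

end

section \<open>The logistic model and consistency\<close>

text \<open>Existence of the matrices and the rank condition on the design enter through the last
  two assumptions, which \<open>logistic_asymptoticsI\<close> derives.\<close>

locale logistic_asymptotics = logistic_regression_sample P X Y H i0 \<beta>0
  for P :: "'a measure" and X :: "nat \<Rightarrow> 'a \<Rightarrow> real ^ 'p" and Y :: "nat \<Rightarrow> 'a \<Rightarrow> real"
    and H :: "(real ^ 'p) measure" and i0 :: 'p and \<beta>0 :: "real ^ 'p" +
  fixes l :: real
  assumes lambda: "l \<ge> 0"
    and second_moment: "integrable H (\<lambda>x. (norm x)\<^sup>2)"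
    and nondegenerate: "\<And>u. u \<noteq> 0 \<Longrightarrow> \<not> (AE x in H. x \<bullet> u = 0)"
begin

definition Z :: "nat \<Rightarrow> 'a \<Rightarrow> (real ^ 'p) \<times> real" where "Z i \<omega> = (X i \<omega>, Y i \<omega>)"

definition D :: "((real ^ 'p) \<times> real) measure" where "D = distr P borel (Z 0)"

abbreviation mean0 :: "real ^ 'p \<Rightarrow> real" where "mean0 x \<equiv> logistic (x \<bullet> \<beta>0)"

lemma sets_H: "sets H = sets borel" using X_distr[of 0] by (metis sets_distr)

lemma measurable_H: "measurable H N = measurable borel N" by (rule measurable_cong_sets[OF sets_H refl])

lemma prob_space_H: "prob_space H"
  using prob_space_distr[OF X_measurable[of 0]] by (simp add: X_distr)

lemma XY_measurable [measurable]: "X i \<in> borel_measurable P" "Y i \<in> borel_measurable P"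
  by (rule X_measurable Y_measurable)+

lemma Z_borel_measurable [measurable]: "Z i \<in> borel_measurable P"
  unfolding Z_def[abs_def] by measurable

lemma logistic_inner_measurable [measurable]: "(\<lambda>x :: real ^ 'p. logistic (x \<bullet> \<beta>)) \<in> borel_measurable borel"
  unfolding logistic_def by measurable

lemma expectation_X:
  fixes f :: "real ^ 'p \<Rightarrow> real"
  assumes "f \<in> borel_measurable borel"
  shows "expectation (\<lambda>\<omega>. f (X i \<omega>)) = integral\<^sup>L H f"
  by (subst X_distr[symmetric, of i], subst integral_distr) (auto simp: assms)

lemma integrable_X:
  fixes f :: "real ^ 'p \<Rightarrow> real"
  assumes "integrable H f"
  shows "integrable P (\<lambda>\<omega>. f (X i \<omega>))"
proof -
  have [measurable]: "f \<in> borel_measurable borel" using assms by (auto simp: measurable_H dest: borel_measurable_integrable)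
  have "integrable (distr P borel (X i)) f" using assms by (simp add: X_distr)
  then show ?thesis by (subst (asm) integrable_distr_eq) auto
qed

text \<open>\<open>f (X i)\<close> is measurable for the sigma-algebra of \<open>X i\<close>, so
  under the integral the indicator may be replaced by its conditional expectation from
  \<open>Y_cond\<close>.\<close>

lemma expectation_X_Y1:
  fixes f :: "real ^ 'p \<Rightarrow> real"
  assumes f: "integrable H f"
  defines "S i \<equiv> {\<omega> \<in> space P. Y i \<omega> = 1}"
  shows "expectation (\<lambda>\<omega>. f (X i \<omega>) * indicator (S i) \<omega>) = (\<integral>x. f x * mean0 x \<partial>H)"
    and "integrable P (\<lambda>\<omega>. f (X i \<omega>) * indicator (S i) \<omega>)"
proof -
  have [measurable]: "f \<in> borel_measurable borel" using f by (auto simp: measurable_H dest: borel_measurable_integrable)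
  have S[measurable]: "S i \<in> sets P" unfolding S_def by measurable
  let ?F = "vimage_algebra (space P) (X i) borel"
  have sub: "subalgebra P ?F"
    by (simp add: subalgebra_def sets_image_in_sets)
  interpret sub: finite_measure_subalgebra P ?F by standard (rule sub)
  have fF: "(\<lambda>\<omega>. f (X i \<omega>)) \<in> borel_measurable ?F"
    by (rule measurable_compose[OF measurable_vimage_algebra1]) auto
  show int: "integrable P (\<lambda>\<omega>. f (X i \<omega>) * indicator (S i) \<omega>)"
    using integrable_real_mult_indicator[OF S integrable_X[OF f]] .
  have "expectation (\<lambda>\<omega>. f (X i \<omega>) * indicator (S i) \<omega>)
      = expectation (\<lambda>\<omega>. f (X i \<omega>) * real_cond_exp P ?F (indicator (S i)) \<omega>)"
    by (rule sub.real_cond_exp_intg(2)[symmetric, OF int fF]) simp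
  also have "\<dots> = expectation (\<lambda>\<omega>. f (X i \<omega>) * mean0 (X i \<omega>))"
    using Y_cond[of i] unfolding S_def by (intro integral_cong_AE) auto
  also have "\<dots> = (\<integral>x. f x * mean0 x \<partial>H)" by (rule expectation_X) measurable
  finally show "expectation (\<lambda>\<omega>. f (X i \<omega>) * indicator (S i) \<omega>) = (\<integral>x. f x * mean0 x \<partial>H)" .
qed

lemma integrable_mean0:
  fixes f :: "real ^ 'p \<Rightarrow> real"
  assumes f: "integrable H f"
  shows "integrable H (\<lambda>x. f x * mean0 x)" "integrable H (\<lambda>x. f x * (1 - mean0 x))"
proof -
  have [measurable]: "f \<in> borel_measurable borel" using f by (auto simp: measurable_H dest: borel_measurable_integrable)
  show "integrable H (\<lambda>x. f x * mean0 x)" "integrable H (\<lambda>x. f x * (1 - mean0 x))"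
    using logistic_bounds
    by (auto intro!: Bochner_Integration.integrable_bound[OF f] AE_I2 simp: measurable_H abs_mult mult_left_le less_imp_le)
qed

text \<open>Almost surely \<open>Y i\<close> is 0 or 1, and the part with \<open>Y i = 0\<close> is
  a difference of two integrals, so the conditional probability of the value 1 determines
  everything.\<close>

lemma expectation_Z:
  fixes g :: "(real ^ 'p) \<times> real \<Rightarrow> real"
  assumes [measurable]: "g \<in> borel_measurable borel"
    and g: "integrable H (\<lambda>x. g (x, 1))" "integrable H (\<lambda>x. g (x, 0))"
  shows "expectation (\<lambda>\<omega>. g (Z i \<omega>)) = (\<integral>x. g (x, 1) * mean0 x + g (x, 0) * (1 - mean0 x) \<partial>H)"
    and "integrable P (\<lambda>\<omega>. g (Z i \<omega>))"
proof -
  let ?S = "{\<omega> \<in> space P. Y i \<omega> = 1}"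
  have [measurable]: "?S \<in> sets P" by measurable
  have eq: "AE \<omega> in P. g (Z i \<omega>) = g (X i \<omega>, 1) * indicator ?S \<omega> + (g (X i \<omega>, 0) - g (X i \<omega>, 0) * indicator ?S \<omega>)"
    using Y_binary[of i] AE_space by eventually_elim (auto simp: Z_def indicator_def)
  have int: "integrable P (\<lambda>\<omega>. g (X i \<omega>, 1) * indicator ?S \<omega> + (g (X i \<omega>, 0) - g (X i \<omega>, 0) * indicator ?S \<omega>))"
    using expectation_X_Y1(2)[OF g(1)] expectation_X_Y1(2)[OF g(2)] integrable_X[OF g(2)] by auto
  show "integrable P (\<lambda>\<omega>. g (Z i \<omega>))"
    using eq by (intro integrable_cong_AE_imp[OF int]) auto
  have [measurable]: "(\<lambda>x. g (x, c)) \<in> borel_measurable borel" for c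
    by measurable
  have "expectation (\<lambda>\<omega>. g (Z i \<omega>)) = expectation (\<lambda>\<omega>. g (X i \<omega>, 1) * indicator ?S \<omega> + (g (X i \<omega>, 0) - g (X i \<omega>, 0) * indicator ?S \<omega>))"
    using eq by (intro integral_cong_AE) auto
  also have "\<dots> = (\<integral>x. g (x, 1) * mean0 x \<partial>H) + ((\<integral>x. g (x, 0) \<partial>H) - (\<integral>x. g (x, 0) * mean0 x \<partial>H))"
    using expectation_X_Y1[OF g(1), of i] expectation_X_Y1[OF g(2), of i] integrable_X[OF g(2), of i]
      expectation_X[of "\<lambda>x. g (x, 0)" i] by simp
  also have "\<dots> = (\<integral>x. g (x, 1) * mean0 x + g (x, 0) * (1 - mean0 x) \<partial>H)"
    using integrable_mean0[OF g(1)] integrable_mean0[OF g(2)] g by (simp add: right_diff_distrib)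
  finally show "expectation (\<lambda>\<omega>. g (Z i \<omega>)) = (\<integral>x. g (x, 1) * mean0 x + g (x, 0) * (1 - mean0 x) \<partial>H)" .
qed

text \<open>The probability of \<open>A\<close> is expressed through \<open>H\<close> and
  \<open>mean0\<close> alone, which do not depend on \<open>i\<close>.\<close>

lemma distr_Z_eq_D: "distr P borel (Z i) = D"
proof (rule measure_eqI)
  fix A assume "A \<in> sets (distr P borel (Z i))"
  then have A[measurable]: "A \<in> sets borel" by simp
  interpret H: prob_space H by (rule prob_space_H)
  have [measurable]: "(\<lambda>x. indicator A (x, c) :: real) \<in> borel_measurable borel" for c :: real
    by measurable
  have int: "integrable H (\<lambda>x. indicator A (x, c) :: real)" for c :: real
    by (rule H.integrable_const_bound[of _ 1]) (auto simp: measurable_H)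
  have "measure (distr P borel (Z j)) A = (\<integral>x. indicator A (x, 1) * mean0 x + indicator A (x, 0) * (1 - mean0 x) \<partial>H)" for j
  proof -
    have "measure (distr P borel (Z j)) A = expectation (\<lambda>\<omega>. indicator A (Z j \<omega>))"
      by (subst measure_distr) (auto simp: indicator_vimage[symmetric] indicator_inter_arith intro!: arg_cong[where f=prob])
    also have "\<dots> = (\<integral>x. indicator A (x, 1) * mean0 x + indicator A (x, 0) * (1 - mean0 x) \<partial>H)"
      by (rule expectation_Z(1)) (auto intro: int)
    finally show ?thesis .
  qed
  then have "measure (distr P borel (Z i)) A = measure (distr P borel (Z 0)) A" by simp
  moreover have "prob_space (distr P borel (Z j))" for j by (rule prob_space_distr) simp
  ultimately show "emeasure (distr P borel (Z i)) A = emeasure D A"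
    by (simp add: D_def finite_measure.emeasure_eq_measure prob_space.finite_measure)
qed (simp add: D_def)

lemma sets_D: "sets D = sets borel" by (simp add: D_def)

lemma measurable_D: "measurable D N = measurable borel N" by (rule measurable_cong_sets[OF sets_D refl])

sublocale iid_sequence P Z D
proof
  have "measurable P D = borel_measurable P" by (rule measurable_cong_sets[OF refl sets_D])
  then show "indep_vars (\<lambda>_. D) Z UNIV"
    using indep unfolding indep_vars_def2 Z_def[abs_def, symmetric] by (simp add: sets_D)
  show "distr P D (Z i) = D" for i
    using distr_Z_eq_D[of i] by (metis distr_cong sets_D)
qed

lemma integral_D:
  fixes g :: "(real ^ 'p) \<times> real \<Rightarrow> real"
  assumes [measurable]: "g \<in> borel_measurable borel"
    and g: "integrable H (\<lambda>x. g (x, 1))" "integrable H (\<lambda>x. g (x, 0))"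
  shows "integral\<^sup>L D g = (\<integral>x. g (x, 1) * mean0 x + g (x, 0) * (1 - mean0 x) \<partial>H)"
    and "integrable D g"
proof -
  show "integral\<^sup>L D g = (\<integral>x. g (x, 1) * mean0 x + g (x, 0) * (1 - mean0 x) \<partial>H)"
    using expectation_Z(1)[OF assms, of 0] integral_Z[of g 0] by (simp add: measurable_D)
  have "integrable (distr P borel (Z 0)) g"
    by (subst integrable_distr_eq) (auto intro: expectation_Z(2)[OF assms])
  then show "integrable D g" by (simp add: D_def)
qed

lemma fst_snd_measurable [measurable]:
  "(fst :: (real ^ 'p) \<times> real \<Rightarrow> real ^ 'p) \<in> borel_measurable borel"
  "(snd :: (real ^ 'p) \<times> real \<Rightarrow> real) \<in> borel_measurable borel"
  by (intro borel_measurable_continuous_onI continuous_intros)+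

lemma integral_D_fst:
  fixes f :: "real ^ 'p \<Rightarrow> real"
  assumes f: "integrable H f"
  shows "integral\<^sup>L D (\<lambda>z. f (fst z)) = integral\<^sup>L H f" "integrable D (\<lambda>z. f (fst z))"
proof -
  have [measurable]: "f \<in> borel_measurable borel" using f by (auto simp: measurable_H dest: borel_measurable_integrable)
  have [measurable]: "(\<lambda>z :: (real ^ 'p) \<times> real. f (fst z)) \<in> borel_measurable borel"
    by (rule measurable_compose[OF fst_snd_measurable(1)]) measurable
  have eq: "f x * mean0 x + f x * (1 - mean0 x) = f x" for x
    by (simp add: right_diff_distrib)
  have int: "integrable H (\<lambda>x. f (fst (x, c :: real)))" for c using f by simp
  show "integral\<^sup>L D (\<lambda>z. f (fst z)) = integral\<^sup>L H f"
    by (subst integral_D(1)[OF _ int int]) (measurable, simp only: fst_conv eq)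
  show "integrable D (\<lambda>z. f (fst z))"
    by (rule integral_D(2)[OF _ int int]) measurable
qed

lemma norm_int: "integrable H norm"
proof -
  interpret H: prob_space H by (rule prob_space_H)
  have "norm \<in> borel_measurable H" by (simp add: measurable_H)
  then show ?thesis using second_moment by (rule H.square_integrable_imp_integrable)
qed

lemma AE_binary: "AE \<omega> in P. \<forall>i. Y i \<omega> \<in> {0, 1}"
  unfolding AE_all_countable using Y_binary by blast

lemma whp_binary: "whp (\<lambda>n \<omega>. \<forall>i. Y i \<omega> \<in> {0, 1})"
  using AE_binary by (rule whp_AE)

abbreviation loss_at :: "real ^ 'p \<Rightarrow> (real ^ 'p) \<times> real \<Rightarrow> real" where
  "loss_at \<beta> z \<equiv> loss l (fst z \<bullet> \<beta>) (snd z)"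

abbreviation excess_at :: "real ^ 'p \<Rightarrow> (real ^ 'p) \<times> real \<Rightarrow> real" where
  "excess_at v z \<equiv> excess l (fst z \<bullet> (\<beta>0 + v)) (fst z \<bullet> \<beta>0)"

lemma excess_at_Lipschitz: "\<bar>excess_at v z - excess_at w z\<bar> \<le> norm (fst z) * norm (v - w)"
proof -
  have "\<bar>excess_at v z - excess_at w z\<bar> \<le> \<bar>fst z \<bullet> (v - w)\<bar>"
    using excess_Lipschitz[OF lambda, of "fst z \<bullet> (\<beta>0 + v)" "fst z \<bullet> \<beta>0" "fst z \<bullet> (\<beta>0 + w)"]
    by (simp add: inner_add_right inner_diff_right)
  then show ?thesis using Cauchy_Schwarz_ineq2[of "fst z" "v - w"] by linarith
qed

lemma loss_measurable [measurable]: "(\<lambda>s. loss l s y) \<in> borel_measurable borel"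
  using DERIV_isCont[OF DERIV_loss[OF lambda]]
  by (auto intro!: borel_measurable_continuous_onI continuous_at_imp_continuous_on)

lemma excess_H_measurable [measurable]:
  "(\<lambda>x :: real ^ 'p. excess l (x \<bullet> (\<beta>0 + v)) (x \<bullet> \<beta>0)) \<in> borel_measurable borel"
proof -
  have eq: "excess l s t = (loss l s 0 + logistic t * (loss l s 1 - loss l s 0)) - (loss l t 0 + logistic t * (loss l t 1 - loss l t 0))" for s t
    unfolding excess_def by (subst (1 2) loss_affine) simp
  show ?thesis unfolding eq by measurable
qed

lemma excess_H_integrable: "integrable H (\<lambda>x. excess l (x \<bullet> (\<beta>0 + v)) (x \<bullet> \<beta>0))"
proof (rule Bochner_Integration.integrable_bound)
  show "integrable H (\<lambda>x. norm x * norm v)" using norm_int by simp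
  show "AE x in H. norm (excess l (x \<bullet> (\<beta>0 + v)) (x \<bullet> \<beta>0)) \<le> norm (norm x * norm v)"
    using excess_at_Lipschitz[of "(_, 0)" v 0] by (intro AE_I2) (simp add: abs_mult)
qed (simp add: measurable_H)

lemma mean_excess_pos:
  assumes "v \<noteq> 0"
  shows "(\<integral>x. excess l (x \<bullet> (\<beta>0 + v)) (x \<bullet> \<beta>0) \<partial>H) > 0"
proof (rule ccontr)
  assume "\<not> ?thesis"
  moreover have "(\<integral>x. excess l (x \<bullet> (\<beta>0 + v)) (x \<bullet> \<beta>0) \<partial>H) \<ge> 0"
    by (intro integral_nonneg_AE AE_I2 excess_nonneg lambda)
  ultimately have "(\<integral>x. excess l (x \<bullet> (\<beta>0 + v)) (x \<bullet> \<beta>0) \<partial>H) = 0" by linarith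
  then have "AE x in H. excess l (x \<bullet> (\<beta>0 + v)) (x \<bullet> \<beta>0) = 0"
    using integral_nonneg_eq_0_iff_AE[OF excess_H_integrable[of v]] excess_nonneg[OF lambda] by auto
  then have "AE x in H. x \<bullet> v = 0"
  proof eventually_elim
    case (elim x)
    then have "x \<bullet> (\<beta>0 + v) = x \<bullet> \<beta>0" using excess_pos[OF lambda] by (metis less_irrefl)
    then show ?case by (simp add: inner_add_right)
  qed
  with nondegenerate[OF assms] show False by simp
qed

text \<open>The law of large numbers is applied on a finite net of the sphere. Between net points
  the average norm of the covariates, itself close to its mean, is a Lipschitz constant.\<close>

lemma whp_excess_sphere:
  assumes "\<epsilon> > 0"
  obtains c where "c > 0" "whp (\<lambda>n \<omega>. \<forall>v\<in>sphere 0 \<epsilon>. avg (excess_at v) n \<omega> \<ge> c)"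
proof -
  define A where "A = (\<integral>x. norm x \<partial>H)"
  have A: "A \<ge> 0" unfolding A_def by simp
  define G where "G v = (\<integral>x. excess l (x \<bullet> (\<beta>0 + v)) (x \<bullet> \<beta>0) \<partial>H)" for v
  have G_Lip: "\<bar>G v - G w\<bar> \<le> A * norm (v - w)" for v w
  proof -
    have "\<bar>G v - G w\<bar> = \<bar>\<integral>x. excess l (x \<bullet> (\<beta>0 + v)) (x \<bullet> \<beta>0) - excess l (x \<bullet> (\<beta>0 + w)) (x \<bullet> \<beta>0) \<partial>H\<bar>"
      unfolding G_def using excess_H_integrable by simp
    also have "\<dots> \<le> (\<integral>x. \<bar>excess l (x \<bullet> (\<beta>0 + v)) (x \<bullet> \<beta>0) - excess l (x \<bullet> (\<beta>0 + w)) (x \<bullet> \<beta>0)\<bar> \<partial>H)"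
      by (rule integral_abs_bound)
    also have "\<dots> \<le> (\<integral>x. norm x * norm (v - w) \<partial>H)"
      using excess_H_integrable norm_int excess_at_Lipschitz[of "(_, 0)" v w]
      by (intro integral_mono) auto
    finally show ?thesis by (simp add: A_def)
  qed
  have "continuous_on (sphere 0 \<epsilon>) G"
  proof (rule continuous_at_imp_continuous_on, rule ballI)
    fix v
    show "isCont G v" unfolding continuous_within
    proof (rule metric_tendsto_imp_tendsto)
      show "((\<lambda>w. A * norm (w - v)) \<longlongrightarrow> 0) (at v)" by (auto intro!: tendsto_eq_intros)
      show "\<forall>\<^sub>F w in at v. dist (G w) (G v) \<le> dist (A * norm (w - v)) 0"
        using G_Lip A by (auto simp: dist_real_def abs_mult)
    qed
  qed
  moreover have "sphere (0 :: real ^ 'p) \<epsilon> \<noteq> {}" using assms by simp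
  ultimately obtain v0 where v0: "v0 \<in> sphere 0 \<epsilon>" "\<And>v. v \<in> sphere 0 \<epsilon> \<Longrightarrow> G v0 \<le> G v"
    using continuous_attains_inf[of "sphere (0 :: real ^ 'p) \<epsilon>" G] by auto
  have "v0 \<noteq> 0" using v0(1) assms by auto
  then have c0: "G v0 > 0" unfolding G_def by (rule mean_excess_pos)
  \<comment> \<open>Moving to the net costs at most \<open>\<delta> * (A + 1)\<close>, a quarter of
    the minimum \<open>G v0\<close>; the law of large numbers costs another quarter, and half
    remains.\<close>
  define \<delta> where "\<delta> = G v0 / (4 * (A + 1))"
  have \<delta>: "\<delta> > 0" using c0 A unfolding \<delta>_def by simp
  have "sphere (0 :: real ^ 'p) \<epsilon> \<subseteq> (\<Union>v\<in>sphere 0 \<epsilon>. ball v \<delta>)"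
    using \<delta> by (intro subsetI UN_I) auto
  then obtain C where C: "C \<subseteq> sphere (0 :: real ^ 'p) \<epsilon>" "finite C" "sphere 0 \<epsilon> \<subseteq> (\<Union>v\<in>C. ball v \<delta>)"
    using compactE_image[OF compact_sphere[of "0 :: real ^ 'p" \<epsilon>], of "sphere 0 \<epsilon>" "\<lambda>v. ball v \<delta>"] by auto
  have 1: "whp (\<lambda>n \<omega>. \<forall>v\<in>C. \<bar>avg (excess_at v) n \<omega> - G v\<bar> < G v0 / 4)"
  proof (rule whp_finite_Ball[OF C(2)])
    fix v
    have "integral\<^sup>L D (excess_at v) = G v" "integrable D (excess_at v)"
      using integral_D_fst[OF excess_H_integrable[of v]] by (auto simp: G_def)
    then show "whp (\<lambda>n \<omega>. \<bar>avg (excess_at v) n \<omega> - G v\<bar> < G v0 / 4)"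
      using weak_law_of_large_numbers[of "excess_at v" "G v0 / 4"] c0 by simp
  qed
  have 2: "whp (\<lambda>n \<omega>. \<bar>avg (\<lambda>z. norm (fst z)) n \<omega> - A\<bar> < 1)"
    using weak_law_of_large_numbers[of "\<lambda>z. norm (fst z)" 1] integral_D_fst[OF norm_int] by (simp add: A_def)
  have "whp (\<lambda>n \<omega>. \<forall>v\<in>sphere 0 \<epsilon>. avg (excess_at v) n \<omega> \<ge> G v0 / 2)"
  proof (rule whp_mono[OF whp_conj[OF 1 2]], intro ballI)
    fix n \<omega> and v :: "real ^ 'p"
    assume *: "(\<forall>v\<in>C. \<bar>avg (excess_at v) n \<omega> - G v\<bar> < G v0 / 4) \<and> \<bar>avg (\<lambda>z. norm (fst z)) n \<omega> - A\<bar> < 1"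
      and v: "v \<in> sphere 0 \<epsilon>"
    then obtain w where w: "w \<in> C" "v \<in> ball w \<delta>" using C(3) by blast
    have "avg (excess_at w) n \<omega> - avg (excess_at v) n \<omega> = avg (\<lambda>z. excess_at w z - excess_at v z) n \<omega>"
      by (simp add: avg_diff)
    also have "\<dots> \<le> avg (\<lambda>z. \<delta> * norm (fst z)) n \<omega>"
    proof (rule avg_mono)
      fix i
      have "\<bar>excess_at w (Z i \<omega>) - excess_at v (Z i \<omega>)\<bar> \<le> norm (fst (Z i \<omega>)) * norm (w - v)"
        by (rule excess_at_Lipschitz)
      also have "\<dots> \<le> norm (fst (Z i \<omega>)) * \<delta>" using w(2) by (intro mult_left_mono) (auto simp: dist_norm)
      finally show "excess_at w (Z i \<omega>) - excess_at v (Z i \<omega>) \<le> \<delta> * norm (fst (Z i \<omega>))" by (simp add: mult.commute)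
    qed
    also have "\<dots> = \<delta> * avg (\<lambda>z. norm (fst z)) n \<omega>" by (rule avg_cmult)
    also have "\<dots> \<le> \<delta> * (A + 1)" using * \<delta> by (intro mult_left_mono) auto
    also have "\<dots> = G v0 / 4" unfolding \<delta>_def using A by (simp add: divide_simps)
    finally have "avg (excess_at w) n \<omega> - avg (excess_at v) n \<omega> \<le> G v0 / 4" .
    moreover have "\<bar>avg (excess_at w) n \<omega> - G w\<bar> < G v0 / 4" using * w(1) by blast
    moreover have "G v0 \<le> G w" using v0(2) w(1) C(1) by blast
    ultimately show "G v0 / 2 \<le> avg (excess_at v) n \<omega>" by linarith
  qed
  with c0 that[of "G v0 / 2"] show ?thesis by simp
qed

section \<open>Uniform smallness of the noise and separation of the average loss\<close>

definition noise :: "(real ^ 'p) \<times> real \<Rightarrow> real" where "noise z = snd z - mean0 (fst z)"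

lemma noise_abs_le: "snd z \<in> {0, 1} \<Longrightarrow> \<bar>noise z\<bar> \<le> 1"
  using logistic_bounds[of "fst z \<bullet> \<beta>0"] by (auto simp: noise_def)

lemma noise_measurable [measurable]: "noise \<in> borel_measurable borel"
proof -
  have "(\<lambda>z :: (real ^ 'p) \<times> real. mean0 (fst z)) \<in> borel_measurable borel"
    by (rule measurable_compose[OF fst_snd_measurable(1)]) measurable
  then show ?thesis unfolding noise_def[abs_def] by measurable
qed

text \<open>Given the covariate the noise has mean
  \<open>(1 - p) * p - p * (1 - p) = 0\<close>.\<close>

lemma integral_noise:
  fixes f :: "real ^ 'p \<Rightarrow> real"
  assumes f: "integrable H f"
  shows "integrable D (\<lambda>z. noise z * f (fst z))" "integral\<^sup>L D (\<lambda>z. noise z * f (fst z)) = 0"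
proof -
  have [measurable]: "f \<in> borel_measurable borel" using f by (auto simp: measurable_H dest: borel_measurable_integrable)
  have "(\<lambda>z :: (real ^ 'p) \<times> real. f (fst z)) \<in> borel_measurable borel"
    by (rule measurable_compose[OF fst_snd_measurable(1)]) measurable
  then have m: "(\<lambda>z. noise z * f (fst z)) \<in> borel_measurable borel" by measurable
  have i1: "integrable H (\<lambda>x. noise (x, 1) * f (fst (x, 1 :: real)))"
    using integrable_mean0(2)[OF f] by (simp add: noise_def mult.commute)
  have i0: "integrable H (\<lambda>x. noise (x, 0) * f (fst (x, 0 :: real)))"
    using integrable_mean0(1)[OF f] by (simp add: noise_def mult.commute)
  show "integrable D (\<lambda>z. noise z * f (fst z))" using integral_D(2)[OF m i1 i0] .
  show "integral\<^sup>L D (\<lambda>z. noise z * f (fst z)) = 0"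
    unfolding integral_D(1)[OF m i1 i0] by (simp add: noise_def algebra_simps)
qed

text \<open>The noise is at most 1 in absolute value, so replacing the response by the lower end of
  its bracket costs at most the average gap. Finitely many brackets then call for finitely many laws
  of large numbers.\<close>

lemma whp_noise_response:
  assumes "l > 0" "\<eta> > 0"
  shows "whp (\<lambda>n \<omega>. \<forall>\<beta>. \<bar>avg (\<lambda>z. noise z * response l (fst z \<bullet> \<beta>)) n \<omega>\<bar> < \<eta>)"
proof -
  obtain B where B: "finite B"
    "\<And>lo up. (lo, up) \<in> B \<Longrightarrow> integrable H lo \<and> integrable H up \<and> (\<integral>x. up x - lo x \<partial>H) < \<eta> / 4"
    "\<And>\<beta>. \<exists>(lo, up)\<in>B. \<forall>x. lo x \<le> response l (x \<bullet> \<beta>) \<and> response l (x \<bullet> \<beta>) \<le> up x"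
  proof (rule finite_brackets[OF prob_space_H sets_H norm_int response_antimono[OF lambda] _ tendsto_response(2,1)[OF \<open>l > 0\<close>]])
    show "\<bar>response l s - response l t\<bar> \<le> 1 * \<bar>s - t\<bar>" for s t using response_Lipschitz[OF lambda, of s t] by simp
    show "\<eta> / 4 > 0" using assms by simp
  qed blast
  have "whp (\<lambda>n \<omega>. \<forall>(lo, up)\<in>B. \<bar>avg (\<lambda>z. noise z * lo (fst z)) n \<omega>\<bar> < \<eta> / 2
      \<and> avg (\<lambda>z. up (fst z) - lo (fst z)) n \<omega> < \<eta> / 2)"
  proof (rule whp_finite_Ball[OF B(1)])
    fix b assume "b \<in> B"
    then obtain lo up where b: "b = (lo, up)" "(lo, up) \<in> B" by (cases b) auto
    have lu: "integrable H lo" "integrable H (\<lambda>x. up x - lo x)" "(\<integral>x. up x - lo x \<partial>H) < \<eta> / 4"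
      using B(2)[OF b(2)] by auto
    have "whp (\<lambda>n \<omega>. \<bar>avg (\<lambda>z. noise z * lo (fst z)) n \<omega> - 0\<bar> < \<eta> / 2)"
      using weak_law_of_large_numbers[OF integral_noise(1)[OF lu(1)], of "\<eta> / 2"] assms
      by (simp add: integral_noise[OF lu(1)])
    moreover have "whp (\<lambda>n \<omega>. \<bar>avg (\<lambda>z. up (fst z) - lo (fst z)) n \<omega> - (\<integral>x. up x - lo x \<partial>H)\<bar> < \<eta> / 4)"
      using weak_law_of_large_numbers[OF integral_D_fst(2)[OF lu(2)], of "\<eta> / 4"] assms
      by (simp add: integral_D_fst[OF lu(2)])
    ultimately have "whp (\<lambda>n \<omega>. \<bar>avg (\<lambda>z. noise z * lo (fst z)) n \<omega> - 0\<bar> < \<eta> / 2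
       \<and> \<bar>avg (\<lambda>z. up (fst z) - lo (fst z)) n \<omega> - (\<integral>x. up x - lo x \<partial>H)\<bar> < \<eta> / 4)" by (rule whp_conj)
    then show "whp (\<lambda>n \<omega>. case b of (lo, up) \<Rightarrow> \<bar>avg (\<lambda>z. noise z * lo (fst z)) n \<omega>\<bar> < \<eta> / 2
      \<and> avg (\<lambda>z. up (fst z) - lo (fst z)) n \<omega> < \<eta> / 2)"
    proof (rule whp_mono)
      fix n \<omega>
      assume "\<bar>avg (\<lambda>z. noise z * lo (fst z)) n \<omega> - 0\<bar> < \<eta> / 2
       \<and> \<bar>avg (\<lambda>z. up (fst z) - lo (fst z)) n \<omega> - (\<integral>x. up x - lo x \<partial>H)\<bar> < \<eta> / 4"
      then have "\<bar>avg (\<lambda>z. noise z * lo (fst z)) n \<omega>\<bar> < \<eta> / 2" "avg (\<lambda>z. up (fst z) - lo (fst z)) n \<omega> < \<eta> / 2"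
        using lu(3) by linarith+
      then show "case b of (lo, up) \<Rightarrow> \<bar>avg (\<lambda>z. noise z * lo (fst z)) n \<omega>\<bar> < \<eta> / 2
        \<and> avg (\<lambda>z. up (fst z) - lo (fst z)) n \<omega> < \<eta> / 2" by (simp add: b(1))
    qed
  qed
  from whp_conj[OF this whp_binary] show ?thesis
  proof (rule whp_mono, intro allI)
    fix n \<omega> \<beta>
    assume *: "(\<forall>(lo, up)\<in>B. \<bar>avg (\<lambda>z. noise z * lo (fst z)) n \<omega>\<bar> < \<eta> / 2
      \<and> avg (\<lambda>z. up (fst z) - lo (fst z)) n \<omega> < \<eta> / 2) \<and> (\<forall>i. Y i \<omega> \<in> {0, 1})"
    obtain lo up where b: "(lo, up) \<in> B" "\<And>x. lo x \<le> response l (x \<bullet> \<beta>)" "\<And>x. response l (x \<bullet> \<beta>) \<le> up x"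
      using B(3)[of \<beta>] by auto
    have lo: "\<bar>avg (\<lambda>z. noise z * lo (fst z)) n \<omega>\<bar> < \<eta> / 2"
      and up: "avg (\<lambda>z. up (fst z) - lo (fst z)) n \<omega> < \<eta> / 2" using * b(1) by auto
    have "\<bar>avg (\<lambda>z. noise z * response l (fst z \<bullet> \<beta>)) n \<omega> - avg (\<lambda>z. noise z * lo (fst z)) n \<omega>\<bar>
       \<le> avg (\<lambda>z. \<bar>noise z * response l (fst z \<bullet> \<beta>) - noise z * lo (fst z)\<bar>) n \<omega>"
      unfolding avg_diff[symmetric] by (rule avg_abs)
    also have "\<dots> \<le> avg (\<lambda>z. up (fst z) - lo (fst z)) n \<omega>"
    proof (rule avg_mono)
      fix i
      let ?z = "Z i \<omega>"
      have "snd ?z \<in> {0, 1}" using * by (simp add: Z_def)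
      then have "\<bar>noise ?z\<bar> * \<bar>response l (fst ?z \<bullet> \<beta>) - lo (fst ?z)\<bar> \<le> 1 * (up (fst ?z) - lo (fst ?z))"
        using b(2,3)[of "fst ?z"] noise_abs_le[of ?z] by (intro mult_mono) auto
      then show "\<bar>noise ?z * response l (fst ?z \<bullet> \<beta>) - noise ?z * lo (fst ?z)\<bar> \<le> up (fst ?z) - lo (fst ?z)"
        by (simp add: right_diff_distrib[symmetric] abs_mult)
    qed
    finally show "\<bar>avg (\<lambda>z. noise z * response l (fst z \<bullet> \<beta>)) n \<omega>\<bar> < \<eta>" using lo up by linarith
  qed
qed

text \<open>Linearity in \<open>v\<close> reduces uniformity to the finitely many
  coordinates.\<close>

lemma whp_noise_linear:
  assumes "\<eta> > 0"
  shows "whp (\<lambda>n \<omega>. \<forall>v. \<bar>avg (\<lambda>z. noise z * (fst z \<bullet> v)) n \<omega>\<bar> \<le> \<eta> * norm v)"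
proof -
  define \<eta>' where "\<eta>' = \<eta> / real CARD('p)"
  have "\<eta>' > 0" using assms by (simp add: \<eta>'_def)
  have int: "integrable H (\<lambda>x. x $ j)" for j :: 'p
    using norm_int component_le_norm_cart by (intro Bochner_Integration.integrable_bound[OF norm_int] AE_I2) (auto simp: measurable_H)
  have "whp (\<lambda>n \<omega>. \<forall>j\<in>UNIV. \<bar>avg (\<lambda>z. noise z * (fst z $ j)) n \<omega>\<bar> < \<eta>')"
  proof (rule whp_finite_Ball)
    fix j
    show "whp (\<lambda>n \<omega>. \<bar>avg (\<lambda>z. noise z * (fst z $ j)) n \<omega>\<bar> < \<eta>')"
      using weak_law_of_large_numbers[OF integral_noise(1)[OF int[of j]] \<open>\<eta>' > 0\<close>]
      by (simp add: integral_noise[OF int])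
  qed simp
  then show ?thesis
  proof (rule whp_mono, intro allI)
    fix n \<omega> and v :: "real ^ 'p"
    assume *: "\<forall>j\<in>UNIV. \<bar>avg (\<lambda>z. noise z * (fst z $ j)) n \<omega>\<bar> < \<eta>'"
    have "avg (\<lambda>z. noise z * (fst z \<bullet> v)) n \<omega> = (\<Sum>j\<in>UNIV. v $ j * avg (\<lambda>z. noise z * (fst z $ j)) n \<omega>)"
      by (simp add: inner_vec_def sum_distrib_left avg_sum[symmetric] avg_cmult[symmetric] mult_ac)
    also have "\<bar>\<dots>\<bar> \<le> (\<Sum>j\<in>(UNIV :: 'p set). norm v * \<eta>')"
    proof (rule order.trans[OF sum_abs], rule sum_mono)
      fix j :: 'p
      show "\<bar>v $ j * avg (\<lambda>z. noise z * (fst z $ j)) n \<omega>\<bar> \<le> norm v * \<eta>'"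
        unfolding abs_mult using * component_le_norm_cart[of v j] by (intro mult_mono) (auto intro: less_imp_le)
    qed
    also have "\<dots> = \<eta> * norm v" by (simp add: \<eta>'_def)
    finally show "\<bar>avg (\<lambda>z. noise z * (fst z \<bullet> v)) n \<omega>\<bar> \<le> \<eta> * norm v" .
  qed
qed

lemma avg_loss_diff:
  "avg (loss_at \<beta>) n \<omega> - avg (loss_at \<beta>0) n \<omega> = avg (excess_at (\<beta> - \<beta>0)) n \<omega>
     + (avg (\<lambda>z. noise z * response l (fst z \<bullet> \<beta>)) n \<omega> - avg (\<lambda>z. noise z * response l (fst z \<bullet> \<beta>0)) n \<omega>)"
  unfolding avg_diff[symmetric] avg_add[symmetric] loss_diff
  by (simp add: noise_def right_diff_distrib)

text \<open>Let \<open>c\<close> bound the excess from below on the sphere. For \<open>l > 0\<close>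
  the bound persists outside, and each of two noise terms stays below \<open>c / 2\<close>. For
  \<open>l = 0\<close> the bounds for the excess and for the noise both scale with the distance from
  \<beta>0.\<close>

lemma whp_loss_separated:
  assumes "\<epsilon> > 0"
  shows "whp (\<lambda>n \<omega>. \<forall>\<beta>. norm (\<beta> - \<beta>0) \<ge> \<epsilon> \<longrightarrow> avg (loss_at \<beta>) n \<omega> > avg (loss_at \<beta>0) n \<omega>)"
proof -
  obtain c where c: "c > 0" "whp (\<lambda>n \<omega>. \<forall>v\<in>sphere 0 \<epsilon>. avg (excess_at v) n \<omega> \<ge> c)"
    using whp_excess_sphere[OF assms] by blast
  have ray: "\<beta> - \<beta>0 \<noteq> 0 \<and> (\<epsilon> / norm (\<beta> - \<beta>0)) *\<^sub>R (\<beta> - \<beta>0) \<in> sphere 0 \<epsilon> \<and> 0 \<le> \<epsilon> / norm (\<beta> - \<beta>0) \<and> \<epsilon> / norm (\<beta> - \<beta>0) \<le> 1"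
    if "norm (\<beta> - \<beta>0) \<ge> \<epsilon>" for \<beta> :: "real ^ 'p"
    using that assms by auto
  show ?thesis
  proof (cases "l = 0")
    case False
    then have "l > 0" using lambda by simp
    have "c / 2 > 0" using c(1) by simp
    from whp_conj[OF c(2) whp_noise_response[OF \<open>l > 0\<close> this]] show ?thesis
    proof (rule whp_mono, intro allI impI)
      fix n \<omega> and \<beta> :: "real ^ 'p"
      assume *: "(\<forall>v\<in>sphere 0 \<epsilon>. avg (excess_at v) n \<omega> \<ge> c) \<and>
          (\<forall>\<beta>. \<bar>avg (\<lambda>z. noise z * response l (fst z \<bullet> \<beta>)) n \<omega>\<bar> < c / 2)"
        and far: "\<epsilon> \<le> norm (\<beta> - \<beta>0)"
      define t where "t = \<epsilon> / norm (\<beta> - \<beta>0)"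
      have t01: "0 \<le> t" "t \<le> 1" using ray[OF far] unfolding t_def by blast+
      have "t *\<^sub>R (\<beta> - \<beta>0) \<in> sphere 0 \<epsilon>" using ray[OF far] unfolding t_def by blast
      with * have "c \<le> avg (excess_at (t *\<^sub>R (\<beta> - \<beta>0))) n \<omega>" by blast
      also have "\<dots> \<le> avg (excess_at (\<beta> - \<beta>0)) n \<omega>"
      proof (rule avg_mono)
        fix i
        show "excess_at (t *\<^sub>R (\<beta> - \<beta>0)) (Z i \<omega>) \<le> excess_at (\<beta> - \<beta>0) (Z i \<omega>)"
          using excess_mono_ray[OF lambda, of t "fst (Z i \<omega>) \<bullet> \<beta>0" "fst (Z i \<omega>) \<bullet> (\<beta> - \<beta>0)"] t01
          by (simp only: inner_add_right inner_scaleR_right)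
      qed
      finally have "avg (excess_at (\<beta> - \<beta>0)) n \<omega> \<ge> c" .
      moreover have "\<bar>avg (\<lambda>z. noise z * response l (fst z \<bullet> \<beta>)) n \<omega>\<bar> < c / 2"
        "\<bar>avg (\<lambda>z. noise z * response l (fst z \<bullet> \<beta>0)) n \<omega>\<bar> < c / 2" using * by blast+
      ultimately show "avg (loss_at \<beta>) n \<omega> > avg (loss_at \<beta>0) n \<omega>"
        using avg_loss_diff[of \<beta> n \<omega>] by linarith
    qed
  next
    case True
    \<comment> \<open>At distance \<open>d\<close> from \<beta>0 the excess is at least
      \<open>c * d / \<epsilon>\<close>; the noise is allowed half of that slope.\<close>
    have "c / (2 * \<epsilon>) > 0" using c(1) assms by simp
    from whp_conj[OF c(2) whp_noise_linear[OF this]] show ?thesis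
    proof (rule whp_mono, intro allI impI)
      fix n \<omega> and \<beta> :: "real ^ 'p"
      assume *: "(\<forall>v\<in>sphere 0 \<epsilon>. avg (excess_at v) n \<omega> \<ge> c) \<and>
          (\<forall>v. \<bar>avg (\<lambda>z. noise z * (fst z \<bullet> v)) n \<omega>\<bar> \<le> c / (2 * \<epsilon>) * norm v)"
        and far: "\<epsilon> \<le> norm (\<beta> - \<beta>0)"
      define t where "t = \<epsilon> / norm (\<beta> - \<beta>0)"
      have t: "t > 0" unfolding t_def using far assms by (intro divide_pos_pos) linarith+
      have t01: "0 \<le> t" "t \<le> 1" using ray[OF far] unfolding t_def by blast+
      have "t *\<^sub>R (\<beta> - \<beta>0) \<in> sphere 0 \<epsilon>" using ray[OF far] unfolding t_def by blast
      with * have "c \<le> avg (excess_at (t *\<^sub>R (\<beta> - \<beta>0))) n \<omega>" by blast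
      also have "\<dots> \<le> avg (\<lambda>z. t * excess_at (\<beta> - \<beta>0) z) n \<omega>"
      proof (rule avg_mono)
        fix i
        show "excess_at (t *\<^sub>R (\<beta> - \<beta>0)) (Z i \<omega>) \<le> t * excess_at (\<beta> - \<beta>0) (Z i \<omega>)"
          using excess_0_superlinear[of t "fst (Z i \<omega>) \<bullet> \<beta>0" "fst (Z i \<omega>) \<bullet> (\<beta> - \<beta>0)"] t01
          by (simp only: True inner_add_right inner_scaleR_right)
      qed
      also have "\<dots> = t * avg (excess_at (\<beta> - \<beta>0)) n \<omega>" by (rule avg_cmult)
      finally have "avg (excess_at (\<beta> - \<beta>0)) n \<omega> \<ge> c / t" using t by (simp add: divide_le_eq mult.commute)
      moreover have "c / t = 2 * (c / (2 * \<epsilon>) * norm (\<beta> - \<beta>0))" using assms by (simp add: t_def)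
      moreover have "c / (2 * \<epsilon>) * norm (\<beta> - \<beta>0) > 0" using c(1) assms far by (intro mult_pos_pos) auto
      moreover have "\<bar>avg (\<lambda>z. noise z * response l (fst z \<bullet> \<beta>)) n \<omega> - avg (\<lambda>z. noise z * response l (fst z \<bullet> \<beta>0)) n \<omega>\<bar>
          \<le> c / (2 * \<epsilon>) * norm (\<beta> - \<beta>0)"
      proof -
        have "avg (\<lambda>z. noise z * response l (fst z \<bullet> \<beta>)) n \<omega> - avg (\<lambda>z. noise z * response l (fst z \<bullet> \<beta>0)) n \<omega>
          = avg (\<lambda>z. noise z * (fst z \<bullet> (\<beta>0 - \<beta>))) n \<omega>"
          unfolding avg_diff[symmetric] True response_0 inner_diff_right right_diff_distrib by simp
        moreover have "\<bar>avg (\<lambda>z. noise z * (fst z \<bullet> (\<beta>0 - \<beta>))) n \<omega>\<bar> \<le> c / (2 * \<epsilon>) * norm (\<beta>0 - \<beta>)"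
          using * by blast
        ultimately show ?thesis by (simp only: norm_minus_commute)
      qed
      ultimately show "avg (loss_at \<beta>) n \<omega> > avg (loss_at \<beta>0) n \<omega>"
        using avg_loss_diff[of \<beta> n \<omega>] by linarith
    qed
  qed
qed

end

section \<open>The matrices of the asymptotic variance\<close>

text \<open>The complement of the support is the union of all open null sets. By Lindelof's theorem
  countably many of them have the same union, which is therefore null.\<close>

lemma measure_support_full:
  fixes H :: "'b::second_countable_topology measure"
  assumes sets_H: "sets H = sets borel"
  shows "measure_support H \<in> sets H" "AE x in H. x \<in> measure_support H"
proof -
  define \<F> where "\<F> = {U. open U \<and> emeasure H U = 0}"
  obtain \<F>' where F': "\<F>' \<subseteq> \<F>" "countable \<F>'" "\<Union>\<F>' = \<Union>\<F>"
    using Lindelof[of \<F>] by (auto simp: \<F>_def)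
  have compl: "- measure_support H = \<Union>\<F>"
    unfolding measure_support_def \<F>_def by (auto simp: zero_less_iff_neq_zero)
  have "U \<in> null_sets H" if "U \<in> \<F>'" for U
    using F'(1) that by (auto simp: \<F>_def sets_H null_sets_def)
  then have "(\<Union>U\<in>\<F>'. U) \<in> null_sets H" by (intro null_sets_UN'[OF F'(2)])
  then have null: "- measure_support H \<in> null_sets H" using F'(3) compl by simp
  then show "AE x in H. x \<in> measure_support H" by (rule AE_I') auto
  have "space H - (- measure_support H) \<in> sets H" using null by (intro sets.compl_sets) auto
  moreover have "space H = UNIV" using sets_eq_imp_space_eq[OF sets_H] by simp
  ultimately show "measure_support H \<in> sets H" by simp
qed

text \<open>Markov's inequality bounds \<open>T n\<close> by a constant off a small event, and the
  factor \<eta> is chosen after that constant.\<close>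

lemma (in prob_space) whp_dominated_by_bounded:
  fixes R T :: "nat \<Rightarrow> 'a \<Rightarrow> real"
  assumes dom: "\<And>\<eta>. \<eta> > 0 \<Longrightarrow> whp (\<lambda>n \<omega>. R n \<omega> \<le> \<eta> * T n \<omega>)"
    and T: "\<And>n. integrable M (T n)" "\<And>n \<omega>. T n \<omega> \<ge> 0" "\<And>n. expectation (T n) \<le> \<tau>" and "\<delta> > 0"
  shows "whp (\<lambda>n \<omega>. R n \<omega> \<le> \<delta>)"
  unfolding whp_def
proof (intro allI impI)
  fix \<epsilon> :: real assume "\<epsilon> > 0"
  have "\<tau> \<ge> 0" using T(3)[of 0] integral_nonneg_AE[OF AE_I2, of M "T 0", OF T(2)] by linarith
  \<comment> \<open>Chosen so that \<open>(\<tau> + 1) / c = \<epsilon> / 2\<close>, the probability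
    allotted to \<open>T n\<close> reaching \<open>c\<close>.\<close>
  define c where "c = 2 * (\<tau> + 1) / \<epsilon>"
  have c: "c > 0" using \<open>\<epsilon> > 0\<close> \<open>\<tau> \<ge> 0\<close> by (simp add: c_def)
  have "whp (\<lambda>n \<omega>. R n \<omega> \<le> \<delta> / c * T n \<omega>)" using c \<open>\<delta> > 0\<close> by (intro dom) simp
  then have "\<forall>\<^sub>F n in sequentially. \<exists>A\<in>events. prob A \<ge> 1 - \<epsilon> / 2 \<and> (\<forall>\<omega>\<in>A. R n \<omega> \<le> \<delta> / c * T n \<omega>)"
    using half_gt_zero[OF \<open>\<epsilon> > 0\<close>] unfolding whp_def by (elim allE[of _ "\<epsilon> / 2"] impE)
  then show "\<forall>\<^sub>F n in sequentially. \<exists>A\<in>events. prob A \<ge> 1 - \<epsilon> \<and> (\<forall>\<omega>\<in>A. R n \<omega> \<le> \<delta>)"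
  proof eventually_elim
    case (elim n)
    then obtain A where A: "A \<in> events" "prob A \<ge> 1 - \<epsilon> / 2" "\<And>\<omega>. \<omega> \<in> A \<Longrightarrow> R n \<omega> \<le> \<delta> / c * T n \<omega>" by blast
    have [measurable]: "T n \<in> borel_measurable M" using T(1) by auto
    define N where "N = {\<omega>\<in>space M. T n \<omega> \<ge> c}"
    have N[measurable]: "N \<in> events" unfolding N_def by measurable
    have "prob N \<le> expectation (T n) / c"
      unfolding N_def using T c by (intro integral_Markov_inequality_measure[where A="{}"]) auto
    also have "\<dots> \<le> (\<tau> + 1) / c" using T(3)[of n] c by (intro divide_right_mono) auto
    also have "\<dots> = \<epsilon> / 2" using \<open>\<tau> \<ge> 0\<close> \<open>\<epsilon> > 0\<close> by (simp add: c_def divide_simps)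
    finally have "prob N \<le> \<epsilon> / 2" .
    moreover have "prob A \<le> prob (A - N) + prob N"
    proof -
      have "prob A \<le> prob ((A - N) \<union> N)" using A(1) by (intro finite_measure_mono) auto
      also have "\<dots> \<le> prob (A - N) + prob N" using A(1) by (intro measure_Un_le) auto
      finally show ?thesis .
    qed
    moreover have "R n \<omega> \<le> \<delta>" if "\<omega> \<in> A - N" for \<omega>
    proof -
      have "\<omega> \<in> space M" using that A(1) sets.sets_into_space by blast
      then have "T n \<omega> \<le> c" using that by (auto simp: N_def)
      then have "\<delta> / c * T n \<omega> \<le> \<delta> / c * c" using \<open>\<delta> > 0\<close> c by (intro mult_left_mono) auto
      then show ?thesis using A(3)[of \<omega>] that c by simp
    qed
    ultimately show ?case using A by (intro bexI[of _ "A - N"]) auto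
  qed
qed

definition outer :: "real ^ 'p \<Rightarrow> real ^ 'p ^ 'p" where "outer x = (\<chi> i j. x $ i * x $ j)"

lemma norm_outer_le: "norm (outer x) \<le> real CARD('p) * (norm x)\<^sup>2" for x :: "real ^ 'p"
proof -
  have row: "outer x $ i = (x $ i) *\<^sub>R x" for i by (simp add: outer_def vec_eq_iff)
  have "norm (outer x) \<le> (\<Sum>i\<in>UNIV. norm (outer x $ i))" by (simp add: norm_vec_def L2_set_le_sum)
  also have "\<dots> \<le> (\<Sum>i\<in>(UNIV :: 'p set). (norm x)\<^sup>2)"
    unfolding row power2_eq_square by (intro sum_mono) (simp add: component_le_norm_cart mult_right_mono)
  finally show ?thesis by simp
qed

context logistic_asymptotics
begin

text \<open>The common shape of \<open>J\<close> and \<open>K\<close>. Both have positive weights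
  bounded by 1, so the second moment makes the integral exist.\<close>

definition gram :: "(real \<Rightarrow> real) \<Rightarrow> real ^ 'p \<Rightarrow> real ^ 'p ^ 'p" where
  "gram g \<beta> = (\<integral>x. g (x \<bullet> \<beta>) *\<^sub>R outer x \<partial>H)"

lemma outer_measurable [measurable]: "(outer :: real ^ 'p \<Rightarrow> _) \<in> borel_measurable borel"
  unfolding outer_def by (intro borel_measurable_continuous_onI continuous_intros continuous_on_vec_lambda)

lemma gram_integrable:
  assumes [measurable]: "g \<in> borel_measurable borel" and g: "\<And>s. \<bar>g s\<bar> \<le> 1"
  shows "integrable H (\<lambda>x. g (x \<bullet> \<beta>) *\<^sub>R outer x)"
proof (rule Bochner_Integration.integrable_bound)
  show "integrable H (\<lambda>x. real CARD('p) * (norm x)\<^sup>2)" using second_moment by simp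
  show "(\<lambda>x. g (x \<bullet> \<beta>) *\<^sub>R outer x) \<in> borel_measurable H" by (simp add: measurable_H)
  have "\<bar>g (x \<bullet> \<beta>)\<bar> * norm (outer x) \<le> 1 * (real CARD('p) * (norm x)\<^sup>2)" for x :: "real ^ 'p"
    using g norm_outer_le by (intro mult_mono) auto
  then show "AE x in H. norm (g (x \<bullet> \<beta>) *\<^sub>R outer x) \<le> norm (real CARD('p) * (norm x)\<^sup>2)"
    by (intro AE_I2) simp
qed

lemma gram_component:
  assumes "g \<in> borel_measurable borel" "\<And>s. \<bar>g s\<bar> \<le> 1"
  shows "gram g \<beta> $ i $ j = (\<integral>x. g (x \<bullet> \<beta>) * (x $ i * x $ j) \<partial>H)"
    and "integrable H (\<lambda>x. g (x \<bullet> \<beta>) * (x $ i * x $ j))"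
proof -
  have bl: "bounded_linear (\<lambda>A :: real ^ 'p ^ 'p. A $ i $ j)"
    by (rule bounded_linear_compose[OF bounded_linear_vec_nth bounded_linear_vec_nth])
  show "gram g \<beta> $ i $ j = (\<integral>x. g (x \<bullet> \<beta>) * (x $ i * x $ j) \<partial>H)"
    unfolding gram_def integral_bounded_linear[OF bl gram_integrable[OF assms], symmetric]
    by (simp add: outer_def)
  show "integrable H (\<lambda>x. g (x \<bullet> \<beta>) * (x $ i * x $ j))"
    using integrable_bounded_linear[OF bl gram_integrable[OF assms, of \<beta>]] by (simp add: outer_def)
qed

lemma gram_form:
  assumes "g \<in> borel_measurable borel" "\<And>s. \<bar>g s\<bar> \<le> 1"
  shows "u \<bullet> (gram g \<beta> *v v) = (\<integral>x. g (x \<bullet> \<beta>) * ((x \<bullet> u) * (x \<bullet> v)) \<partial>H)"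
    and "integrable H (\<lambda>x. g (x \<bullet> \<beta>) * ((x \<bullet> u) * (x \<bullet> v)))"
proof -
  have eq: "g (x \<bullet> \<beta>) * ((x \<bullet> u) * (x \<bullet> v)) = (\<Sum>i\<in>UNIV. \<Sum>j\<in>UNIV. u $ i * v $ j * (g (x \<bullet> \<beta>) * (x $ i * x $ j)))" for x
  proof -
    have "(x \<bullet> u) * (x \<bullet> v) = (\<Sum>i\<in>UNIV. \<Sum>j\<in>UNIV. (x $ i * u $ i) * (x $ j * v $ j))"
      by (simp add: inner_vec_def sum_product)
    then show ?thesis by (simp only: sum_distrib_left mult_ac)
  qed
  note int = gram_component(2)[OF assms]
  show "integrable H (\<lambda>x. g (x \<bullet> \<beta>) * ((x \<bullet> u) * (x \<bullet> v)))"
    unfolding eq using int by (intro Bochner_Integration.integrable_sum integrable_mult_right)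
  have "(\<integral>x. g (x \<bullet> \<beta>) * ((x \<bullet> u) * (x \<bullet> v)) \<partial>H) = (\<Sum>i\<in>UNIV. \<Sum>j\<in>UNIV. u $ i * v $ j * gram g \<beta> $ i $ j)"
    unfolding eq gram_component(1)[OF assms] using int
    by (simp add: Bochner_Integration.integral_sum Bochner_Integration.integrable_sum)
  also have "\<dots> = u \<bullet> (gram g \<beta> *v v)"
    by (simp add: inner_vec_def matrix_vector_mult_def sum_distrib_left mult_ac)
  finally show "u \<bullet> (gram g \<beta> *v v) = (\<integral>x. g (x \<bullet> \<beta>) * ((x \<bullet> u) * (x \<bullet> v)) \<partial>H)" by simp
qed

lemma transpose_gram:
  assumes "g \<in> borel_measurable borel" "\<And>s. \<bar>g s\<bar> \<le> 1"
  shows "transpose (gram g \<beta>) = gram g \<beta>"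
  by (simp add: vec_eq_iff transpose_def gram_component[OF assms] mult.commute)

text \<open>A vanishing quadratic form would force \<open>x \<bullet> v = 0\<close> almost
  everywhere, against \<open>nondegenerate\<close>.\<close>

lemma gram_pos:
  assumes g: "g \<in> borel_measurable borel" "\<And>s. \<bar>g s\<bar> \<le> 1" and pos: "\<And>s. g s > 0" and "v \<noteq> 0"
  shows "v \<bullet> (gram g \<beta> *v v) > 0"
proof (rule ccontr)
  assume "\<not> ?thesis"
  have nn: "g (x \<bullet> \<beta>) * ((x \<bullet> v) * (x \<bullet> v)) \<ge> 0" for x using pos[of "x \<bullet> \<beta>"] by simp
  then have "v \<bullet> (gram g \<beta> *v v) \<ge> 0" unfolding gram_form[OF g] by (intro integral_nonneg_AE AE_I2)
  with \<open>\<not> ?thesis\<close> have "(\<integral>x. g (x \<bullet> \<beta>) * ((x \<bullet> v) * (x \<bullet> v)) \<partial>H) = 0"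
    unfolding gram_form[OF g] by linarith
  then have "AE x in H. g (x \<bullet> \<beta>) * ((x \<bullet> v) * (x \<bullet> v)) = 0"
    using integral_nonneg_eq_0_iff_AE[OF gram_form(2)[OF g]] nn by auto
  then have "AE x in H. x \<bullet> v = 0"
    by eventually_elim (use pos in \<open>metis less_irrefl mult_eq_0_iff\<close>)
  with nondegenerate[OF \<open>v \<noteq> 0\<close>] show False by simp
qed

lemma gram_continuous:
  assumes cont: "\<And>s. isCont g s" and g: "\<And>s. \<bar>g s\<bar> \<le> 1"
  shows "isCont (\<lambda>\<beta>. gram g \<beta> $ i $ j) \<beta>"
proof -
  have meas [measurable]: "g \<in> borel_measurable borel"
    using cont by (intro borel_measurable_continuous_onI continuous_at_imp_continuous_on) auto
  show ?thesis
    unfolding continuous_at_sequentially comp_def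
  proof (intro allI impI)
    fix b :: "nat \<Rightarrow> real ^ 'p" assume b: "b \<longlonglongrightarrow> \<beta>"
    show "(\<lambda>n. gram g (b n) $ i $ j) \<longlonglongrightarrow> gram g \<beta> $ i $ j"
      unfolding gram_component(1)[OF meas g]
    proof (rule integral_dominated_convergence)
      show "integrable H (\<lambda>x. (norm x)\<^sup>2)" by (rule second_moment)
      show "AE x in H. (\<lambda>n. g (x \<bullet> b n) * (x $ i * x $ j)) \<longlonglongrightarrow> g (x \<bullet> \<beta>) * (x $ i * x $ j)"
        by (intro AE_I2 tendsto_mult isCont_tendsto_compose[OF cont] tendsto_inner tendsto_const b)
      have "\<bar>g (x \<bullet> b n)\<bar> * (\<bar>x $ i\<bar> * \<bar>x $ j\<bar>) \<le> 1 * (norm x * norm x)" for n x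
        using g component_le_norm_cart by (intro mult_mono) auto
      then show "AE x in H. norm (g (x \<bullet> b n) * (x $ i * x $ j)) \<le> (norm x)\<^sup>2" for n
        by (intro AE_I2) (simp add: abs_mult power2_eq_square)
    qed (simp_all add: measurable_H)
  qed
qed

text \<open>At the true linear predictor, \<open>J_weight\<close> is the conditional mean of
  \<open>score_deriv\<close> and \<open>K_weight\<close> the conditional mean square of
  \<open>score\<close>.\<close>

definition J_weight :: "real \<Rightarrow> real" where
  "J_weight s = score_weight l s * (logistic s * (1 - logistic s))"

definition K_weight :: "real \<Rightarrow> real" where
  "K_weight s = (score_weight l s)\<^sup>2 * (logistic s * (1 - logistic s))"

lemma isCont_weights: "isCont J_weight s" "isCont K_weight s"
proof -
  have "isCont (score_weight l) s"
    unfolding score_weight_def[abs_def]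
    by (intro isCont_add isCont_mult isCont_diff continuous_const DERIV_isCont[OF DERIV_logistic]
        DERIV_isCont[OF DERIV_logistic_powr] DERIV_isCont[OF DERIV_one_minus_logistic_powr])
  moreover have "isCont logistic s" using DERIV_logistic by (rule DERIV_isCont)
  ultimately show "isCont J_weight s" "isCont K_weight s"
    unfolding J_weight_def[abs_def] K_weight_def[abs_def] by (auto intro!: continuous_intros)
qed

lemma weights_measurable [measurable]: "J_weight \<in> borel_measurable borel" "K_weight \<in> borel_measurable borel"
  using isCont_weights by (auto intro!: borel_measurable_continuous_onI continuous_at_imp_continuous_on)

lemma weights_pos: "J_weight s > 0" "K_weight s > 0"
  using score_weight_pos[of l s] logistic_bounds[of s] by (auto simp: J_weight_def K_weight_def)

lemma weights_le: "\<bar>J_weight s\<bar> \<le> 1" "\<bar>K_weight s\<bar> \<le> 1"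
proof -
  have p: "0 \<le> logistic s * (1 - logistic s)" "logistic s * (1 - logistic s) \<le> 1"
    using logistic_bounds[of s] by (auto intro!: mult_le_one)
  have h: "0 \<le> score_weight l s" "score_weight l s \<le> 1"
    using score_weight_pos[of l s] score_weight_le_1[OF lambda, of s] by auto
  show "\<bar>J_weight s\<bar> \<le> 1" "\<bar>K_weight s\<bar> \<le> 1"
    using p h by (simp_all add: J_weight_def K_weight_def mult_le_one power_le_one)
qed

lemma set_integral_support:
  fixes f :: "real ^ 'p \<Rightarrow> 'c :: {banach, second_countable_topology}"
  assumes "f \<in> borel_measurable H"
  shows "(LINT x:measure_support H|H. f x) = integral\<^sup>L H f"
  unfolding set_lebesgue_integral_def
  using measure_support_full[OF sets_H] assms
  by (intro integral_cong_AE borel_measurable_scaleR borel_measurable_indicator) auto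

lemma J_mat_eq: "J_mat H l \<beta> = gram J_weight \<beta>" and K_mat_eq: "K_mat H l \<beta> = gram K_weight \<beta>"
proof -
  have "J_integrand l \<beta> x = J_weight (x \<bullet> \<beta>) *\<^sub>R outer x" "K_integrand l \<beta> x = K_weight (x \<bullet> \<beta>) *\<^sub>R outer x" for x :: "real ^ 'p"
    by (simp_all add: J_integrand_eq K_integrand_eq J_weight_def K_weight_def outer_def)
  note eq = this
  show "J_mat H l \<beta> = gram J_weight \<beta>" "K_mat H l \<beta> = gram K_weight \<beta>"
    unfolding J_mat_def K_mat_def gram_def eq by (rule set_integral_support; simp add: measurable_H)+
qed

lemmas J_gram = weights_measurable(1) weights_le(1)
lemmas K_gram = weights_measurable(2) weights_le(2)

lemma det_J_mat: "det (J_mat H l \<beta>) \<noteq> 0"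
  unfolding J_mat_eq by (rule positive_matrix_det_nz[OF gram_pos[OF J_gram weights_pos(1)]])

lemma transpose_J_inv: "transpose (matrix_inv (J_mat H l \<beta>)) = matrix_inv (J_mat H l \<beta>)"
proof -
  have inv: "invertible (J_mat H l \<beta>)" using det_J_mat by (simp add: invertible_det_nz)
  have "transpose (matrix_inv (J_mat H l \<beta>) ** J_mat H l \<beta>) = transpose (mat 1)"
    using matrix_inv_inverse(2)[OF inv] by simp
  then have "J_mat H l \<beta> ** transpose (matrix_inv (J_mat H l \<beta>)) = mat 1"
    by (simp add: matrix_transpose_mul J_mat_eq transpose_gram[OF J_gram])
  then show ?thesis by (rule matrix_inv_unique[symmetric])
qed

text \<open>The filter is \<open>nhds\<close> instead of \<open>at\<close>, because the limit is
  composed with a map that may take the value \<beta>' itself.\<close>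

lemma tendsto_Sigma_mat: "((\<lambda>\<beta>. Sigma_mat H l \<beta> $ i $ j) \<longlongrightarrow> Sigma_mat H l \<beta>' $ i $ j) (nhds \<beta>')"
proof -
  have J: "((\<lambda>\<beta>. J_mat H l \<beta> $ i $ j) \<longlongrightarrow> J_mat H l \<beta>' $ i $ j) (nhds \<beta>')" for i j
    unfolding J_mat_eq using gram_continuous[OF isCont_weights(1) weights_le(1), of \<beta>' i j]
      tendsto_at_iff_tendsto_nhds[of "\<lambda>\<beta>. gram J_weight \<beta> $ i $ j" \<beta>'] by (simp add: continuous_within)
  have K: "((\<lambda>\<beta>. K_mat H l \<beta> $ i $ j) \<longlongrightarrow> K_mat H l \<beta>' $ i $ j) (nhds \<beta>')" for i j
    unfolding K_mat_eq using gram_continuous[OF isCont_weights(2) weights_le(2), of \<beta>' i j]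
      tendsto_at_iff_tendsto_nhds[of "\<lambda>\<beta>. gram K_weight \<beta> $ i $ j" \<beta>'] by (simp add: continuous_within)
  show ?thesis
    unfolding Sigma_mat_def matrix_mult_component
    by (intro tendsto_intros tendsto_matrix_inv J K det_J_mat)
qed

lemma Sigma_mat_measurable [measurable]: "(\<lambda>\<beta>. Sigma_mat H l \<beta> $ i $ j) \<in> borel_measurable borel"
proof (intro borel_measurable_continuous_onI continuous_at_imp_continuous_on ballI)
  fix \<beta>
  show "isCont (\<lambda>\<beta>. Sigma_mat H l \<beta> $ i $ j) \<beta>"
    using tendsto_Sigma_mat[of i j \<beta>] tendsto_at_iff_tendsto_nhds[of "\<lambda>\<beta>. Sigma_mat H l \<beta> $ i $ j" \<beta>]
    by (simp add: continuous_within)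
qed

text \<open>For \<open>w = J^-1 M v\<close> the form equals \<open>w \<bullet> K w\<close>, and
  \<open>w\<close> is nonzero because full rank makes \<open>M\<close> injective.\<close>

lemma wald_middle_pos:
  fixes M :: "real ^ 'r ^ 'p"
  assumes "rank M = CARD('r)"
  shows "transpose (transpose M ** Sigma_mat H l \<beta> ** M) = transpose M ** Sigma_mat H l \<beta> ** M"
    and "v \<noteq> 0 \<Longrightarrow> v \<bullet> ((transpose M ** Sigma_mat H l \<beta> ** M) *v v) > 0"
proof -
  show "transpose (transpose M ** Sigma_mat H l \<beta> ** M) = transpose M ** Sigma_mat H l \<beta> ** M"
    by (simp add: Sigma_mat_def matrix_transpose_mul transpose_J_inv K_mat_eq transpose_gram[OF K_gram] matrix_mul_assoc)
  assume "v \<noteq> 0"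
  let ?Ji = "matrix_inv (J_mat H l \<beta>)"
  have inv: "invertible (J_mat H l \<beta>)" using det_J_mat by (simp add: invertible_det_nz)
  have "inj ((*v) M)" using assms by (simp add: full_rank_injective)
  then have "M *v v \<noteq> 0" using \<open>v \<noteq> 0\<close> by (metis injD matrix_vector_mult_0_right)
  then have nz: "?Ji *v (M *v v) \<noteq> 0"
    by (metis inv matrix_inv_inverse(1) matrix_vector_mul_assoc matrix_vector_mul_lid matrix_vector_mult_0_right)
  have tr: "u \<bullet> (transpose A *v w) = (A *v u) \<bullet> w" for u w and A :: "real ^ ('s::finite) ^ ('t::finite)"
    by (metis dot_lmul_matrix inner_commute vector_transpose_matrix transpose_transpose)
  have "v \<bullet> ((transpose M ** Sigma_mat H l \<beta> ** M) *v v) = (M *v v) \<bullet> (?Ji *v (K_mat H l \<beta> *v (?Ji *v (M *v v))))"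
    by (simp only: Sigma_mat_def matrix_vector_mul_assoc[symmetric] tr)
  also have "\<dots> = (?Ji *v (M *v v)) \<bullet> (K_mat H l \<beta> *v (?Ji *v (M *v v)))"
    using tr[of "M *v v" ?Ji] by (simp add: transpose_J_inv)
  also have "\<dots> > 0" unfolding K_mat_eq by (rule gram_pos[OF K_gram weights_pos(2) nz])
  finally show "v \<bullet> ((transpose M ** Sigma_mat H l \<beta> ** M) *v v) > 0" .
qed

lemma wald_measurable:
  fixes M :: "real ^ 'r ^ 'p"
  assumes [measurable]: "b \<in> borel_measurable P"
  shows "(\<lambda>\<omega>. wald_statistic H l M m n (b \<omega>)) \<in> borel_measurable P"
proof -
  have [measurable]: "(\<lambda>\<omega>. (transpose M ** Sigma_mat H l (b \<omega>) ** M) $ i $ j) \<in> borel_measurable P" for i j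
    unfolding matrix_mult_component by measurable
  have [measurable]: "(\<lambda>\<omega>. matrix_inv (transpose M ** Sigma_mat H l (b \<omega>) ** M) $ i $ j) \<in> borel_measurable P" for i j
    by (rule measurable_matrix_inv) measurable
  have [measurable]: "(\<lambda>\<omega>. (transpose M *v b \<omega> - m) $ i) \<in> borel_measurable P" for i
    unfolding vector_minus_component matrix_vector_mult_def vec_lambda_beta
    by (intro borel_measurable_diff borel_measurable_sum borel_measurable_times borel_measurable_const
        measurable_compose[OF assms, of "\<lambda>x. x $ _"] borel_measurable_continuous_onI continuous_intros)
  have form: "x \<bullet> (A *v y) = (\<Sum>i\<in>UNIV. x $ i * (\<Sum>j\<in>UNIV. A $ i $ j * y $ j))" for x y :: "real ^ 'r" and A
    by (simp add: inner_vec_def matrix_vector_mult_def)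
  show ?thesis
    unfolding wald_statistic_def form by measurable
qed

end

section \<open>The linearised score equation\<close>

text \<open>Outside the ball all values exceed \<open>L \<beta>0\<close>, so a minimum over the
  compact ball is global. Existence matters as much as location, since the estimator is tied to
  minimisers only where they exist.\<close>

lemma argmin_near_if_separated:
  fixes L :: "real ^ 'p \<Rightarrow> real"
  assumes cont: "continuous_on UNIV L" and "\<epsilon> > 0"
    and sep: "\<And>\<beta>. norm (\<beta> - \<beta>0) \<ge> \<epsilon> \<Longrightarrow> L \<beta> > L \<beta>0"
  shows "\<exists>b. \<forall>\<beta>. L b \<le> L \<beta>" "(\<forall>\<beta>. L b \<le> L \<beta>) \<Longrightarrow> norm (b - \<beta>0) < \<epsilon>"
proof -
  obtain b1 where b1: "b1 \<in> cball \<beta>0 \<epsilon>" "\<And>\<beta>. \<beta> \<in> cball \<beta>0 \<epsilon> \<Longrightarrow> L b1 \<le> L \<beta>"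
    using continuous_attains_inf[OF compact_cball _ continuous_on_subset[OF cont subset_UNIV], of \<beta>0 \<epsilon>] \<open>\<epsilon> > 0\<close>
    by auto
  have "L b1 \<le> L \<beta>" for \<beta>
  proof (cases "\<beta> \<in> cball \<beta>0 \<epsilon>")
    case False
    then have "L \<beta>0 < L \<beta>" by (intro sep) (simp add: dist_norm norm_minus_commute)
    moreover have "L b1 \<le> L \<beta>0" using \<open>\<epsilon> > 0\<close> by (intro b1(2)) simp
    ultimately show ?thesis by simp
  qed (rule b1(2))
  then show "\<exists>b. \<forall>\<beta>. L b \<le> L \<beta>" by blast
  assume "\<forall>\<beta>. L b \<le> L \<beta>"
  then show "norm (b - \<beta>0) < \<epsilon>" using sep[of b] by (meson linorder_not_le)
qed

text \<open>The first-order condition along the line through \<open>b\<close> in direction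
  \<open>v\<close>.\<close>

lemma sum_loss_minimum_score:
  fixes b :: "real ^ 'p"
  assumes "l \<ge> 0" and min: "\<And>\<beta>. (\<Sum>i<n. loss l (x i \<bullet> b) (y i)) \<le> (\<Sum>i<n. loss l (x i \<bullet> \<beta>) (y i))"
  shows "(\<Sum>i<n. score l (x i \<bullet> b) (y i) * (x i \<bullet> v)) = 0"
proof -
  let ?f = "\<lambda>t. \<Sum>i<n. loss l (x i \<bullet> b + t * (x i \<bullet> v)) (y i)"
  have "(?f has_real_derivative (\<Sum>i<n. score l (x i \<bullet> b + 0 * (x i \<bullet> v)) (y i) * (x i \<bullet> v))) (at 0)"
  proof (rule DERIV_sum)
    fix i
    have "((\<lambda>t. x i \<bullet> b + t * (x i \<bullet> v)) has_real_derivative (x i \<bullet> v)) (at 0)"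
      by (auto intro!: derivative_eq_intros)
    from DERIV_chain2[OF DERIV_loss[OF \<open>l \<ge> 0\<close>] this]
    show "((\<lambda>t. loss l (x i \<bullet> b + t * (x i \<bullet> v)) (y i)) has_real_derivative
        score l (x i \<bullet> b + 0 * (x i \<bullet> v)) (y i) * (x i \<bullet> v)) (at 0)" .
  qed
  moreover have "?f 0 \<le> ?f t" for t
    using min[of "b + t *\<^sub>R v"] by (simp add: inner_add_right)
  ultimately have "(\<Sum>i<n. score l (x i \<bullet> b + 0 * (x i \<bullet> v)) (y i) * (x i \<bullet> v)) = 0"
    by (intro DERIV_local_min[of ?f _ 0 1]) auto
  then show ?thesis by simp
qed

context logistic_asymptotics
begin

abbreviation hess_at :: "'p \<Rightarrow> 'p \<Rightarrow> (real ^ 'p) \<times> real \<Rightarrow> real" where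
  "hess_at j k z \<equiv> score_deriv l (fst z \<bullet> \<beta>0) (snd z) * (fst z $ j * fst z $ k)"

abbreviation score_at :: "real ^ 'p \<Rightarrow> (real ^ 'p) \<times> real \<Rightarrow> real" where
  "score_at \<beta> z \<equiv> score l (fst z \<bullet> \<beta>) (snd z)"

text \<open>The gradient of the average loss at \<beta>0.\<close>

definition U :: "nat \<Rightarrow> 'a \<Rightarrow> real ^ 'p" where
  "U n \<omega> = (\<chi> j. avg (\<lambda>z. score_at \<beta>0 z * fst z $ j) n \<omega>)"

text \<open>Samples without a minimiser occur, such as separable data for \<open>l = 0\<close>;
  there \<open>b\<close> is arbitrary. \<open>whp_estimator\<close> shows that this is harmless in
  the limit.\<close>

definition estimating :: "(nat \<Rightarrow> 'a \<Rightarrow> real ^ 'p) \<Rightarrow> bool" where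
  "estimating b \<longleftrightarrow> (\<forall>n. AE \<omega> in P. (\<exists>b'. is_mdpde l n (\<lambda>i. X i \<omega>) (\<lambda>i. Y i \<omega>) b')
        \<longrightarrow> is_mdpde l n (\<lambda>i. X i \<omega>) (\<lambda>i. Y i \<omega>) (b n \<omega>))"

lemma estimator_near:
  assumes "n > 0" "\<epsilon> > 0"
    and sep: "\<forall>\<beta>. norm (\<beta> - \<beta>0) \<ge> \<epsilon> \<longrightarrow> avg (loss_at \<beta>) n \<omega> > avg (loss_at \<beta>0) n \<omega>"
    and bin: "\<forall>i. Y i \<omega> \<in> {0, 1}"
    and ex: "(\<exists>b'. is_mdpde l n (\<lambda>i. X i \<omega>) (\<lambda>i. Y i \<omega>) b') \<longrightarrow> is_mdpde l n (\<lambda>i. X i \<omega>) (\<lambda>i. Y i \<omega>) b"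
  shows "norm (b - \<beta>0) < \<epsilon>" "avg (\<lambda>z. score_at b z * fst z $ j) n \<omega> = 0"
proof -
  define L where "L \<beta> = (\<Sum>i<n. loss l (X i \<omega> \<bullet> \<beta>) (Y i \<omega>))" for \<beta>
  have avg_L: "avg (loss_at \<beta>) n \<omega> = L \<beta> / real n" for \<beta>
    by (simp add: avg_def L_def Z_def)
  have sepL: "L \<beta> > L \<beta>0" if "norm (\<beta> - \<beta>0) \<ge> \<epsilon>" for \<beta>
    using sep that \<open>n > 0\<close> by (simp add: avg_L divide_less_cancel)
  have cl: "continuous_on UNIV (\<lambda>s. loss l s y)" for y
    using DERIV_isCont[OF DERIV_loss[OF lambda]] by (simp add: continuous_at_imp_continuous_on)
  have "continuous_on UNIV (\<lambda>\<beta>. loss l (x \<bullet> \<beta>) y)" for x :: "real ^ 'p" and y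
    by (rule continuous_on_compose2[OF cl]) (intro continuous_intros, simp)
  then have "continuous_on UNIV L"
    unfolding L_def by (rule continuous_on_sum)
  note near = argmin_near_if_separated[OF this \<open>\<epsilon> > 0\<close> sepL]
  have mdpde: "is_mdpde l n (\<lambda>i. X i \<omega>) (\<lambda>i. Y i \<omega>) b' \<longleftrightarrow> (\<forall>\<beta>. L b' \<le> L \<beta>)" for b'
    using bin unfolding L_def by (intro is_mdpde_iff lambda \<open>n > 0\<close>) auto
  have min: "\<forall>\<beta>. L b \<le> L \<beta>" using mp[OF ex] near(1) unfolding mdpde by simp
  then show "norm (b - \<beta>0) < \<epsilon>" by (rule near(2)[rotated])
  have "(\<Sum>i<n. score l (X i \<omega> \<bullet> b) (Y i \<omega>) * (X i \<omega> \<bullet> axis j 1)) = 0"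
    using min unfolding L_def by (intro sum_loss_minimum_score lambda) auto
  then show "avg (\<lambda>z. score_at b z * fst z $ j) n \<omega> = 0"
    by (simp add: avg_def Z_def inner_axis)
qed

lemma whp_estimator:
  assumes est: "estimating b" and "\<epsilon> > 0"
  shows "whp (\<lambda>n \<omega>. norm (b n \<omega> - \<beta>0) < \<epsilon> \<and> (\<forall>j. avg (\<lambda>z. score_at (b n \<omega>) z * fst z $ j) n \<omega> = 0)
    \<and> (\<forall>i. Y i \<omega> \<in> {0, 1}))"
proof -
  have "whp (\<lambda>n \<omega>. (\<exists>b'. is_mdpde l n (\<lambda>i. X i \<omega>) (\<lambda>i. Y i \<omega>) b') \<longrightarrow> is_mdpde l n (\<lambda>i. X i \<omega>) (\<lambda>i. Y i \<omega>) (b n \<omega>))"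
    using est by (intro whp_AE) (simp add: estimating_def)
  from whp_conj[OF whp_loss_separated[OF \<open>\<epsilon> > 0\<close>] whp_conj[OF whp_binary this]]
  show ?thesis
    by (rule whp_mono_eventually, intro eventually_mono[OF eventually_gt_at_top[of 0]] ballI impI)
       (elim conjE, intro conjI allI estimator_near[OF _ \<open>\<epsilon> > 0\<close>]; blast)
qed

section \<open>Moments and limit law of the score at the true parameter\<close>

lemma measurable_compose_fst [measurable]: "(\<lambda>z :: (real ^ 'p) \<times> real. f (fst z)) \<in> borel_measurable borel"
  if "f \<in> borel_measurable borel" for f :: "real ^ 'p \<Rightarrow> real"
  using that by (rule measurable_compose[OF fst_snd_measurable(1)])

lemma score_at_eq: "score_at \<beta>0 z = - (noise z * score_weight l (fst z \<bullet> \<beta>0))"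
proof -
  have "score_at \<beta>0 z = - (score_weight l (fst z \<bullet> \<beta>0) * noise z)"
    unfolding score_def noise_def mult_minus_right[symmetric] minus_diff_eq ..
  then show ?thesis by (simp only: mult.commute)
qed

lemma score_weight_H_measurable [measurable]: "(\<lambda>x :: real ^ 'p. score_weight l (x \<bullet> \<beta>0)) \<in> borel_measurable borel"
  unfolding score_weight_def by measurable

lemma inner_int: "integrable H (\<lambda>x. x \<bullet> u)"
proof (rule Bochner_Integration.integrable_bound)
  show "integrable H (\<lambda>x. norm x * norm u)" using norm_int by simp
  show "AE x in H. norm (x \<bullet> u) \<le> norm (norm x * norm u)"
    using Cauchy_Schwarz_ineq2[of _ u] by (intro AE_I2) simp
qed (simp add: measurable_H)

text \<open>The score is noise times a function of the covariate, hence centred, and the conditional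
  variance of the noise turns its second moment into the quadratic form of \<open>K\<close>.\<close>

lemma score_moments:
  shows "integrable D (\<lambda>z. score_at \<beta>0 z * (fst z \<bullet> u))"
    "integral\<^sup>L D (\<lambda>z. score_at \<beta>0 z * (fst z \<bullet> u)) = 0"
    "integrable D (\<lambda>z. (score_at \<beta>0 z * (fst z \<bullet> u))\<^sup>2)"
    "integral\<^sup>L D (\<lambda>z. (score_at \<beta>0 z * (fst z \<bullet> u))\<^sup>2) = u \<bullet> (K_mat H l \<beta>0 *v u)"
proof -
  define f where "f x = - (score_weight l (x \<bullet> \<beta>0) * (x \<bullet> u))" for x
  have f_meas[measurable]: "f \<in> borel_measurable borel" unfolding f_def by measurable
  have f_le: "\<bar>f x\<bar> \<le> \<bar>x \<bullet> u\<bar>" for x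
    using score_weight_le_1[OF lambda, of "x \<bullet> \<beta>0"] score_weight_pos[of l "x \<bullet> \<beta>0"]
    by (simp add: f_def abs_mult mult_left_le_one_le)
  have f: "integrable H f"
    using f_le by (intro Bochner_Integration.integrable_bound[OF inner_int[of u]] AE_I2) (auto simp: measurable_H)
  have eq: "score_at \<beta>0 z * (fst z \<bullet> u) = noise z * f (fst z)" for z
    by (simp add: score_at_eq f_def)
  show "integrable D (\<lambda>z. score_at \<beta>0 z * (fst z \<bullet> u))" "integral\<^sup>L D (\<lambda>z. score_at \<beta>0 z * (fst z \<bullet> u)) = 0"
    unfolding eq using integral_noise[OF f] by auto
  have "(\<lambda>z. f (fst z)) \<in> borel_measurable (borel :: ((real ^ 'p) \<times> real) measure)"
    by (rule measurable_compose_fst[OF f_meas])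
  then have meas: "(\<lambda>z. (noise z * f (fst z))\<^sup>2) \<in> borel_measurable borel" by measurable
  have f2: "integrable H (\<lambda>x. (f x)\<^sup>2)"
  proof (rule Bochner_Integration.integrable_bound)
    show "integrable H (\<lambda>x. (norm u)\<^sup>2 * (norm x)\<^sup>2)" using second_moment by simp
    have "(f x)\<^sup>2 \<le> (norm u)\<^sup>2 * (norm x)\<^sup>2" for x
    proof -
      have "\<bar>f x\<bar> \<le> norm u * norm x" using f_le[of x] Cauchy_Schwarz_ineq2[of x u] by (simp add: mult.commute)
      then have "\<bar>f x\<bar>\<^sup>2 \<le> (norm u * norm x)\<^sup>2" by (intro power_mono) auto
      then show ?thesis by (simp add: power_mult_distrib)
    qed
    then show "AE x in H. norm ((f x)\<^sup>2) \<le> norm ((norm u)\<^sup>2 * (norm x)\<^sup>2)" by (intro AE_I2) simp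
  qed (simp add: measurable_H)
  have i: "integrable H (\<lambda>x. (noise (x, c) * f (fst (x, c)))\<^sup>2)" if "c \<in> {0, 1}" for c :: real
  proof (rule Bochner_Integration.integrable_bound[OF f2])
    have "(noise (x, c))\<^sup>2 \<le> 1" for x using noise_abs_le[of "(x, c)"] that by (simp add: abs_square_le_1)
    then show "AE x in H. norm ((noise (x, c) * f (fst (x, c)))\<^sup>2) \<le> norm ((f x)\<^sup>2)"
      by (intro AE_I2) (simp add: power_mult_distrib mult_left_le_one_le)
    have "(\<lambda>x :: real ^ 'p. noise (x, c)) \<in> borel_measurable borel" unfolding noise_def by simp
    then show "(\<lambda>x. (noise (x, c) * f (fst (x, c)))\<^sup>2) \<in> borel_measurable H" by (simp add: measurable_H)
  qed
  have i1: "integrable H (\<lambda>x. (noise (x, 1) * f (fst (x, 1 :: real)))\<^sup>2)" by (rule i) simp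
  have i0: "integrable H (\<lambda>x. (noise (x, 0) * f (fst (x, 0 :: real)))\<^sup>2)" by (rule i) simp
  show "integrable D (\<lambda>z. (score_at \<beta>0 z * (fst z \<bullet> u))\<^sup>2)"
    unfolding eq using integral_D(2)[OF meas i1 i0] .
  \<comment> \<open>The Bernoulli variance:
    \<open>(1 - p)^2 * p + p^2 * (1 - p) = p * (1 - p)\<close>.\<close>
  have w: "(noise (x, 1) * f (fst (x, 1 :: real)))\<^sup>2 * mean0 x + (noise (x, 0) * f (fst (x, 0 :: real)))\<^sup>2 * (1 - mean0 x)
      = K_weight (x \<bullet> \<beta>0) * ((x \<bullet> u) * (x \<bullet> u))" for x
    by (simp add: noise_def f_def K_weight_def power2_eq_square) algebra
  show "integral\<^sup>L D (\<lambda>z. (score_at \<beta>0 z * (fst z \<bullet> u))\<^sup>2) = u \<bullet> (K_mat H l \<beta>0 *v u)"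
    unfolding eq integral_D(1)[OF meas i1 i0] w K_mat_eq gram_form(1)[OF K_gram] ..
qed

lemma U_inner: "U n \<omega> \<bullet> u = avg (\<lambda>z. score_at \<beta>0 z * (fst z \<bullet> u)) n \<omega>"
proof -
  have iu: "x \<bullet> u = (\<Sum>j\<in>UNIV. u $ j * x $ j)" for x
    by (simp add: inner_vec_def mult.commute)
  have "U n \<omega> \<bullet> u = (\<Sum>j\<in>UNIV. avg (\<lambda>z. u $ j * (score_at \<beta>0 z * fst z $ j)) n \<omega>)"
    unfolding avg_cmult iu by (simp add: U_def)
  also have "\<dots> = avg (\<lambda>z. score_at \<beta>0 z * (fst z \<bullet> u)) n \<omega>"
    unfolding avg_sum[symmetric] iu sum_distrib_left by (simp only: mult_ac)
  finally show ?thesis .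
qed

lemma U_measurable: "(\<lambda>\<omega>. U n \<omega> \<bullet> u) \<in> borel_measurable P"
  unfolding U_inner using integrable_avg[OF score_moments(1)] by auto

text \<open>As in the Cramer-Wold device, each direction \<open>u\<close> gives a scalar central
  limit theorem. Direction 0 is split off because that theorem asks for positive variance.\<close>

lemma score_characteristic_tendsto:
  "(\<lambda>n. \<integral>\<omega>. iexp (sqrt (real n) * (U n \<omega> \<bullet> u)) \<partial>P) \<longlonglongrightarrow> of_real (exp (- (u \<bullet> (K_mat H l \<beta>0 *v u)) / 2))"
proof (cases "u = 0")
  case True
  then show ?thesis by (simp add: prob_space)
next
  case False
  define \<sigma> where "\<sigma> = sqrt (u \<bullet> (K_mat H l \<beta>0 *v u))"
  have pos: "u \<bullet> (K_mat H l \<beta>0 *v u) > 0"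
    unfolding K_mat_eq by (rule gram_pos[OF K_gram weights_pos(2) False])
  then have \<sigma>: "\<sigma> > 0" "\<sigma>\<^sup>2 = u \<bullet> (K_mat H l \<beta>0 *v u)" by (auto simp: \<sigma>_def)
  define f where "f z = score_at \<beta>0 z * (fst z \<bullet> u)" for z
  have f: "integrable D f" "integral\<^sup>L D f = 0" "integrable D (\<lambda>z. (f z)\<^sup>2)" "integral\<^sup>L D (\<lambda>z. (f z)\<^sup>2) = \<sigma>\<^sup>2"
    using score_moments[of u] unfolding f_def \<sigma>(2) by auto
  have f_meas: "f \<in> borel_measurable D" using f(1) by auto
  have f2_meas: "(\<lambda>z. (f z)\<^sup>2) \<in> borel_measurable D" using f(3) by auto
  have fZ[measurable]: "(\<lambda>\<omega>. f (Z i \<omega>)) \<in> borel_measurable P" for i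
    using measurable_compose[OF Z_measurable f_meas] .
  define F where "F n = distr P borel (\<lambda>\<omega>. (\<Sum>i<n. f (Z i \<omega>)) / sqrt (real n * \<sigma>\<^sup>2))" for n
  have "weak_conv_m F std_normal_distribution"
    unfolding F_def
  proof (rule central_limit_theorem_zero_mean)
    show "indep_vars (\<lambda>i. borel) (\<lambda>i \<omega>. f (Z i \<omega>)) UNIV"
      by (rule indep_vars_compose2[OF indep_Z]) (rule f_meas)
    show mean: "expectation (\<lambda>\<omega>. f (Z i \<omega>)) = 0" for i using integral_Z[OF f_meas, of i] f(2) by simp
    show "integrable P (\<lambda>\<omega>. (f (Z i \<omega>))\<^sup>2)" for i by (rule integrable_Z[OF f(3)])
    show "expectation (\<lambda>\<omega>. (f (Z i \<omega>) - expectation (\<lambda>\<omega>. f (Z i \<omega>)))\<^sup>2) = \<sigma>\<^sup>2" for i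
      unfolding mean using integral_Z[OF f2_meas, of i] f(4) by simp
    show "distr P borel (\<lambda>\<omega>. f (Z i \<omega>)) = distr D borel f" for i
      using distr_distr[OF f_meas Z_measurable, of i] by (simp add: distr_Z comp_def)
    show "\<sigma> > 0" by (rule \<sigma>)
  qed
  \<comment> \<open>Evaluating the characteristic functions at \<sigma> undoes the normalisation to
    unit variance.\<close>
  then have lim: "(\<lambda>n. char (F n) \<sigma>) \<longlonglongrightarrow> char std_normal_distribution \<sigma>"
    by (rule levy_continuity1[rotated 2]) (simp_all add: F_def real_distribution_std_normal)
  have "\<forall>\<^sub>F n in sequentially. char (F n) \<sigma> = (\<integral>\<omega>. iexp (sqrt (real n) * (U n \<omega> \<bullet> u)) \<partial>P)"
    using eventually_gt_at_top[of 0]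
  proof eventually_elim
    case (elim n)
    have eq: "\<sigma> * ((\<Sum>i<n. f (Z i \<omega>)) / sqrt (real n * \<sigma>\<^sup>2)) = sqrt (real n) * (U n \<omega> \<bullet> u)" for \<omega>
    proof -
      have "sqrt (real n * \<sigma>\<^sup>2) = sqrt (real n) * \<sigma>" using \<sigma>(1) by (simp add: real_sqrt_mult)
      moreover have "real n = sqrt (real n) * sqrt (real n)" by simp
      ultimately show ?thesis unfolding U_inner f_def[symmetric] avg_def using \<sigma>(1) elim
        by (simp add: field_simps)
    qed
    have "char (F n) \<sigma> = (\<integral>\<omega>. iexp (\<sigma> * ((\<Sum>i<n. f (Z i \<omega>)) / sqrt (real n * \<sigma>\<^sup>2))) \<partial>P)"
      unfolding char_def F_def by (subst integral_distr) auto
    then show ?case unfolding eq .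
  qed
  from Lim_transform_eventually[OF lim this] show ?thesis
    by (simp add: char_std_normal_distribution \<sigma>(2))
qed

lemma expectation_score_square:
  assumes "n > 0"
  shows "integrable P (\<lambda>\<omega>. real n * (U n \<omega> \<bullet> u)\<^sup>2)"
    "expectation (\<lambda>\<omega>. real n * (U n \<omega> \<bullet> u)\<^sup>2) = u \<bullet> (K_mat H l \<beta>0 *v u)"
proof -
  define f where "f z = score_at \<beta>0 z * (fst z \<bullet> u)" for z
  have f: "integrable D f" "integral\<^sup>L D f = 0" "integrable D (\<lambda>z. (f z)\<^sup>2)" "integral\<^sup>L D (\<lambda>z. (f z)\<^sup>2) = u \<bullet> (K_mat H l \<beta>0 *v u)"
    using score_moments[of u] unfolding f_def by auto
  have eq: "real n * (U n \<omega> \<bullet> u)\<^sup>2 = (\<Sum>i<n. f (Z i \<omega>))\<^sup>2 / real n" for \<omega>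
    unfolding U_inner f_def[symmetric] avg_def using assms by (simp add: power2_eq_square)
  show "integrable P (\<lambda>\<omega>. real n * (U n \<omega> \<bullet> u)\<^sup>2)"
    unfolding eq using expectation_sum_square(2)[OF f(1,3,2)] by simp
  show "expectation (\<lambda>\<omega>. real n * (U n \<omega> \<bullet> u)\<^sup>2) = u \<bullet> (K_mat H l \<beta>0 *v u)"
    unfolding eq using expectation_sum_square(1)[OF f(1,3,2), of n] f(4) assms by simp
qed

section \<open>The Hessian at the true parameter and the remainder of the score equation\<close>

lemma score_deriv_mean_affine:
  "score_deriv l s 1 * q + score_deriv l s 0 * (1 - q) = score_deriv l s q"
  unfolding score_deriv_def by algebra

lemma score_deriv_measurable: "(\<lambda>s. score_deriv l s y) \<in> borel_measurable borel"
  unfolding score_deriv_def score_weight_def logistic_def by measurable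

text \<open>A law of large numbers whose mean is \<open>J\<close>: the term of
  \<open>score_deriv\<close> that carries the residual has conditional mean zero, and the
  \<open>J_weight\<close> term remains.\<close>

lemma whp_hessian:
  assumes "\<eta> > 0"
  shows "whp (\<lambda>n \<omega>. \<bar>avg (hess_at j k) n \<omega> - J_mat H l \<beta>0 $ j $ k\<bar> < \<eta>)"
proof -
  obtain C where C: "C \<ge> 0" "\<And>y s. y \<in> {0, 1} \<Longrightarrow> \<bar>score_deriv l s y\<bar> \<le> C"
    using score_divided_difference[OF lambda] by metis
  define g where "g = hess_at j k"
  have g_meas: "g \<in> borel_measurable borel"
  proof -
    have [measurable]: "(\<lambda>z :: (real ^ 'p) \<times> real. fst z \<bullet> \<beta>0) \<in> borel_measurable borel"
      "(\<lambda>z :: (real ^ 'p) \<times> real. fst z $ i) \<in> borel_measurable borel" for i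
      by (rule measurable_compose_fst; measurable)+
    have [measurable]: "logistic \<in> borel_measurable borel"
      by (auto intro!: borel_measurable_continuous_onI continuous_at_imp_continuous_on DERIV_isCont[OF DERIV_logistic])
    show ?thesis unfolding g_def score_deriv_def score_weight_def by measurable
  qed
  have i: "integrable H (\<lambda>x. g (x, c))" if "c \<in> {0, 1}" for c
  proof (rule Bochner_Integration.integrable_bound)
    show "integrable H (\<lambda>x. C * (norm x)\<^sup>2)" using second_moment by simp
    have "\<bar>g (x, c)\<bar> \<le> C * (norm x * norm x)" for x
      unfolding g_def abs_mult fst_conv snd_conv using C that
      by (intro mult_mono component_le_norm_cart) auto
    then show "AE x in H. norm (g (x, c)) \<le> norm (C * (norm x)\<^sup>2)"
      using C(1) by (intro AE_I2) (simp add: power2_eq_square)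
    show "(\<lambda>x. g (x, c)) \<in> borel_measurable H"
      unfolding g_def fst_conv snd_conv using measurable_compose[OF _ score_deriv_measurable[of c], of "\<lambda>x. x \<bullet> \<beta>0" borel]
      by (simp add: measurable_H)
  qed
  have i1: "integrable H (\<lambda>x. g (x, 1))" and i0: "integrable H (\<lambda>x. g (x, 0))" using i by auto
  have w: "g (x, 1) * mean0 x + g (x, 0) * (1 - mean0 x) = J_weight (x \<bullet> \<beta>0) * (x $ j * x $ k)" for x
  proof -
    have "g (x, 1) * mean0 x + g (x, 0) * (1 - mean0 x)
        = (score_deriv l (x \<bullet> \<beta>0) 1 * mean0 x + score_deriv l (x \<bullet> \<beta>0) 0 * (1 - mean0 x)) * (x $ j * x $ k)"
      by (simp add: g_def algebra_simps)
    then show ?thesis by (simp only: score_deriv_mean_affine score_deriv_mean J_weight_def)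
  qed
  have "integral\<^sup>L D g = J_mat H l \<beta>0 $ j $ k"
    unfolding integral_D(1)[OF g_meas i1 i0] w J_mat_eq gram_component(1)[OF J_gram] ..
  then show ?thesis
    using weak_law_of_large_numbers[OF integral_D(2)[OF g_meas i1 i0] assms] unfolding g_def by simp
qed

text \<open>The integrand tends to 0 with \<open>r\<close> and is at most
  \<open>C * (norm x)^2\<close>, so its mean can be made small; the law of large numbers transfers
  this to the sample.\<close>

lemma whp_small_remainder:
  assumes "\<eta> > 0" "C \<ge> 0"
  obtains r where "r > 0" "whp (\<lambda>n \<omega>. avg (\<lambda>z. C * min 1 (r * norm (fst z)) * (norm (fst z))\<^sup>2) n \<omega> < \<eta>)"
proof -
  define f where "f m x = C * min 1 (inverse (real (Suc m)) * norm x) * (norm x)\<^sup>2" for m and x :: "real ^ 'p"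
  have f_meas[measurable]: "f m \<in> borel_measurable borel" for m unfolding f_def by measurable
  have f_le: "\<bar>f m x\<bar> \<le> C * (norm x)\<^sup>2" for m x
    using assms(2) by (simp add: f_def abs_mult mult_left_le mult_right_mono)
  have "(\<lambda>m. integral\<^sup>L H (f m)) \<longlonglongrightarrow> (\<integral>x. 0 \<partial>H)"
  proof (rule integral_dominated_convergence)
    show "integrable H (\<lambda>x. C * (norm x)\<^sup>2)" using second_moment by simp
    have "(\<lambda>m. f m x) \<longlonglongrightarrow> C * min 1 (0 * norm x) * (norm x)\<^sup>2" for x
      unfolding f_def by (intro tendsto_intros LIMSEQ_inverse_real_of_nat)
    then show "AE x in H. (\<lambda>m. f m x) \<longlonglongrightarrow> 0" by (intro AE_I2) simp
    show "AE x in H. norm (f m x) \<le> C * (norm x)\<^sup>2" for m using f_le by (intro AE_I2) simp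
  qed (auto simp: measurable_H)
  then have "\<forall>\<^sub>F m in sequentially. integral\<^sup>L H (f m) < \<eta> / 2"
    using assms(1) by (intro order_tendstoD) auto
  then obtain m where m: "integral\<^sup>L H (f m) < \<eta> / 2" by (auto simp: eventually_sequentially)
  have "integrable H (f m)"
  proof (rule Bochner_Integration.integrable_bound)
    show "integrable H (\<lambda>x. C * (norm x)\<^sup>2)" using second_moment by simp
    show "AE x in H. norm (f m x) \<le> norm (C * (norm x)\<^sup>2)"
    proof (rule AE_I2)
      fix x
      have "\<bar>f m x\<bar> \<le> \<bar>C * (norm x)\<^sup>2\<bar>" using f_le[of m x] by (rule order.trans) (rule abs_ge_self)
      then show "norm (f m x) \<le> norm (C * (norm x)\<^sup>2)" by (simp only: real_norm_def)
    qed
  qed (simp add: measurable_H)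
  from integral_D_fst[OF this]
  have "whp (\<lambda>n \<omega>. \<bar>avg (\<lambda>z. f m (fst z)) n \<omega> - integral\<^sup>L H (f m)\<bar> < \<eta> / 2)"
    using weak_law_of_large_numbers[of "\<lambda>z. f m (fst z)" "\<eta> / 2"] assms(1) by simp
  then have "whp (\<lambda>n \<omega>. avg (\<lambda>z. f m (fst z)) n \<omega> < \<eta>)"
    by (rule whp_mono) (use m in linarith)
  then show ?thesis by (intro that[of "inverse (real (Suc m))"]) (simp_all add: f_def)
qed

text \<open>The score equation, linearised with divided differences of the score instead of a Taylor remainder.\<close>
lemma whp_linearization:
  assumes est: "estimating b" and "\<eta> > 0"
  shows "whp (\<lambda>n \<omega>. norm (b n \<omega> - \<beta>0) < \<eta> \<and>
    (\<exists>A. (\<forall>j k. \<bar>A $ j $ k - J_mat H l \<beta>0 $ j $ k\<bar> < \<eta>) \<and> A *v (b n \<omega> - \<beta>0) = - U n \<omega>))"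
proof -
  obtain C where C: "C \<ge> 0" "\<And>y s t. y \<in> {0, 1} \<Longrightarrow>
      \<exists>c. score l s y - score l t y = c * (s - t) \<and> \<bar>c - score_deriv l t y\<bar> \<le> C * min 1 \<bar>s - t\<bar>"
    using score_divided_difference[OF lambda] by metis
  have "\<eta> / 2 > 0" using \<open>\<eta> > 0\<close> by simp
  obtain r where r: "r > 0" "whp (\<lambda>n \<omega>. avg (\<lambda>z. C * min 1 (r * norm (fst z)) * (norm (fst z))\<^sup>2) n \<omega> < \<eta> / 2)"
    using whp_small_remainder[OF \<open>\<eta> / 2 > 0\<close> C(1)] by blast
  have "whp (\<lambda>n \<omega>. \<forall>j\<in>UNIV. \<forall>k\<in>UNIV. \<bar>avg (hess_at j k) n \<omega>
      - J_mat H l \<beta>0 $ j $ k\<bar> < \<eta> / 2)"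
    by (intro whp_finite_Ball whp_hessian \<open>\<eta> / 2 > 0\<close>) auto
  moreover have "min r \<eta> > 0" using r(1) \<open>\<eta> > 0\<close> by simp
  ultimately have "whp (\<lambda>n \<omega>. ((norm (b n \<omega> - \<beta>0) < min r \<eta> \<and> (\<forall>j. avg (\<lambda>z. score_at (b n \<omega>) z * fst z $ j) n \<omega> = 0)
    \<and> (\<forall>i. Y i \<omega> \<in> {0, 1})) \<and> (\<forall>j\<in>UNIV. \<forall>k\<in>UNIV. \<bar>avg (hess_at j k) n \<omega>
      - J_mat H l \<beta>0 $ j $ k\<bar> < \<eta> / 2)) \<and> avg (\<lambda>z. C * min 1 (r * norm (fst z)) * (norm (fst z))\<^sup>2) n \<omega> < \<eta> / 2)"
    by (intro whp_conj whp_estimator est r(2))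
  then show ?thesis
  proof (rule whp_mono, elim conjE)
    fix n \<omega>
    assume near: "norm (b n \<omega> - \<beta>0) < min r \<eta>"
      and score: "\<forall>j. avg (\<lambda>z. score_at (b n \<omega>) z * fst z $ j) n \<omega> = 0"
      and bin: "\<forall>i. Y i \<omega> \<in> {0, 1}"
      and hess: "\<forall>j\<in>UNIV. \<forall>k\<in>UNIV. \<bar>avg (hess_at j k) n \<omega>
          - J_mat H l \<beta>0 $ j $ k\<bar> < \<eta> / 2"
      and rem: "avg (\<lambda>z. C * min 1 (r * norm (fst z)) * (norm (fst z))\<^sup>2) n \<omega> < \<eta> / 2"
    define \<delta> where "\<delta> = b n \<omega> - \<beta>0"
    \<comment> \<open>The slope is obtained as a witness, since a difference quotient carries no
      information where \<open>X i \<omega> \<bullet> \<delta> = 0\<close>.\<close>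
    have "\<forall>i. \<exists>c. score l (X i \<omega> \<bullet> b n \<omega>) (Y i \<omega>) - score l (X i \<omega> \<bullet> \<beta>0) (Y i \<omega>) = c * (X i \<omega> \<bullet> \<delta>)
        \<and> \<bar>c - score_deriv l (X i \<omega> \<bullet> \<beta>0) (Y i \<omega>)\<bar> \<le> C * min 1 \<bar>X i \<omega> \<bullet> \<delta>\<bar>"
      using C(2)[of "Y _ \<omega>" "X _ \<omega> \<bullet> b n \<omega>" "X _ \<omega> \<bullet> \<beta>0"] bin by (simp add: \<delta>_def inner_diff_right)
    then obtain c where c: "\<And>i. score l (X i \<omega> \<bullet> b n \<omega>) (Y i \<omega>) - score l (X i \<omega> \<bullet> \<beta>0) (Y i \<omega>) = c i * (X i \<omega> \<bullet> \<delta>)"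
        "\<And>i. \<bar>c i - score_deriv l (X i \<omega> \<bullet> \<beta>0) (Y i \<omega>)\<bar> \<le> C * min 1 \<bar>X i \<omega> \<bullet> \<delta>\<bar>" by metis
    \<comment> \<open>With the exact slopes \<open>c i\<close> in place of second derivatives, the
      expansion of the score has no remainder; the whole error sits in \<open>A\<close>.\<close>
    define A :: "real ^ 'p ^ 'p" where "A = (\<chi> j k. (\<Sum>i<n. c i * (X i \<omega> $ j * X i \<omega> $ k)) / real n)"
    have "\<bar>A $ j $ k - J_mat H l \<beta>0 $ j $ k\<bar> < \<eta>" for j k
    proof -
      have "A $ j $ k - avg (hess_at j k) n \<omega>
          = (\<Sum>i<n. (c i - score_deriv l (X i \<omega> \<bullet> \<beta>0) (Y i \<omega>)) * (X i \<omega> $ j * X i \<omega> $ k)) / real n"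
        by (simp add: A_def avg_def Z_def sum_subtractf left_diff_distrib diff_divide_distrib)
      also have "\<bar>\<dots>\<bar> \<le> (\<Sum>i<n. C * min 1 (r * norm (X i \<omega>)) * (norm (X i \<omega>))\<^sup>2) / real n"
        unfolding abs_divide abs_of_nat
      proof (intro divide_right_mono order.trans[OF sum_abs] sum_mono)
        fix i
        have "\<bar>X i \<omega> \<bullet> \<delta>\<bar> \<le> norm (X i \<omega>) * norm \<delta>" by (rule Cauchy_Schwarz_ineq2)
        also have "\<dots> \<le> norm (X i \<omega>) * r" using near by (intro mult_left_mono) (auto simp: \<delta>_def)
        finally have "min 1 \<bar>X i \<omega> \<bullet> \<delta>\<bar> \<le> min 1 (r * norm (X i \<omega>))" by (simp add: mult.commute min_le_iff_disj)
        then have "C * min 1 \<bar>X i \<omega> \<bullet> \<delta>\<bar> \<le> C * min 1 (r * norm (X i \<omega>))" using C(1) by (rule mult_left_mono)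
        with c(2)[of i] have "\<bar>c i - score_deriv l (X i \<omega> \<bullet> \<beta>0) (Y i \<omega>)\<bar> \<le> C * min 1 (r * norm (X i \<omega>))" by linarith
        moreover have "\<bar>X i \<omega> $ j\<bar> * \<bar>X i \<omega> $ k\<bar> \<le> norm (X i \<omega>) * norm (X i \<omega>)"
          by (intro mult_mono component_le_norm_cart) auto
        ultimately have "\<bar>c i - score_deriv l (X i \<omega> \<bullet> \<beta>0) (Y i \<omega>)\<bar> * (\<bar>X i \<omega> $ j\<bar> * \<bar>X i \<omega> $ k\<bar>)
            \<le> (C * min 1 (r * norm (X i \<omega>))) * (norm (X i \<omega>) * norm (X i \<omega>))"
          using C(1) r(1) by (rule_tac mult_mono) auto
        then show "\<bar>(c i - score_deriv l (X i \<omega> \<bullet> \<beta>0) (Y i \<omega>)) * (X i \<omega> $ j * X i \<omega> $ k)\<bar>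
            \<le> C * min 1 (r * norm (X i \<omega>)) * (norm (X i \<omega>))\<^sup>2"
          by (simp add: abs_mult power2_eq_square)
      qed simp
      also have "\<dots> < \<eta> / 2" using rem by (simp add: avg_def Z_def)
      finally have "\<bar>A $ j $ k - avg (hess_at j k) n \<omega>\<bar> < \<eta> / 2" .
      moreover have "\<bar>avg (hess_at j k) n \<omega> - J_mat H l \<beta>0 $ j $ k\<bar> < \<eta> / 2"
        using hess by blast
      ultimately show ?thesis by linarith
    qed
    moreover have "A *v \<delta> = - U n \<omega>"
      unfolding vec_eq_iff
    proof
      fix j
      have "(A *v \<delta>) $ j = (\<Sum>k\<in>UNIV. \<Sum>i<n. c i * X i \<omega> $ j * (X i \<omega> $ k * \<delta> $ k) / real n)"
        by (simp add: A_def matrix_vector_mult_def sum_divide_distrib sum_distrib_right sum_distrib_left mult_ac)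
      also have "\<dots> = (\<Sum>i<n. c i * (X i \<omega> \<bullet> \<delta>) * X i \<omega> $ j / real n)"
        by (subst sum.swap) (simp add: inner_vec_def sum_distrib_left sum_distrib_right sum_divide_distrib mult_ac)
      also have "\<dots> = avg (\<lambda>z. score_at (b n \<omega>) z * fst z $ j) n \<omega> - avg (\<lambda>z. score_at \<beta>0 z * fst z $ j) n \<omega>"
        unfolding c(1)[symmetric] by (simp add: avg_def Z_def left_diff_distrib sum_subtractf diff_divide_distrib sum_divide_distrib)
      also have "\<dots> = (- U n \<omega>) $ j" using score by (simp add: U_def)
      finally show "(A *v \<delta>) $ j = (- U n \<omega>) $ j" .
    qed
    ultimately show "norm (b n \<omega> - \<beta>0) < \<eta> \<and>
      (\<exists>A. (\<forall>j k. \<bar>A $ j $ k - J_mat H l \<beta>0 $ j $ k\<bar> < \<eta>) \<and> A *v (b n \<omega> - \<beta>0) = - U n \<omega>)"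
      using near unfolding \<delta>_def by auto
  qed
qed

end

section \<open>The Wald statistic\<close>

lemma inner_transpose_mult:
  fixes A :: "real ^ 'm ^ 'n"
  shows "u \<bullet> (transpose A *v w) = (A *v u) \<bullet> w"
  by (metis dot_lmul_matrix inner_commute vector_transpose_matrix transpose_transpose)

lemma norm_matrix_less:
  fixes A :: "real ^ 'n ^ 'm"
  assumes "\<And>i j. \<bar>A $ i $ j\<bar> < d / (real CARD('m) * real CARD('n))"
  shows "norm A < d"
proof -
  have "norm A \<le> (\<Sum>i\<in>UNIV. norm (A $ i))" by (simp add: norm_vec_def L2_set_le_sum)
  also have "\<dots> \<le> (\<Sum>i\<in>UNIV. \<Sum>j\<in>UNIV. \<bar>A $ i $ j\<bar>)" by (intro sum_mono norm_le_l1_cart)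
  also have "\<dots> < (\<Sum>i\<in>(UNIV :: 'm set). \<Sum>j\<in>(UNIV :: 'n set). d / (real CARD('m) * real CARD('n)))"
    by (intro sum_strict_mono assms) auto
  also have "\<dots> = d" by simp
  finally show ?thesis .
qed

text \<open>Each product of two coordinates is at most half the sum of their squares; summing over
  the other index yields the factor \<open>CARD('n)\<close>.\<close>

lemma abs_quadratic_form_le:
  fixes A :: "real ^ 'n ^ 'n"
  assumes A: "\<And>i j. \<bar>A $ i $ j\<bar> \<le> \<eta>" and "\<eta> \<ge> 0"
  shows "\<bar>v \<bullet> (A *v v)\<bar> \<le> \<eta> * real CARD('n) * (\<Sum>i\<in>UNIV. (v $ i)\<^sup>2)"
proof -
  have "v \<bullet> (A *v v) = (\<Sum>i\<in>UNIV. \<Sum>j\<in>UNIV. v $ i * (A $ i $ j * v $ j))"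
    by (simp add: inner_vec_def matrix_vector_mult_def sum_distrib_left)
  also have "\<bar>\<dots>\<bar> \<le> (\<Sum>i\<in>UNIV. \<Sum>j\<in>UNIV. \<eta> * (((v $ i)\<^sup>2 + (v $ j)\<^sup>2) / 2))"
  proof (intro order.trans[OF sum_abs] sum_mono order.trans[OF sum_abs])
    fix i j
    have "0 \<le> (\<bar>v $ i\<bar> - \<bar>v $ j\<bar>)\<^sup>2" by simp
    then have "\<bar>v $ i\<bar> * \<bar>v $ j\<bar> \<le> ((v $ i)\<^sup>2 + (v $ j)\<^sup>2) / 2" by (simp add: power2_diff)
    then have "\<bar>A $ i $ j\<bar> * (\<bar>v $ i\<bar> * \<bar>v $ j\<bar>) \<le> \<eta> * (((v $ i)\<^sup>2 + (v $ j)\<^sup>2) / 2)"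
      using A \<open>\<eta> \<ge> 0\<close> by (rule_tac mult_mono) auto
    then show "\<bar>v $ i * (A $ i $ j * v $ j)\<bar> \<le> \<eta> * (((v $ i)\<^sup>2 + (v $ j)\<^sup>2) / 2)"
      by (simp add: abs_mult mult_ac)
  qed
  also have "\<dots> = \<eta> * real CARD('n) * (\<Sum>i\<in>UNIV. (v $ i)\<^sup>2)"
    by (simp add: sum_distrib_left[symmetric] sum_divide_distrib[symmetric] sum.distrib)
  finally show ?thesis .
qed

context logistic_asymptotics
begin

text \<open>With \<open>A (b - \<beta>0) = - U\<close>, the Wald statistic at \<open>b\<close> is \<open>n U \<bullet> wald_form M A b U\<close>.\<close>
definition wald_form :: "real ^ 'r ^ 'p \<Rightarrow> real ^ 'p ^ 'p \<Rightarrow> real ^ 'p \<Rightarrow> real ^ 'p ^ 'p" where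
  "wald_form M A \<beta> = transpose (matrix_inv A) ** M ** matrix_inv (transpose M ** Sigma_mat H l \<beta> ** M)
     ** transpose M ** matrix_inv A"

lemma wald_form_inner:
  "v \<bullet> (wald_form M A \<beta> *v v) = (transpose M *v (matrix_inv A *v v)) \<bullet>
     (matrix_inv (transpose M ** Sigma_mat H l \<beta> ** M) *v (transpose M *v (matrix_inv A *v v)))"
proof -
  have "v \<bullet> (wald_form M A \<beta> *v v) = (matrix_inv A *v v) \<bullet> (M *v (matrix_inv (transpose M ** Sigma_mat H l \<beta> ** M) *v
      (transpose M *v (matrix_inv A *v v))))"
    by (simp only: wald_form_def matrix_vector_mul_assoc[symmetric] inner_transpose_mult)
  then show ?thesis
    using inner_transpose_mult[of _ "transpose M"] by (simp only: transpose_transpose)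
qed

lemma wald_statistic_eq:
  fixes M :: "real ^ 'r ^ 'p"
  assumes "det A \<noteq> 0" "A *v (b - \<beta>0) = - u"
  shows "wald_statistic H l M (transpose M *v \<beta>0) n b = real n * (u \<bullet> (wald_form M A b *v u))"
proof -
  have inv: "invertible A" using assms(1) by (simp add: invertible_det_nz)
  have "b - \<beta>0 = matrix_inv A *v (A *v (b - \<beta>0))"
    by (simp add: matrix_vector_mul_assoc matrix_inv_inverse[OF inv])
  also have "\<dots> = - (matrix_inv A *v u)"
    unfolding assms(2) using matrix_vector_mult_diff_distrib[of "matrix_inv A" 0 u] by simp
  finally have "b - \<beta>0 = - (matrix_inv A *v u)" .
  then have "transpose M *v b - transpose M *v \<beta>0 = - (transpose M *v (matrix_inv A *v u))"
    using matrix_vector_mult_diff_distrib[of "transpose M" b \<beta>0] matrix_vector_mult_diff_distrib[of "transpose M" 0 "matrix_inv A *v u"]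
    by simp
  moreover have "(- w) \<bullet> (C *v (- w)) = w \<bullet> (C *v w)" for w :: "real ^ 'r" and C
    using matrix_vector_mult_diff_distrib[of C 0 w] by simp
  ultimately show ?thesis unfolding wald_statistic_def wald_form_inner by (simp only:)
qed

text \<open>Joint continuity at the limiting matrix and \<beta>0 in epsilon-delta form. It holds
  because both matrices that get inverted are nonsingular there.\<close>

lemma wald_form_close:
  fixes M :: "real ^ 'r ^ 'p"
  assumes full_rank: "rank M = CARD('r)" and "\<eta> > 0"
  obtains d where "d > 0" "\<And>A \<beta>. (\<And>i j. \<bar>A $ i $ j - J_mat H l \<beta>0 $ i $ j\<bar> < d) \<Longrightarrow> norm (\<beta> - \<beta>0) < d \<Longrightarrow>
      det A \<noteq> 0 \<and> (\<forall>i j. \<bar>wald_form M A \<beta> $ i $ j - wald_form M (J_mat H l \<beta>0) \<beta>0 $ i $ j\<bar> < \<eta>)"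
proof -
  define J where "J = J_mat H l \<beta>0"
  have B: "det (transpose M ** Sigma_mat H l \<beta>0 ** M) \<noteq> 0"
    by (rule positive_matrix_det_nz) (rule wald_middle_pos(2)[OF full_rank])
  let ?F = "nhds (J, \<beta>0)"
  have fst: "((\<lambda>p. fst p $ i $ j) \<longlongrightarrow> J $ i $ j) ?F" for i j
    using tendsto_fst[OF tendsto_ident_at[of "(J, \<beta>0)" UNIV]] tendsto_at_iff_tendsto_nhds[of fst "(J, \<beta>0)"]
    by (auto intro!: tendsto_vec_nth)
  have snd: "((\<lambda>p. snd p) \<longlongrightarrow> \<beta>0) ?F"
    using tendsto_snd[OF tendsto_ident_at[of "(J, \<beta>0)" UNIV]] tendsto_at_iff_tendsto_nhds[of snd "(J, \<beta>0)"]
    by auto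
  have Sigma: "((\<lambda>p. Sigma_mat H l (snd p) $ i $ j) \<longlongrightarrow> Sigma_mat H l \<beta>0 $ i $ j) ?F" for i j
    by (rule filterlim_compose[OF tendsto_Sigma_mat snd])
  have det: "((\<lambda>p. det (fst p)) \<longlongrightarrow> det J) ?F" by (rule tendsto_det[OF fst])
  have J_nz: "det J \<noteq> 0" unfolding J_def by (rule det_J_mat)
  have inv: "((\<lambda>p. matrix_inv (fst p) $ i $ j) \<longlongrightarrow> matrix_inv J $ i $ j) ?F" for i j
    by (rule tendsto_matrix_inv[OF fst J_nz])
  have mid: "((\<lambda>p. matrix_inv (transpose M ** Sigma_mat H l (snd p) ** M) $ i $ j) \<longlongrightarrow>
      matrix_inv (transpose M ** Sigma_mat H l \<beta>0 ** M) $ i $ j) ?F" for i j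
    unfolding matrix_mult_component
    by (rule tendsto_matrix_inv[OF _ B]) (unfold matrix_mult_component, intro tendsto_intros Sigma)
  have "((\<lambda>p. wald_form M (fst p) (snd p) $ i $ j) \<longlongrightarrow> wald_form M J \<beta>0 $ i $ j) ?F" for i j
    unfolding wald_form_def matrix_mult_component transpose_def vec_lambda_beta
    by (intro tendsto_intros inv mid[unfolded transpose_def])
  then have "\<forall>\<^sub>F p in ?F. dist (wald_form M (fst p) (snd p) $ i $ j) (wald_form M J \<beta>0 $ i $ j) < \<eta>" for i j
    using \<open>\<eta> > 0\<close> by (rule tendstoD)
  then have "\<forall>\<^sub>F p in ?F. \<forall>i j. dist (wald_form M (fst p) (snd p) $ i $ j) (wald_form M J \<beta>0 $ i $ j) < \<eta>"
    by (simp add: eventually_all_finite)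
  moreover have "\<forall>\<^sub>F p in ?F. det (fst p) \<noteq> 0" using det J_nz by (rule tendsto_imp_eventually_ne)
  ultimately have "\<forall>\<^sub>F p in ?F. det (fst p) \<noteq> 0 \<and> (\<forall>i j. dist (wald_form M (fst p) (snd p) $ i $ j) (wald_form M J \<beta>0 $ i $ j) < \<eta>)"
    by eventually_elim simp
  then obtain d where d: "d > 0" "\<And>p. dist p (J, \<beta>0) < d \<Longrightarrow>
      det (fst p) \<noteq> 0 \<and> (\<forall>i j. dist (wald_form M (fst p) (snd p) $ i $ j) (wald_form M J \<beta>0 $ i $ j) < \<eta>)"
    unfolding eventually_nhds_metric by blast
  \<comment> \<open>The second bound lets all entries together contribute less than
    \<open>d / 2\<close> to the norm of the matrix difference; the first serves \<beta>.\<close>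
  define d' where "d' = min (d / 2) (d / 2 / (real CARD('p) * real CARD('p)))"
  show ?thesis
  proof (rule that)
    show "d' > 0" using d(1) by (simp add: d'_def)
    fix A \<beta> assume A: "\<And>i j. \<bar>A $ i $ j - J_mat H l \<beta>0 $ i $ j\<bar> < d'" and \<beta>: "norm (\<beta> - \<beta>0) < d'"
    have "norm (A - J) < d / 2"
      by (rule norm_matrix_less) (use A in \<open>simp add: d'_def J_def\<close>)
    moreover have "norm (\<beta> - \<beta>0) < d / 2" using \<beta> by (simp add: d'_def)
    moreover have "dist (A, \<beta>) (J, \<beta>0) \<le> dist A J + dist \<beta> \<beta>0"
      unfolding dist_Pair_Pair by (rule sqrt_sum_squares_le_sum) simp_all
    ultimately have "dist (A, \<beta>) (J, \<beta>0) < d" by (simp add: dist_norm)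
    from d(2)[OF this] show "det A \<noteq> 0 \<and> (\<forall>i j. \<bar>wald_form M A \<beta> $ i $ j - wald_form M (J_mat H l \<beta>0) \<beta>0 $ i $ j\<bar> < \<eta>)"
      by (simp add: dist_real_def J_def)
  qed
qed

text \<open>The difference is a quadratic form in \<open>U\<close> with arbitrarily small
  coefficients, hence at most a small multiple of \<open>n\<close> times the squared norm of
  \<open>U\<close>. The latter has bounded mean, so \<open>whp_dominated_by_bounded\<close>
  applies.\<close>

lemma whp_wald_close:
  fixes M :: "real ^ 'r ^ 'p"
  assumes full_rank: "rank M = CARD('r)" and est: "estimating b" and "\<delta> > 0"
  shows "whp (\<lambda>n \<omega>. \<bar>wald_statistic H l M (transpose M *v \<beta>0) n (b n \<omega>)
    - real n * (U n \<omega> \<bullet> (wald_form M (J_mat H l \<beta>0) \<beta>0 *v U n \<omega>))\<bar> \<le> \<delta>)"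
proof -
  define p where "p = real CARD('p)"
  have p: "p > 0" by (simp add: p_def)
  define T where "T n \<omega> = (\<Sum>i\<in>UNIV. real n * (U n \<omega> \<bullet> axis i 1)\<^sup>2)" for n \<omega>
  define \<tau> where "\<tau> = (\<Sum>i\<in>UNIV. axis i 1 \<bullet> (K_mat H l \<beta>0 *v axis i 1))"
  have \<tau>: "\<tau> \<ge> 0"
    unfolding \<tau>_def K_mat_eq by (intro sum_nonneg less_imp_le gram_pos[OF K_gram weights_pos(2)]) simp
  show ?thesis
  proof (rule whp_dominated_by_bounded[of _ T \<tau>])
    show "integrable P (T n)" for n
      unfolding T_def using expectation_score_square(1)[of n] by (cases "n = 0") auto
    show "expectation (T n) \<le> \<tau>" for n
    proof (cases "n = 0")
      case True
      have "T 0 = (\<lambda>\<omega>. 0)" by (simp add: T_def fun_eq_iff)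
      then show ?thesis using \<tau> True by simp
    next
      case False
      then show ?thesis
        unfolding T_def \<tau>_def using expectation_score_square[of n] by (simp add: Bochner_Integration.integral_sum)
    qed
    show "T n \<omega> \<ge> 0" for n \<omega> unfolding T_def by (intro sum_nonneg) simp
    show "\<delta> > 0" by fact
    fix \<eta> :: real assume "\<eta> > 0"
    then have "\<eta> / p > 0" using p by simp
    from wald_form_close[OF full_rank this] obtain d where d: "d > 0"
      "\<And>A \<beta>. (\<And>i j. \<bar>A $ i $ j - J_mat H l \<beta>0 $ i $ j\<bar> < d) \<Longrightarrow> norm (\<beta> - \<beta>0) < d \<Longrightarrow>
      det A \<noteq> 0 \<and> (\<forall>i j. \<bar>wald_form M A \<beta> $ i $ j - wald_form M (J_mat H l \<beta>0) \<beta>0 $ i $ j\<bar> < \<eta> / p)"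
      by metis
    show "whp (\<lambda>n \<omega>. \<bar>wald_statistic H l M (transpose M *v \<beta>0) n (b n \<omega>)
      - real n * (U n \<omega> \<bullet> (wald_form M (J_mat H l \<beta>0) \<beta>0 *v U n \<omega>))\<bar> \<le> \<eta> * T n \<omega>)"
    proof (rule whp_mono[OF whp_linearization[OF est d(1)]], elim conjE exE)
      fix n \<omega> A
      assume near: "norm (b n \<omega> - \<beta>0) < d" and A: "\<forall>j k. \<bar>A $ j $ k - J_mat H l \<beta>0 $ j $ k\<bar> < d"
        and lin: "A *v (b n \<omega> - \<beta>0) = - U n \<omega>"
      have dA: "det A \<noteq> 0" and close: "\<And>i j. \<bar>wald_form M A (b n \<omega>) $ i $ j - wald_form M (J_mat H l \<beta>0) \<beta>0 $ i $ j\<bar> < \<eta> / p"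
        using d(2)[of A "b n \<omega>"] A near by blast+
      let ?E = "wald_form M A (b n \<omega>) - wald_form M (J_mat H l \<beta>0) \<beta>0"
      have "wald_statistic H l M (transpose M *v \<beta>0) n (b n \<omega>) - real n * (U n \<omega> \<bullet> (wald_form M (J_mat H l \<beta>0) \<beta>0 *v U n \<omega>))
        = real n * (U n \<omega> \<bullet> (?E *v U n \<omega>))"
        unfolding wald_statistic_eq[OF dA lin] by (simp add: matrix_vector_mult_diff_rdistrib inner_diff_right right_diff_distrib)
      also have "\<bar>\<dots>\<bar> \<le> real n * (\<eta> / p * p * (\<Sum>i\<in>UNIV. (U n \<omega> $ i)\<^sup>2))"
        unfolding abs_mult abs_of_nat p_def
        using close p \<open>\<eta> > 0\<close>
        by (intro mult_left_mono abs_quadratic_form_le) (auto simp: p_def intro: less_imp_le)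
      also have "\<dots> = \<eta> * T n \<omega>"
        using p by (simp add: T_def inner_axis sum_distrib_left mult_ac)
      finally show "\<bar>wald_statistic H l M (transpose M *v \<beta>0) n (b n \<omega>)
        - real n * (U n \<omega> \<bullet> (wald_form M (J_mat H l \<beta>0) \<beta>0 *v U n \<omega>))\<bar> \<le> \<eta> * T n \<omega>" .
    qed
  qed
qed

text \<open>The vectors \<open>w j = J^-1 M (e j)\<close> are orthonormal for \<open>K\<close>
  because the \<open>e j\<close> are orthonormal for \<open>M^T J^-1 K J^-1 M\<close>. Hence the
  combination of the \<open>w j\<close> with coefficients \<open>t j\<close> has as its
  \<open>K\<close> form the sum of the squares of the \<open>t j\<close>, the exponent of a standard
  normal characteristic function.\<close>

lemma wald_weak_conv:
  fixes M :: "real ^ 'r ^ 'p"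
  assumes full_rank: "rank M = CARD('r)" and est: "estimating b"
    and b_meas: "\<And>n. b n \<in> borel_measurable P"
  shows "weak_conv_m (\<lambda>n. distr P borel (\<lambda>\<omega>. wald_statistic H l M (transpose M *v \<beta>0) n (b n \<omega>)))
    (chi_square CARD('r))"
proof -
  define r where "r = CARD('r)"
  let ?Ji = "matrix_inv (J_mat H l \<beta>0)"
  define B where "B = transpose M ** Sigma_mat H l \<beta>0 ** M"
  obtain e :: "nat \<Rightarrow> real ^ 'r" where
    e: "\<And>i j. i < r \<Longrightarrow> j < r \<Longrightarrow> e i \<bullet> (B *v e j) = (if i = j then 1 else 0)"
    and sq: "\<And>a. a \<bullet> (matrix_inv B *v a) = (\<Sum>j<r. (e j \<bullet> a)\<^sup>2)"
    using positive_symmetric_inverse_sum_squares[OF wald_middle_pos[OF full_rank]] unfolding B_def r_def by metis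
  define w where "w j = ?Ji *v (M *v e j)" for j
  have w: "e j \<bullet> (transpose M *v (?Ji *v v)) = v \<bullet> w j" for j v
    unfolding w_def inner_transpose_mult
    using inner_transpose_mult[of "M *v e j" ?Ji v] unfolding transpose_J_inv by (simp add: inner_commute)
  have form: "real n * (U n \<omega> \<bullet> (wald_form M (J_mat H l \<beta>0) \<beta>0 *v U n \<omega>)) = (\<Sum>j<r. (sqrt (real n) * (U n \<omega> \<bullet> w j))\<^sup>2)" for n \<omega>
    unfolding wald_form_inner B_def[symmetric] sq w by (simp add: power_mult_distrib sum_distrib_left)
  have wK: "w i \<bullet> (K_mat H l \<beta>0 *v w j) = (if i = j then 1 else 0)" if "i < r" "j < r" for i j
  proof -
    have "e i \<bullet> (B *v e j) = e i \<bullet> (transpose M *v (?Ji *v (K_mat H l \<beta>0 *v w j)))"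
      unfolding B_def Sigma_mat_def w_def by (simp only: matrix_vector_mul_assoc matrix_mul_assoc)
    also have "\<dots> = w i \<bullet> (K_mat H l \<beta>0 *v w j)" unfolding w by (rule inner_commute)
    finally show ?thesis using e[OF that] by simp
  qed
  show ?thesis
    unfolding r_def[symmetric]
  proof (rule weak_conv_chi_square)
    show "(\<lambda>\<omega>. sqrt (real n) * (U n \<omega> \<bullet> w j)) \<in> borel_measurable P" for n j
      using U_measurable by measurable
    show "(\<lambda>\<omega>. wald_statistic H l M (transpose M *v \<beta>0) n (b n \<omega>)) \<in> borel_measurable P" for n
      by (rule wald_measurable[OF b_meas])
    show "whp (\<lambda>n \<omega>. \<bar>wald_statistic H l M (transpose M *v \<beta>0) n (b n \<omega>) - (\<Sum>j<r. (sqrt (real n) * (U n \<omega> \<bullet> w j))\<^sup>2)\<bar> \<le> \<delta>)"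
      if "\<delta> > 0" for \<delta>
      unfolding form[symmetric] by (rule whp_wald_close[OF full_rank est that])
    fix t :: "nat \<Rightarrow> real"
    define u where "u = (\<Sum>j<r. t j *\<^sub>R w j)"
    have lin: "(\<Sum>j<r. t j * (sqrt (real n) * (U n \<omega> \<bullet> w j))) = sqrt (real n) * (U n \<omega> \<bullet> u)" for n \<omega>
      by (simp add: u_def inner_sum_right sum_distrib_left mult_ac)
    have K_sum: "K_mat H l \<beta>0 *v u = (\<Sum>j<r. t j *\<^sub>R (K_mat H l \<beta>0 *v w j))"
      unfolding u_def by (simp add: linear_sum[OF matrix_vector_mul_linear] matrix_vector_mult_scaleR)
    have u_inner: "u \<bullet> v = (\<Sum>i<r. t i * (w i \<bullet> v))" for v
      by (simp add: u_def inner_sum_left)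
    have "u \<bullet> (K_mat H l \<beta>0 *v u) = (\<Sum>i<r. \<Sum>j<r. t i * (t j * (w i \<bullet> (K_mat H l \<beta>0 *v w j))))"
      unfolding K_sum u_inner inner_sum_right inner_scaleR_right sum_distrib_left
      by (subst sum.swap) (simp only: mult.left_commute)
    also have "\<dots> = (\<Sum>i<r. \<Sum>j<r. if j = i then t i * t i else 0)"
      by (intro sum.cong refl) (simp add: wK)
    also have "\<dots> = (\<Sum>i<r. (t i)\<^sup>2)" by (simp add: power2_eq_square)
    finally have "u \<bullet> (K_mat H l \<beta>0 *v u) = (\<Sum>i<r. (t i)\<^sup>2)" .
    with score_characteristic_tendsto[of u]
    show "(\<lambda>n. \<integral>\<omega>. iexp (\<Sum>j<r. t j * (sqrt (real n) * (U n \<omega> \<bullet> w j))) \<partial>P)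
        \<longlonglongrightarrow> of_real (exp (- (\<Sum>j<r. (t j)\<^sup>2) / 2))"
      unfolding lin by simp
  qed
qed

end

text \<open>At the parameter zero the weight of the \<open>J\<close> integrand is a constant
  \<open>c > 0\<close>, so the diagonal entries give the second moments. If the covariates lay
  almost surely in a hyperplane, almost surely no design matrix would reach full rank.\<close>

lemma logistic_asymptoticsI:
  fixes X :: "nat \<Rightarrow> 'a \<Rightarrow> real ^ 'p"
  assumes sample: "logistic_regression_sample P X Y H i0 \<beta>0"
    and design: "AE \<omega> in P. \<forall>\<^sub>F n in sequentially. design_rank n (\<lambda>i. X i \<omega>) = CARD('p)"
    and J_exists: "set_integrable H (measure_support H) (J_integrand l 0)"
    and lambda: "l \<ge> 0"
  shows "logistic_asymptotics P X Y H i0 \<beta>0 l"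
proof -
  interpret logistic_regression_sample P X Y H i0 \<beta>0 by (rule sample)
  have [measurable]: "X i \<in> borel_measurable P" for i by (rule X_measurable)
  have sets_H: "sets H = sets borel" using X_distr[of 0] by (metis sets_distr)
  have meas_H: "measurable H N = measurable borel N" for N by (rule measurable_cong_sets[OF sets_H refl])
  show ?thesis
  proof
    show "l \<ge> 0" by (rule lambda)
    define c where "c = score_weight l 0 * (logistic 0 * (1 - logistic 0))"
    have c: "c > 0" using score_weight_pos[of l 0] logistic_bounds[of 0] by (simp add: c_def)
    have "integrable H (\<lambda>x. (x $ j)\<^sup>2)" for j :: 'p
    proof -
      have bl: "bounded_linear (\<lambda>A :: real ^ 'p ^ 'p. A $ j $ j)"
        by (rule bounded_linear_compose[OF bounded_linear_vec_nth bounded_linear_vec_nth])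
      have "integrable H (\<lambda>x. indicator (measure_support H) x *\<^sub>R J_integrand l 0 x)"
        using J_exists unfolding set_integrable_def .
      from integrable_bounded_linear[OF bl this]
      have "integrable H (\<lambda>x. indicator (measure_support H) x * (c * (x $ j)\<^sup>2))"
        by (simp add: J_integrand_eq c_def power2_eq_square mult.assoc)
      \<comment> \<open>The support carries all the mass of \<open>H\<close>, so the indicator may
        be dropped.\<close>
      then have "integrable H (\<lambda>x. c * (x $ j)\<^sup>2)"
      proof (rule integrable_cong_AE_imp)
        show "(\<lambda>x. c * (x $ j)\<^sup>2) \<in> borel_measurable H"
          unfolding meas_H by (intro borel_measurable_continuous_onI continuous_intros)
        show "AE x in H. indicator (measure_support H) x * (c * (x $ j)\<^sup>2) = c * (x $ j)\<^sup>2"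
          using measure_support_full(2)[OF sets_H] by eventually_elim simp
      qed
      then show ?thesis using c by simp
    qed
    then have "integrable H (\<lambda>x. \<Sum>j\<in>UNIV. (x $ j)\<^sup>2)" by simp
    moreover have "(norm x)\<^sup>2 = (\<Sum>j\<in>UNIV. (x $ j)\<^sup>2)" for x :: "real ^ 'p"
      unfolding power2_norm_eq_inner by (simp add: inner_vec_def power2_eq_square)
    ultimately show "integrable H (\<lambda>x. (norm x)\<^sup>2)" by simp
  next
    fix u :: "real ^ 'p" assume "u \<noteq> 0"
    show "\<not> (AE x in H. x \<bullet> u = 0)"
    proof
      assume orth: "AE x in H. x \<bullet> u = 0"
      have "AE \<omega> in P. X i \<omega> \<bullet> u = 0" for i
        using orth by (subst (asm) X_distr[symmetric, of i], intro AE_distrD[of "X i"]) auto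
      then have "AE \<omega> in P. \<forall>i. X i \<omega> \<bullet> u = 0" by (simp add: AE_all_countable)
      with design have "AE \<omega> in P. False"
      proof eventually_elim
        case (elim \<omega>)
        then obtain n where n: "design_rank n (\<lambda>i. X i \<omega>) = CARD('p)"
          by (auto simp: eventually_sequentially)
        have "dim ((\<lambda>i. X i \<omega>) ` {..<n}) \<le> dim {x. u \<bullet> x = 0}"
          using elim(2) by (intro dim_subset) (auto simp: inner_commute)
        also have "\<dots> = DIM(real ^ 'p) - 1" using \<open>u \<noteq> 0\<close> by (rule dim_hyperplane)
        also have "\<dots> < CARD('p)" by simp
        finally show False using n by (simp add: design_rank_def)
      qed
      then show False by simp
    qed
  qed
qed

theorem theorem6:
  fixes P :: "'a measure" and X :: "nat \<Rightarrow> 'a \<Rightarrow> real ^ 'p" and Y :: "nat \<Rightarrow> 'a \<Rightarrow> real"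
    and H :: "(real ^ 'p) measure" and i0 :: 'p and \<beta>0 :: "real ^ 'p"
    and l :: real and M :: "real ^ 'r ^ 'p" and m :: "real ^ 'r"
    and \<beta>hat :: "nat \<Rightarrow> 'a \<Rightarrow> real ^ 'p"
  assumes sample: "logistic_regression_sample P X Y H i0 \<beta>0"
    and design: "AE \<omega> in P. \<forall>\<^sub>F n in sequentially. design_rank n (\<lambda>i. X i \<omega>) = CARD('p)"
    and J_exists: "\<And>\<beta>. set_integrable H (measure_support H) (J_integrand l \<beta>)"
    and K_exists: "\<And>\<beta>. set_integrable H (measure_support H) (K_integrand l \<beta>)"
    and lambda: "l \<ge> 0"
    and est_measurable: "\<And>n. \<beta>hat n \<in> borel_measurable P"
    and estimator: "\<And>n. AE \<omega> in P. (\<exists>b. is_mdpde l n (\<lambda>i. X i \<omega>) (\<lambda>i. Y i \<omega>) b)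
        \<longrightarrow> is_mdpde l n (\<lambda>i. X i \<omega>) (\<lambda>i. Y i \<omega>) (\<beta>hat n \<omega>)"
    and full_rank: "rank M = CARD('r)"
    and null_hypothesis: "transpose M *v \<beta>0 = m"
  shows "weak_conv_m (\<lambda>n. distr P borel (\<lambda>\<omega>. wald_statistic H l M m n (\<beta>hat n \<omega>)))
           (chi_square CARD('r))"
proof -
  interpret logistic_asymptotics P X Y H i0 \<beta>0 l
    by (rule logistic_asymptoticsI[OF sample design J_exists lambda])
  have "estimating \<beta>hat" unfolding estimating_def using estimator by blast
  from wald_weak_conv[OF full_rank this est_measurable] show ?thesis unfolding null_hypothesis .
qed

end
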